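(* Let $\phi,\psi\in L^2(\Omega,\mu)\cap L^\infty(\Omega,\mu)$ with $\|\phi\|_{2,\mu}=\|\psi\|_{2,\mu}=1$ and $\|\phi\|_\infty\|\psi\|_\infty=1$. Let $\sigma\in L^p(\Omega,\mu)$, $1\le p\le\infty$, let $S,\Sigma\subset\Omega$ be measurable with $0<\mu(S),\mu(\Sigma)<\infty$, and let $\varepsilon_1,\varepsilon_2\in(0,1)$ with $\varepsilon_1+\varepsilon_2<1$. (1) The wavelet multiplier $\overline{\psi}F_\sigma\phi:L^2(\Omega,\mu)\to L^2(\Omega,\mu)$ is in the Schatten class $S_p$ and $$\|\overline{\psi}F_\sigma\phi\|_{S_p}\le c_{\mathcal{K}}^{\frac{2}{p}}\,\|\sigma\|_{p,\mu}.$$ (2) If a nonzero function $f\in L^2(\Omega,\mu)$ is $\varepsilon_1$-localized with respect to $\overline{\psi}F_S\phi$ and $\varepsilon_2$-localized with respect to $\overline{\psi}F_\Sigma\phi$, then $$\mu(S)\mu(\Sigma)\ge c_{\mathcal{K}}^{-4}(1-\varepsilon_1-\varepsilon_2).$$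
   Context: Setting: $\Omega\subset\mathbb{R}^d$ is a convex cone ($\lambda x\in\Omega$ for all $\lambda>0$, $x\in\Omega$) with non-empty interior, endowed with a Borel measure $\mu$, absolutely continuous with respect to Lebesgue measure, with polar decomposition $d\mu(r\zeta)=r^{2a-1}\,dr\,Q(\zeta)\,d\omega(\zeta)$, where $a>0$, $d\omega$ is the surface measure on the unit sphere $\mathbb{S}^{d-1}$, and $Q\in L^1(\mathbb{S}^{d-1},d\omega)$, $Q\ne 0$ (so $\mu$ is homogeneous of degree $2a$). $\|\cdot\|_{p,\mu}$ is the norm of $L^p(\Omega,\mu)$ (with $\|\cdot\|_{\infty,\mu}=\|\cdot\|_\infty$ the essential supremum norm) and $\langle f,g\rangle_\mu=\int_\Omega f\overline{g}\,d\mu$. The kernel $\mathcal{K}:\Omega\times\Omega\to\mathbb{C}$ is continuous, bounded ($|\mathcal{K}(x,\xi)|\le c_{\mathcal{K}}$) and homogeneous ($\mathcal{K}(\lambda x,\xi)=\mathcal{K}(x,\lambda\xi)$ for $\lambda>0$). The operator $\mathcal{T}$ is $\mathcal{T}f(\xi)=\int_\Omega f(x)\mathcal{K}(x,\xi)\,d\mu(x)$. It is assumed that (i) (inversion) if $f,\mathcal{T}f\in L^1(\Omega,\mu)$ then $f$ is continuous and $f(x)=\int_\Omega\mathcal{T}f(\xi)\overline{\mathcal{K}(x,\xi)}\,d\mu(\xi)$ for almost every $x$; (ii) (Parseval) $\langle\mathcal{T}f,\mathcal{T}g\rangle_\mu=\langle f,g\rangle_\mu$ for Schwartz functions $f,g$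 on $\Omega$; in particular $\mathcal{T}$ extends to a unitary operator of $L^2(\Omega,\mu)$ onto itself, with $\mathcal{T}^{-1}f=\overline{\mathcal{T}\overline{f}}$. The wavelet multiplier $\overline{\psi}F_\sigma\phi$ is the operator on $L^2(\Omega,\mu)$ defined weakly by $\langle(\overline{\psi}F_\sigma\phi)f,g\rangle_\mu=\int_\Omega\sigma\,\mathcal{T}(\phi f)\,\overline{\mathcal{T}(\psi g)}\,d\mu$ for $f,g\in L^2(\Omega,\mu)$; for $\sigma=\chi_A$ one writes $F_A$ for $F_\sigma$. For $1\le p<\infty$, $S_p$ is the space of compact operators on $L^2(\Omega,\mu)$ whose singular values lie in $\ell_p$, normed by the $\ell_p$ norm of the singular values; $S_\infty$ is the space of bounded operators with the operator norm; $c_{\mathcal{K}}^{2/p}=1$ for $p=\infty$. A nonzero $f\in L^2(\Omega,\mu)$ is $\varepsilon$-localized with respect to a bounded operator $L$ if $\|Lf-f\|_{2,\mu}\le\varepsilon\|f\|_{2,\mu}$. *)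

theory Defs
  imports "HOL-Probability.Probability"
begin

section \<open>Lebesgue spaces\<close>

text \<open>
  Elements of \<open>L\<^sup>p(M)\<close> are represented by measurable functions; equality in \<open>L\<^sup>p(M)\<close> is
  equality almost everywhere.
\<close>

definition Lp_space :: "ennreal \<Rightarrow> 'a measure \<Rightarrow> ('a \<Rightarrow> complex) set" where
  "Lp_space p M =
     {f \<in> borel_measurable M.
        if p = \<infinity> then esssup M (\<lambda>x. ennreal (norm (f x))) < \<infinity>
        else integrable M (\<lambda>x. norm (f x) powr enn2real p)}"

definition Lp_norm :: "ennreal \<Rightarrow> 'a measure \<Rightarrow> ('a \<Rightarrow> complex) \<Rightarrow> real" where
  "Lp_norm p M f =
     (if p = \<infinity> then enn2real (esssup M (\<lambda>x. ennreal (norm (f x))))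
      else (LINT x|M. norm (f x) powr enn2real p) powr (1 / enn2real p))"

definition L2_inner :: "'a measure \<Rightarrow> ('a \<Rightarrow> complex) \<Rightarrow> ('a \<Rightarrow> complex) \<Rightarrow> complex" where
  "L2_inner M f g = (LINT x|M. f x * cnj (g x))"


section \<open>Operators on \<open>L\<^sup>2(M)\<close> and Schatten classes\<close>

text \<open>
  A map that satisfies the following condition respects equality almost everywhere
  (linearity and boundedness force \<open>A f = A g\<close> a.e. whenever \<open>f = g\<close> a.e.), so it is a bounded
  linear operator on the space of equivalence classes.
\<close>

definition L2_bounded_op :: "'a measure \<Rightarrow> (('a \<Rightarrow> complex) \<Rightarrow> ('a \<Rightarrow> complex)) \<Rightarrow> bool" where
  "L2_bounded_op M A \<longleftrightarrow>
     (\<forall>f\<in>Lp_space 2 M. A f \<in> Lp_space 2 M) \<and>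
     (\<forall>f\<in>Lp_space 2 M. \<forall>g\<in>Lp_space 2 M. \<forall>b c.
        AE x in M. A (\<lambda>y. b * f y + c * g y) x = b * A f x + c * A g x) \<and>
     (\<exists>C. \<forall>f\<in>Lp_space 2 M. Lp_norm 2 M (A f) \<le> C * Lp_norm 2 M f)"

definition L2_opnorm :: "'a measure \<Rightarrow> (('a \<Rightarrow> complex) \<Rightarrow> ('a \<Rightarrow> complex)) \<Rightarrow> real" where
  "L2_opnorm M A =
     Inf {C. 0 \<le> C \<and> (\<forall>f\<in>Lp_space 2 M. Lp_norm 2 M (A f) \<le> C * Lp_norm 2 M f)}"

definition L2_compact_op :: "'a measure \<Rightarrow> (('a \<Rightarrow> complex) \<Rightarrow> ('a \<Rightarrow> complex)) \<Rightarrow> bool" where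
  "L2_compact_op M A \<longleftrightarrow>
     L2_bounded_op M A \<and>
     (\<forall>F :: nat \<Rightarrow> 'a \<Rightarrow> complex.
        (\<forall>n. F n \<in> Lp_space 2 M \<and> Lp_norm 2 M (F n) \<le> 1) \<longrightarrow>
        (\<exists>r. \<exists>g\<in>Lp_space 2 M. strict_mono r \<and>
           (\<lambda>n. Lp_norm 2 M (\<lambda>x. A (F (r n)) x - g x)) \<longlonglongrightarrow> 0))"

definition L2_adjoint ::
    "'a measure \<Rightarrow> (('a \<Rightarrow> complex) \<Rightarrow> ('a \<Rightarrow> complex)) \<Rightarrow> (('a \<Rightarrow> complex) \<Rightarrow> ('a \<Rightarrow> complex))" where
  "L2_adjoint M A =
     (SOME B. L2_bounded_op M B \<and>
        (\<forall>f\<in>Lp_space 2 M. \<forall>g\<in>Lp_space 2 M. L2_inner M (A f) g = L2_inner M f (B g)))"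

text \<open>
  The Hilbert space dimension of a closed subspace \<open>V\<close>, i.e. the maximal number of elements of an
  orthonormal system in \<open>V\<close> (\<open>\<infinity>\<close> if there are arbitrarily large finite ones). Distinct
  representatives of the same equivalence class are not orthogonal, so they cannot both occur.
\<close>

definition L2_dim :: "'a measure \<Rightarrow> ('a \<Rightarrow> complex) set \<Rightarrow> ennreal" where
  "L2_dim M V =
     (SUP F \<in> {F. finite F \<and> F \<subseteq> V \<and>
                  (\<forall>f\<in>F. \<forall>g\<in>F. L2_inner M f g = (if f = g then 1 else 0))}. of_nat (card F))"

text \<open>
  The singular values of a compact \<open>A\<close> are the eigenvalues \<open>s\<close> of \<open>(A\<^sup>*A)\<^bsup>1/2\<^esup>\<close>, i.e. the numbers
  \<open>s \<ge> 0\<close> such that \<open>s\<^sup>2\<close> is an eigenvalue of \<open>A\<^sup>*A\<close>; \<open>s\<close> is repeated as often as the dimension of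
  its eigenspace.
\<close>

definition singular_space ::
    "'a measure \<Rightarrow> (('a \<Rightarrow> complex) \<Rightarrow> ('a \<Rightarrow> complex)) \<Rightarrow> real \<Rightarrow> ('a \<Rightarrow> complex) set" where
  "singular_space M A s =
     {f \<in> Lp_space 2 M. AE x in M. L2_adjoint M A (A f) x = complex_of_real (s\<^sup>2) * f x}"

definition singular_multiplicity ::
    "'a measure \<Rightarrow> (('a \<Rightarrow> complex) \<Rightarrow> ('a \<Rightarrow> complex)) \<Rightarrow> real \<Rightarrow> ennreal" where
  "singular_multiplicity M A s = L2_dim M (singular_space M A s)"

text \<open>
  The sum of the \<open>p\<close>-th powers of the singular values, with multiplicity, as a sum over the
  distinct positive ones (numbers \<open>s\<close> that are not singular values have multiplicity \<open>0\<close>).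
\<close>

definition singular_power_sum ::
    "real \<Rightarrow> 'a measure \<Rightarrow> (('a \<Rightarrow> complex) \<Rightarrow> ('a \<Rightarrow> complex)) \<Rightarrow> ennreal" where
  "singular_power_sum p M A =
     (\<integral>\<^sup>+ s. singular_multiplicity M A s * ennreal (s powr p) \<partial>count_space {0<..})"

definition schatten_class ::
    "ennreal \<Rightarrow> 'a measure \<Rightarrow> (('a \<Rightarrow> complex) \<Rightarrow> ('a \<Rightarrow> complex)) set" where
  "schatten_class p M =
     (if p = \<infinity> then {A. L2_bounded_op M A}
      else {A. L2_compact_op M A \<and> singular_power_sum (enn2real p) M A < \<infinity>})"

definition schatten_norm ::
    "ennreal \<Rightarrow> 'a measure \<Rightarrow> (('a \<Rightarrow> complex) \<Rightarrow> ('a \<Rightarrow> complex)) \<Rightarrow> real" where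
  "schatten_norm p M A =
     (if p = \<infinity> then L2_opnorm M A
      else enn2real (singular_power_sum (enn2real p) M A) powr (1 / enn2real p))"


section \<open>Schwartz functions\<close>

primrec iterated_partial ::
    "'a::euclidean_space list \<Rightarrow> ('a \<Rightarrow> complex) \<Rightarrow> ('a \<Rightarrow> complex)" where
  "iterated_partial [] f = f"
| "iterated_partial (b # bs) f = (\<lambda>x. frechet_derivative (iterated_partial bs f) (at x) b)"

definition schwartz :: "('a::euclidean_space \<Rightarrow> complex) \<Rightarrow> bool" where
  "schwartz f \<longleftrightarrow>
     (\<forall>bs. set bs \<subseteq> Basis \<longrightarrow>
        iterated_partial bs f differentiable_on UNIV \<and>
        (\<forall>k::nat. bounded (range (\<lambda>x. norm x ^ k *\<^sub>R iterated_partial bs f x))))"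


section \<open>Surface measure of the unit sphere\<close>

text \<open>
  The surface measure of a Borel set \<open>A\<close> of the unit sphere is \<open>d\<close> times the Lebesgue measure of
  \<open>{r \<zeta> | 0 < r \<le> 1, \<zeta> \<in> A}\<close>. With this normalisation Lebesgue measure is
  \<open>r\<^bsup>d-1\<^esup> dr d\<omega>(\<zeta>)\<close> in polar coordinates.
\<close>

definition sphere_measure :: "'a::euclidean_space measure" where
  "sphere_measure =
     scale_measure (of_nat DIM('a))
       (distr (restrict_space lborel (cball 0 1 - {0})) (restrict_space borel (sphere 0 1))
          (\<lambda>x. x /\<^sub>R norm x))"

lemma space_sphere_measure: "space sphere_measure = sphere 0 1"
  by (simp add: sphere_measure_def space_restrict_space space_scale_measure)

lemma sets_sphere_measure: "sets sphere_measure = sets (restrict_space borel (sphere 0 1))"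
  by (simp add: sphere_measure_def)

lemma emeasure_sphere_measure:
  fixes A :: "'a::euclidean_space set"
  assumes "A \<in> sets borel" "A \<subseteq> sphere 0 1"
  shows "emeasure sphere_measure A =
    of_nat DIM('a) * emeasure lborel {x. 0 < norm x \<and> norm x \<le> 1 \<and> x /\<^sub>R norm x \<in> A}"
proof -
  have meas: "(\<lambda>x::'a. x /\<^sub>R norm x)
      \<in> restrict_space lborel (cball 0 1 - {0}) \<rightarrow>\<^sub>M restrict_space borel (sphere 0 1)"
    by (rule measurable_restrict_space2)
      (auto simp: space_restrict_space intro!: measurable_restrict_space1)
  have A: "A \<in> sets (restrict_space borel (sphere 0 1))"
    using assms by (auto simp: sets_restrict_space)
  have "(\<lambda>x::'a. x /\<^sub>R norm x) -` A \<inter> space (restrict_space lborel (cball 0 1 - {0}))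
      = {x. 0 < norm x \<and> norm x \<le> 1 \<and> x /\<^sub>R norm x \<in> A}"
    by (auto simp: space_restrict_space)
  then show ?thesis
    using meas A
    by (simp add: sphere_measure_def emeasure_distr)
       (subst emeasure_restrict_space, auto)
qed


section \<open>Integral operators with homogeneous kernel on a convex cone\<close>

definition integral_op ::
    "'a measure \<Rightarrow> ('a \<Rightarrow> 'a \<Rightarrow> complex) \<Rightarrow> ('a \<Rightarrow> complex) \<Rightarrow> ('a \<Rightarrow> complex)" where
  "integral_op M K f = (\<lambda>\<xi>. LINT x|M. f x * K x \<xi>)"

text \<open>
  The measure \<open>\<mu>\<close> lives on \<open>\<Omega>\<close>, with the Borel sets of the subspace \<open>\<Omega>\<close> as measurable sets.
  In \<open>inversion\<close>, continuity of an element of \<open>L\<^sup>1\<close> means that it has a continuous representative.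
  In \<open>parseval\<close>, a Schwartz function on \<open>\<Omega>\<close> is the restriction of one on the whole space; all
  integrals are over \<open>\<Omega>\<close>, so only the values on \<open>\<Omega>\<close> enter.
\<close>

locale homogeneous_transform =
  fixes \<Omega> :: "'a::euclidean_space set"
    and \<mu> :: "'a measure"
    and a :: real
    and Q :: "'a \<Rightarrow> real"
    and K :: "'a \<Rightarrow> 'a \<Rightarrow> complex"
    and c\<^sub>K :: real
  assumes convex_Omega: "convex \<Omega>"
    and cone_Omega: "\<And>t x. 0 < t \<Longrightarrow> x \<in> \<Omega> \<Longrightarrow> t *\<^sub>R x \<in> \<Omega>"
    and interior_Omega: "interior \<Omega> \<noteq> {}"
    and sets_mu: "sets \<mu> = sets (restrict_space borel \<Omega>)"
    and abs_continuous_mu: "\<And>B. B \<in> sets \<mu> \<Longrightarrow> B \<in> null_sets lebesgue \<Longrightarrow> emeasure \<mu> B = 0"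
    and a_pos: "0 < a"
    and integrable_Q: "integrable sphere_measure Q"
    and nonneg_Q: "AE \<zeta> in sphere_measure. 0 \<le> Q \<zeta>"
    and nonzero_Q: "\<not> (AE \<zeta> in sphere_measure. Q \<zeta> = 0)"
    and polar_mu: "\<And>B. B \<in> sets \<mu> \<Longrightarrow>
      emeasure \<mu> B =
        (\<integral>\<^sup>+ \<zeta>. (\<integral>\<^sup>+ r. indicator {0<..} r * indicator B (r *\<^sub>R \<zeta>) * ennreal (r powr (2 * a - 1)) \<partial>lborel)
                * ennreal (Q \<zeta>) \<partial>sphere_measure)"
    and continuous_K: "continuous_on (\<Omega> \<times> \<Omega>) (\<lambda>(x, \<xi>). K x \<xi>)"
    and bounded_K: "\<And>x \<xi>. x \<in> \<Omega> \<Longrightarrow> \<xi> \<in> \<Omega> \<Longrightarrow> norm (K x \<xi>) \<le> c\<^sub>K"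
    and homogeneous_K:
      "\<And>t x \<xi>. 0 < t \<Longrightarrow> x \<in> \<Omega> \<Longrightarrow> \<xi> \<in> \<Omega> \<Longrightarrow> K (t *\<^sub>R x) \<xi> = K x (t *\<^sub>R \<xi>)"
    and inversion: "\<And>f. integrable \<mu> f \<Longrightarrow> integrable \<mu> (integral_op \<mu> K f) \<Longrightarrow>
      (\<exists>g. continuous_on \<Omega> g \<and> (AE x in \<mu>. f x = g x)) \<and>
      (AE x in \<mu>. f x = (LINT \<xi>|\<mu>. integral_op \<mu> K f \<xi> * cnj (K x \<xi>)))"
    and parseval: "\<And>f g. schwartz f \<Longrightarrow> schwartz g \<Longrightarrow>
      L2_inner \<mu> (integral_op \<mu> K f) (integral_op \<mu> K g) = L2_inner \<mu> f g"


section \<open>Wavelet multipliers and localization\<close>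

text \<open>
  For \<open>\<phi>, f \<in> L\<^sup>2\<close> the product \<open>\<phi> f\<close> is in \<open>L\<^sup>1\<close>, so its transform is given by the
  integral. The weak identity determines \<open>L f\<close> up to equality almost everywhere.
\<close>

definition is_wavelet_multiplier ::
    "'a measure \<Rightarrow> ('a \<Rightarrow> 'a \<Rightarrow> complex) \<Rightarrow> ('a \<Rightarrow> complex) \<Rightarrow> ('a \<Rightarrow> complex) \<Rightarrow> ('a \<Rightarrow> complex) \<Rightarrow>
     (('a \<Rightarrow> complex) \<Rightarrow> ('a \<Rightarrow> complex)) \<Rightarrow> bool" where
  "is_wavelet_multiplier M K \<psi> \<sigma> \<phi> L \<longleftrightarrow>
     (\<forall>f\<in>Lp_space 2 M. L f \<in> Lp_space 2 M) \<and>
     (\<forall>f\<in>Lp_space 2 M. \<forall>g\<in>Lp_space 2 M.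
        L2_inner M (L f) g =
          (LINT \<xi>|M. \<sigma> \<xi> * integral_op M K (\<lambda>x. \<phi> x * f x) \<xi>
                        * cnj (integral_op M K (\<lambda>x. \<psi> x * g x) \<xi>)))"

definition wavelet_multiplier ::
    "'a measure \<Rightarrow> ('a \<Rightarrow> 'a \<Rightarrow> complex) \<Rightarrow> ('a \<Rightarrow> complex) \<Rightarrow> ('a \<Rightarrow> complex) \<Rightarrow> ('a \<Rightarrow> complex) \<Rightarrow>
     (('a \<Rightarrow> complex) \<Rightarrow> ('a \<Rightarrow> complex))" where
  "wavelet_multiplier M K \<psi> \<sigma> \<phi> = (SOME L. is_wavelet_multiplier M K \<psi> \<sigma> \<phi> L)"

definition localized ::
    "'a measure \<Rightarrow> real \<Rightarrow> (('a \<Rightarrow> complex) \<Rightarrow> ('a \<Rightarrow> complex)) \<Rightarrow> ('a \<Rightarrow> complex) \<Rightarrow> bool" where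
  "localized M \<epsilon> L f \<longleftrightarrow> Lp_norm 2 M (\<lambda>x. L f x - f x) \<le> \<epsilon> * Lp_norm 2 M f"

end

theory Submission
  imports Defs "HOL-Complex_Analysis.Great_Picard"
begin

text \<open>
  Write \<open>F f = T (\<phi> f)\<close> and \<open>G g = T (\<psi> g)\<close>, where \<open>T\<close> is the transform, so that the multiplier \<open>A\<close> satisfies
  \<open>\<langle>A f, g\<rangle> = \<integral> \<sigma> (F f) cnj (G g)\<close>. Parseval's identity, extended from smooth bumps to \<open>L\<^sup>1 \<inter> L\<^sup>2\<close>,
  makes \<open>\<bar>F f\<bar> \<bar>G g\<bar> d\<mu>\<close> a measure of mass at most \<open>1\<close> for unit vectors \<open>f\<close>, \<open>g\<close>, while Bessel's inequality gives
  \<open>\<Sum>\<^sub>j \<bar>F (e\<^sub>j) \<xi>\<bar>\<^sup>2 \<le> c\<^sub>K\<^sup>2\<close> for orthonormal \<open>e\<^sub>j\<close>. With singular vectors \<open>e\<^sub>j\<close> and \<open>f\<^sub>j = A e\<^sub>j / s\<^sub>j\<close>, Jensen's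
  inequality applied to \<open>s\<^sub>j = \<langle>A e\<^sub>j, f\<^sub>j\<rangle>\<close> yields \<open>\<Sum>\<^sub>j s\<^sub>j\<^sup>p \<le> c\<^sub>K\<^sup>2 \<integral> \<bar>\<sigma>\<bar>\<^sup>p\<close> for every \<open>p \<ge> 1\<close> at once, without
  interpolation. The uncertainty principle compares \<open>f\<close> with \<open>A B f\<close> for the multipliers \<open>A\<close>, \<open>B\<close> of \<open>S\<close>, \<open>\<Sigma>\<close>,
  whose norms are at most \<open>1\<close> and at most \<open>c\<^sub>K\<^sup>2 \<mu>(S)\<close>, \<open>c\<^sub>K\<^sup>2 \<mu>(\<Sigma>)\<close>.
\<close>

section \<open>Square integrable functions\<close>

text \<open>Parseval is given for Schwartz functions only, whereas the multiplier applies the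
  transform to products with a window, which merely lie in L1 and L2. Approximation therefore has to
  succeed in both norms along the same sequence: the L1 part controls the transform pointwise, the
  L2 part its energy. The multiplier is an unspecified solution of a weak identity, so representing
  vectors have to be constructed: by Fubini for integrable symbols, by completeness of L2 for
  bounded ones, by splitting the symbol in general. Finally, the power sum only counts eigenvectors
  that exist, so its finiteness says nothing about compactness; that is a separate argument, which
  reuses the Jensen estimate for differences.\<close>

abbreviation (input) L2 :: "'a measure \<Rightarrow> ('a \<Rightarrow> complex) set" where
  "L2 M \<equiv> Lp_space 2 M"

abbreviation (input) L2norm :: "'a measure \<Rightarrow> ('a \<Rightarrow> complex) \<Rightarrow> real" where
  "L2norm M f \<equiv> Lp_norm 2 M f"

lemma borel_measurable_cnj [measurable (raw)]:
  assumes "f \<in> borel_measurable M"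
  shows "(\<lambda>x. cnj (f x)) \<in> borel_measurable M"
  using measurable_compose[OF assms borel_measurable_continuous_onI[OF continuous_on_cnj[OF continuous_on_id]]]
  by simp

lemma L2_iff: "f \<in> L2 M \<longleftrightarrow> f \<in> borel_measurable M \<and> integrable M (\<lambda>x. (cmod (f x))\<^sup>2)"
  by (simp add: Lp_space_def)

lemma L2_measurable: "f \<in> L2 M \<Longrightarrow> f \<in> borel_measurable M"
  by (simp add: L2_iff)

lemma L2norm_eq: "L2norm M f = sqrt (LINT x|M. (cmod (f x))\<^sup>2)"
  by (simp add: Lp_norm_def powr_half_sqrt)

lemma L2norm_nonneg [simp]: "0 \<le> L2norm M f"
  by (simp add: L2norm_eq)

lemma L2norm_power2: "(L2norm M f)\<^sup>2 = (LINT x|M. (cmod (f x))\<^sup>2)"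
  by (simp add: L2norm_eq)

lemma L2norm_cong_AE:
  assumes "f \<in> borel_measurable M" "g \<in> borel_measurable M" "AE x in M. cmod (f x) = cmod (g x)"
  shows "L2norm M f = L2norm M g"
proof -
  have "(LINT x|M. (cmod (f x))\<^sup>2) = (LINT x|M. (cmod (g x))\<^sup>2)"
    by (rule integral_cong_AE) (use assms in auto)
  then show ?thesis by (simp add: L2norm_eq)
qed

lemma L2_dominated:
  assumes "g \<in> L2 M" "f \<in> borel_measurable M" "AE x in M. cmod (f x) \<le> C * cmod (g x)"
  shows "f \<in> L2 M"
proof -
  have "integrable M (\<lambda>x. (cmod (f x))\<^sup>2)"
  proof (rule Bochner_Integration.integrable_bound)
    show "integrable M (\<lambda>x. C\<^sup>2 * (cmod (g x))\<^sup>2)"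
      using assms(1) by (simp add: L2_iff)
    show "AE x in M. norm ((cmod (f x))\<^sup>2) \<le> norm (C\<^sup>2 * (cmod (g x))\<^sup>2)"
      using assms(3)
    proof eventually_elim
      fix x assume "cmod (f x) \<le> C * cmod (g x)"
      then have "(cmod (f x))\<^sup>2 \<le> (C * cmod (g x))\<^sup>2" by (intro power_mono) auto
      then show "norm ((cmod (f x))\<^sup>2) \<le> norm (C\<^sup>2 * (cmod (g x))\<^sup>2)"
        by (simp add: power_mult_distrib)
    qed
  qed (use assms(2) in measurable)
  then show ?thesis using assms(2) by (simp add: L2_iff)
qed

lemma L2norm_dominated:
  assumes "g \<in> L2 M" "f \<in> borel_measurable M" "AE x in M. cmod (f x) \<le> C * cmod (g x)" "0 \<le> C"
  shows "L2norm M f \<le> C * L2norm M g"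
proof -
  have f: "f \<in> L2 M" using L2_dominated assms by blast
  have "(LINT x|M. (cmod (f x))\<^sup>2) \<le> (LINT x|M. C\<^sup>2 * (cmod (g x))\<^sup>2)"
  proof (rule integral_mono_AE)
    show "AE x in M. (cmod (f x))\<^sup>2 \<le> C\<^sup>2 * (cmod (g x))\<^sup>2"
      using assms(3)
    proof eventually_elim
      fix x assume "cmod (f x) \<le> C * cmod (g x)"
      then have "(cmod (f x))\<^sup>2 \<le> (C * cmod (g x))\<^sup>2" by (intro power_mono) auto
      then show "(cmod (f x))\<^sup>2 \<le> C\<^sup>2 * (cmod (g x))\<^sup>2"
        by (simp add: power_mult_distrib)
    qed
  qed (use f assms(1) in \<open>auto simp: L2_iff\<close>)
  also have "\<dots> = (C * L2norm M g)\<^sup>2"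
    by (simp add: power_mult_distrib L2norm_power2)
  finally have "(L2norm M f)\<^sup>2 \<le> (C * L2norm M g)\<^sup>2" by (simp add: L2norm_power2)
  then show ?thesis using assms(4) by (simp add: power2_le_iff_abs_le)
qed

lemma L2_zero [simp]: "(\<lambda>x. 0) \<in> L2 M"
  by (simp add: L2_iff)

lemma L2_add [intro]:
  assumes "f \<in> L2 M" "g \<in> L2 M" shows "(\<lambda>x. f x + g x) \<in> L2 M"
proof -
  have "integrable M (\<lambda>x. (cmod (f x + g x))\<^sup>2)"
  proof (rule Bochner_Integration.integrable_bound)
    show "integrable M (\<lambda>x. 2 * (cmod (f x))\<^sup>2 + 2 * (cmod (g x))\<^sup>2)"
      using assms by (simp add: L2_iff)
    have "(cmod (f x + g x))\<^sup>2 \<le> 2 * (cmod (f x))\<^sup>2 + 2 * (cmod (g x))\<^sup>2" for x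
    proof -
      have "(cmod (f x + g x))\<^sup>2 \<le> (cmod (f x) + cmod (g x))\<^sup>2"
        by (intro power_mono norm_triangle_ineq) auto
      also have "\<dots> \<le> 2 * (cmod (f x))\<^sup>2 + 2 * (cmod (g x))\<^sup>2"
        using sum_squares_bound[of "cmod (f x)" "cmod (g x)"] by (simp add: power2_sum)
      finally show ?thesis .
    qed
    then show "AE x in M. norm ((cmod (f x + g x))\<^sup>2) \<le> norm (2 * (cmod (f x))\<^sup>2 + 2 * (cmod (g x))\<^sup>2)"
      by (intro AE_I2) simp
  qed (use assms in \<open>auto simp: L2_iff\<close>)
  then show ?thesis using assms by (auto simp: L2_iff)
qed

lemma L2_scale [intro]: "f \<in> L2 M \<Longrightarrow> (\<lambda>x. c * f x) \<in> L2 M"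
  by (auto simp: L2_iff norm_mult power_mult_distrib)

lemma L2_diff [intro]:
  assumes "f \<in> L2 M" "g \<in> L2 M" shows "(\<lambda>x. f x - g x) \<in> L2 M"
  using L2_add[OF assms(1) L2_scale[OF assms(2), of "-1"]] by simp

lemma L2_sum [intro]: "(\<And>i. i \<in> I \<Longrightarrow> f i \<in> L2 M) \<Longrightarrow> (\<lambda>x. \<Sum>i\<in>I. f i x) \<in> L2 M"
  by (induction I rule: infinite_finite_induct) (auto intro: L2_add)

lemma L2_cnj [intro]: "f \<in> L2 M \<Longrightarrow> (\<lambda>x. cnj (f x)) \<in> L2 M"
  unfolding L2_iff by auto

lemma L2norm_scale: "L2norm M (\<lambda>x. c * f x) = cmod c * L2norm M f"
  by (simp add: L2norm_eq norm_mult power_mult_distrib real_sqrt_mult)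

lemma L2norm_minus_commute: "L2norm M (\<lambda>x. f x - g x) = L2norm M (\<lambda>x. g x - f x)"
  by (simp add: L2norm_eq norm_minus_commute)

lemma L2_integrable_norm_mult:
  assumes "f \<in> L2 M" "g \<in> L2 M" shows "integrable M (\<lambda>x. cmod (f x) * cmod (g x))"
proof (rule Bochner_Integration.integrable_bound)
  show "integrable M (\<lambda>x. (cmod (f x))\<^sup>2 + (cmod (g x))\<^sup>2)"
    using assms by (simp add: L2_iff)
  have "cmod (f x) * cmod (g x) \<le> (cmod (f x))\<^sup>2 + (cmod (g x))\<^sup>2" for x
  proof -
    have "0 \<le> cmod (f x) * cmod (g x)" by simp
    then show ?thesis using sum_squares_bound[of "cmod (f x)" "cmod (g x)"] by linarith
  qed
  then show "AE x in M. norm (cmod (f x) * cmod (g x)) \<le> norm ((cmod (f x))\<^sup>2 + (cmod (g x))\<^sup>2)"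
    by (intro AE_I2) simp
qed (use assms in \<open>auto simp: L2_iff\<close>)

lemma L2_integrable_mult:
  assumes "f \<in> L2 M" "g \<in> L2 M" shows "integrable M (\<lambda>x. f x * g x)"
  by (rule Bochner_Integration.integrable_bound[OF L2_integrable_norm_mult[OF assms]])
     (use assms in \<open>auto simp: L2_iff norm_mult\<close>)

lemma L2_integrable_inner:
  assumes "f \<in> L2 M" "g \<in> L2 M" shows "integrable M (\<lambda>x. f x * cnj (g x))"
  using L2_integrable_mult[OF assms(1) L2_cnj[OF assms(2)]] .

lemma L2_Cauchy_Schwarz_norm:
  assumes f: "f \<in> L2 M" and g: "g \<in> L2 M"
  shows "(LINT x|M. cmod (f x) * cmod (g x)) \<le> L2norm M f * L2norm M g"
proof -
  define A where "A = (LINT x|M. (cmod (f x))\<^sup>2)"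
  define B where "B = (LINT x|M. cmod (f x) * cmod (g x))"
  define C where "C = (LINT x|M. (cmod (g x))\<^sup>2)"
  have nn: "0 \<le> A" "0 \<le> B" "0 \<le> C" by (auto simp: A_def B_def C_def)
  have q: "0 \<le> A - 2 * t * B + t\<^sup>2 * C" for t
  proof -
    have "0 \<le> (LINT x|M. (cmod (f x) - t * cmod (g x))\<^sup>2)" by simp
    also have "\<dots> = (LINT x|M. (cmod (f x))\<^sup>2 - 2 * t * (cmod (f x) * cmod (g x)) + t\<^sup>2 * (cmod (g x))\<^sup>2)"
      by (simp add: power2_diff power_mult_distrib algebra_simps)
    also have "\<dots> = A - 2 * t * B + t\<^sup>2 * C"
      using f g L2_integrable_norm_mult[OF f g] by (simp add: A_def B_def C_def L2_iff)
    finally show ?thesis .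
  qed
  have "B\<^sup>2 \<le> A * C"
  proof (cases "C = 0")
    case True
    have "B = 0"
    proof (rule ccontr)
      assume "B \<noteq> 0"
      \<comment> \<open>With C = 0 the expression is linear in t, and at this t it takes the value
        -1.\<close>
      with q[of "(A + 1) / (2 * B)"] True show False by simp
    qed
    then show ?thesis using nn by simp
  next
    case False
    then have "C > 0" using nn by simp
    \<comment> \<open>B / C minimises the quadratic in t.\<close>
    with q[of "B / C"] show ?thesis by (simp add: field_simps power2_eq_square)
  qed
  then have "B \<le> sqrt (A * C)" by (rule real_le_rsqrt)
  then show ?thesis by (simp add: L2norm_eq A_def B_def C_def real_sqrt_mult)
qed

lemma L2_Cauchy_Schwarz:
  assumes "f \<in> L2 M" "g \<in> L2 M"
  shows "cmod (L2_inner M f g) \<le> L2norm M f * L2norm M g"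
proof -
  have "cmod (L2_inner M f g) \<le> (LINT x|M. cmod (f x * cnj (g x)))"
    unfolding L2_inner_def by (rule integral_norm_bound)
  then show ?thesis using L2_Cauchy_Schwarz_norm[OF assms] by (simp add: norm_mult)
qed

lemma L2_inner_self: "L2_inner M f f = complex_of_real ((L2norm M f)\<^sup>2)"
  by (simp add: L2_inner_def L2norm_power2 complex_norm_square[symmetric] del: of_real_power)

lemma L2_inner_cnj: "L2_inner M g f = cnj (L2_inner M f g)"
  unfolding L2_inner_def by (subst Bochner_Integration.integral_cnj[symmetric]) (simp add: mult.commute)

lemma L2_inner_add_left:
  assumes "f \<in> L2 M" "g \<in> L2 M" "h \<in> L2 M"
  shows "L2_inner M (\<lambda>x. f x + g x) h = L2_inner M f h + L2_inner M g h"
  using assms by (simp add: L2_inner_def distrib_right L2_integrable_inner)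

lemma L2_inner_diff_left:
  assumes "f \<in> L2 M" "g \<in> L2 M" "h \<in> L2 M"
  shows "L2_inner M (\<lambda>x. f x - g x) h = L2_inner M f h - L2_inner M g h"
  using assms by (simp add: L2_inner_def left_diff_distrib L2_integrable_inner)

lemma L2_inner_scale_left: "L2_inner M (\<lambda>x. c * f x) h = c * L2_inner M f h"
  by (simp add: L2_inner_def mult.assoc)

lemma L2_inner_scale_right: "L2_inner M f (\<lambda>x. c * h x) = cnj c * L2_inner M f h"
  by (simp add: L2_inner_def mult.left_commute)

lemma L2_inner_sum_left:
  assumes "\<And>i. i \<in> I \<Longrightarrow> f i \<in> L2 M" "h \<in> L2 M"
  shows "L2_inner M (\<lambda>x. \<Sum>i\<in>I. f i x) h = (\<Sum>i\<in>I. L2_inner M (f i) h)"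
  using assms by (simp add: L2_inner_def sum_distrib_right L2_integrable_inner)

lemma L2_inner_cong_AE:
  assumes "f \<in> borel_measurable M" "f' \<in> borel_measurable M" "g \<in> borel_measurable M" "g' \<in> borel_measurable M"
    and "AE x in M. f x = f' x" "AE x in M. g x = g' x"
  shows "L2_inner M f g = L2_inner M f' g'"
  unfolding L2_inner_def by (rule integral_cong_AE) (use assms in auto)

lemma L2norm_eq_0_iff:
  assumes "f \<in> L2 M" shows "L2norm M f = 0 \<longleftrightarrow> (AE x in M. f x = 0)"
  using assms by (simp add: L2norm_eq L2_iff integral_nonneg_eq_0_iff_AE)

lemma L2norm_triangle:
  assumes f: "f \<in> L2 M" and g: "g \<in> L2 M"
  shows "L2norm M (\<lambda>x. f x + g x) \<le> L2norm M f + L2norm M g"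
proof -
  have "(L2norm M (\<lambda>x. f x + g x))\<^sup>2 \<le> (LINT x|M. (cmod (f x))\<^sup>2 + (cmod (g x))\<^sup>2 + 2 * (cmod (f x) * cmod (g x)))"
    unfolding L2norm_power2
  proof (rule integral_mono)
    show "(cmod (f x + g x))\<^sup>2 \<le> (cmod (f x))\<^sup>2 + (cmod (g x))\<^sup>2 + 2 * (cmod (f x) * cmod (g x))" for x
      using power_mono[OF norm_triangle_ineq[of "f x" "g x"], of 2] by (simp add: power2_sum)
  qed (use f g L2_add[OF f g] L2_integrable_norm_mult[OF f g] in \<open>auto simp: L2_iff\<close>)
  also have "\<dots> = (L2norm M f)\<^sup>2 + (L2norm M g)\<^sup>2 + 2 * (LINT x|M. cmod (f x) * cmod (g x))"
    using f g L2_integrable_norm_mult[OF f g] by (simp add: L2norm_power2 L2_iff)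
  also have "\<dots> \<le> (L2norm M f + L2norm M g)\<^sup>2"
    using L2_Cauchy_Schwarz_norm[OF f g] by (simp add: power2_sum)
  finally show ?thesis by (rule power2_le_imp_le) simp
qed

lemma L2norm_triangle_diff:
  assumes f: "f \<in> L2 M" and g: "g \<in> L2 M" and h: "h \<in> L2 M"
  shows "L2norm M (\<lambda>x. f x - h x) \<le> L2norm M (\<lambda>x. f x - g x) + L2norm M (\<lambda>x. g x - h x)"
  using L2norm_triangle[OF L2_diff[OF f g] L2_diff[OF g h]] by simp

lemma L2_inner_tendsto_left:
  assumes v: "\<And>n. v n \<in> L2 M" and w: "w \<in> L2 M" and g: "g \<in> L2 M"
    and lim: "(\<lambda>n. L2norm M (\<lambda>x. v n x - w x)) \<longlonglongrightarrow> 0"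
  shows "(\<lambda>n. L2_inner M (v n) g) \<longlonglongrightarrow> L2_inner M w g"
proof (rule LIM_zero_cancel, rule Lim_null_comparison)
  show "\<forall>\<^sub>F n in sequentially. norm (L2_inner M (v n) g - L2_inner M w g)
      \<le> L2norm M (\<lambda>x. v n x - w x) * L2norm M g"
    using L2_Cauchy_Schwarz[OF L2_diff[OF v w] g] by (simp add: L2_inner_diff_left v w g)
  show "(\<lambda>n. L2norm M (\<lambda>x. v n x - w x) * L2norm M g) \<longlonglongrightarrow> 0"
    using tendsto_mult_left_zero[OF lim] .
qed

text \<open>Test with the difference \<open>f - g\<close> itself. The multiplier is known only
  through inner products, so this is how its linearity is obtained.\<close>

lemma L2_inner_ext:
  assumes f: "f \<in> L2 M" and g: "g \<in> L2 M"
    and eq: "\<And>h. h \<in> L2 M \<Longrightarrow> L2_inner M f h = L2_inner M g h"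
  shows "AE x in M. f x = g x"
proof -
  have "L2_inner M (\<lambda>x. f x - g x) (\<lambda>x. f x - g x) = 0"
    using eq[OF L2_diff[OF f g]] by (subst L2_inner_diff_left) (auto simp: f g)
  then have "L2norm M (\<lambda>x. f x - g x) = 0" by (simp add: L2_inner_self)
  then show ?thesis using L2norm_eq_0_iff[OF L2_diff[OF f g]] by simp
qed

lemma L2_Bessel:
  assumes "finite J" and e: "\<And>j. j \<in> J \<Longrightarrow> e j \<in> L2 M" and h: "h \<in> L2 M"
    and on: "\<And>i j. i \<in> J \<Longrightarrow> j \<in> J \<Longrightarrow> L2_inner M (e i) (e j) = (if i = j then 1 else 0)"
  shows "(\<Sum>j\<in>J. (cmod (L2_inner M (e j) h))\<^sup>2) \<le> (L2norm M h)\<^sup>2"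
proof -
  define c where "c j = cnj (L2_inner M (e j) h)" for j
  \<comment> \<open>\<open>c j\<close> is the coefficient of \<open>h\<close> along
    \<open>e j\<close>, so \<open>P\<close> is the projection onto the span, and the claim is
    positivity of the squared norm of \<open>h - P\<close>.\<close>
  define P where "P = (\<lambda>x. \<Sum>j\<in>J. c j * e j x)"
  define s where "s = (\<Sum>j\<in>J. (cmod (L2_inner M (e j) h))\<^sup>2)"
  have ce: "(\<lambda>x. c j * e j x) \<in> L2 M" if "j \<in> J" for j using e[OF that] by blast
  have P: "P \<in> L2 M" unfolding P_def using ce by (rule L2_sum)
  have Pg: "L2_inner M P g = (\<Sum>j\<in>J. c j * L2_inner M (e j) g)" if "g \<in> L2 M" for g
    unfolding P_def by (subst L2_inner_sum_left) (use ce that in \<open>auto simp: L2_inner_scale_left\<close>)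
  have Ph: "L2_inner M P h = of_real s"
    by (simp add: Pg[OF h] c_def s_def complex_norm_square mult.commute del: of_real_power)
  have eP: "L2_inner M (e i) P = cnj (c i)" if i: "i \<in> J" for i
  proof -
    have "L2_inner M P (e i) = (\<Sum>j\<in>J. if j = i then c j else 0)"
      unfolding Pg[OF e[OF i]] by (rule sum.cong) (use on i in auto)
    also have "\<dots> = c i" using i \<open>finite J\<close> by simp
    finally show ?thesis by (subst L2_inner_cnj) simp
  qed
  have PP: "L2_inner M P P = of_real s"
    unfolding Pg[OF P] by (simp add: eP) (simp add: c_def s_def complex_norm_square mult.commute of_real_sum
      del: of_real_power)
  have "L2_inner M (\<lambda>x. h x - P x) (\<lambda>x. h x - P x)
      = L2_inner M h (\<lambda>x. h x - P x) - L2_inner M P (\<lambda>x. h x - P x)"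
    using h P by (intro L2_inner_diff_left) auto
  also have "L2_inner M h (\<lambda>x. h x - P x) = cnj (L2_inner M h h - L2_inner M P h)"
    by (subst L2_inner_cnj) (simp add: L2_inner_diff_left h P)
  also have "L2_inner M P (\<lambda>x. h x - P x) = cnj (L2_inner M h P - L2_inner M P P)"
    by (subst L2_inner_cnj) (simp add: L2_inner_diff_left h P)
  also have "L2_inner M h P = cnj (L2_inner M P h)" by (rule L2_inner_cnj)
  finally have "complex_of_real ((L2norm M (\<lambda>x. h x - P x))\<^sup>2) = of_real ((L2norm M h)\<^sup>2 - s)"
    by (simp add: Ph PP L2_inner_self[of M h] L2_inner_self[of M "\<lambda>x. h x - P x"])
  then have "(L2norm M (\<lambda>x. h x - P x))\<^sup>2 = (L2norm M h)\<^sup>2 - s"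
    by (simp only: of_real_eq_iff)
  then show ?thesis unfolding s_def[symmetric] by (smt (verit) zero_le_power2)
qed

text \<open>Lower semicontinuity of the norm under pointwise convergence, which also makes the limit
  square integrable. The bound is asked for only eventually, so a tail of an approximating sequence
  is enough.\<close>

lemma L2_Fatou:
  assumes v: "\<And>n. v n \<in> L2 M" and w [measurable]: "w \<in> borel_measurable M"
    and lim: "AE x in M. (\<lambda>n. v n x) \<longlonglongrightarrow> w x"
    and bound: "\<forall>\<^sub>F n in sequentially. L2norm M (v n) \<le> e"
  shows "w \<in> L2 M \<and> L2norm M w \<le> e"
proof -
  note [measurable] = v[THEN L2_measurable]
  have "e \<ge> 0"
    using eventually_happens'[OF _ bound] L2norm_nonneg by (meson order_trans sequentially_bot)
  have "(\<integral>\<^sup>+x. ennreal ((cmod (w x))\<^sup>2) \<partial>M) = (\<integral>\<^sup>+x. liminf (\<lambda>i. ennreal ((cmod (v i x))\<^sup>2)) \<partial>M)"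
  proof (rule nn_integral_cong_AE, use lim in eventually_elim)
    fix x assume "(\<lambda>i. v i x) \<longlonglongrightarrow> w x"
    then have "(\<lambda>i. ennreal ((cmod (v i x))\<^sup>2)) \<longlonglongrightarrow> ennreal ((cmod (w x))\<^sup>2)"
      by (intro tendsto_intros tendsto_ennrealI)
    then show "ennreal ((cmod (w x))\<^sup>2) = liminf (\<lambda>i. ennreal ((cmod (v i x))\<^sup>2))"
      by (rule lim_imp_Liminf[OF trivial_limit_sequentially, symmetric])
  qed
  also have "\<dots> \<le> liminf (\<lambda>i. \<integral>\<^sup>+x. ennreal ((cmod (v i x))\<^sup>2) \<partial>M)"
    by (rule nn_integral_liminf) measurable
  also have "\<dots> \<le> liminf (\<lambda>i. ennreal (e\<^sup>2))"
  proof (rule Liminf_mono, use bound in eventually_elim)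
    fix i assume "L2norm M (v i) \<le> e"
    then have "(LINT x|M. (cmod (v i x))\<^sup>2) \<le> e\<^sup>2"
      using power_mono[of "L2norm M (v i)" e 2] by (simp add: L2norm_power2)
    then show "(\<integral>\<^sup>+x. ennreal ((cmod (v i x))\<^sup>2) \<partial>M) \<le> ennreal (e\<^sup>2)"
      using v[of i] by (subst nn_integral_eq_integral) (auto simp: L2_iff intro: ennreal_leI)
  qed
  finally have *: "(\<integral>\<^sup>+x. ennreal ((cmod (w x))\<^sup>2) \<partial>M) \<le> ennreal (e\<^sup>2)"
    by (simp only: Liminf_const[OF sequentially_bot])
  then have i: "integrable M (\<lambda>x. (cmod (w x))\<^sup>2)"
    by (intro integrableI_bounded) (auto simp: le_less_trans)
  then have "ennreal (LINT x|M. (cmod (w x))\<^sup>2) \<le> ennreal (e\<^sup>2)"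
    using * by (subst (asm) nn_integral_eq_integral) auto
  then have "(L2norm M w)\<^sup>2 \<le> e\<^sup>2"
    unfolding L2norm_power2 by (subst (asm) ennreal_le_iff) auto
  then show ?thesis using i \<open>e \<ge> 0\<close> by (auto simp: L2_iff intro: power2_le_imp_le)
qed

text \<open>Multiplication by a strictly positive square integrable weight turns Cauchy sequences of \<open>L\<^sup>2\<close>
  into Cauchy sequences of \<open>L\<^sup>1\<close>, for which the library provides an a.e. Cauchy subsequence.\<close>

lemma (in sigma_finite_measure) L2_complete:
  assumes v: "\<And>n. v n \<in> L2 M"
    and cauchy: "\<And>e. 0 < e \<Longrightarrow> \<exists>N. \<forall>m\<ge>N. \<forall>n\<ge>N. L2norm M (\<lambda>x. v m x - v n x) < e"
  obtains w where "w \<in> L2 M" "(\<lambda>n. L2norm M (\<lambda>x. v n x - w x)) \<longlonglongrightarrow> 0"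
proof -
  obtain h :: "'a \<Rightarrow> real" where h [measurable]: "h \<in> borel_measurable M"
    and h0: "\<And>x. 0 < h x" and "integrable M h"
    using obtain_positive_integrable_function by metis
  \<comment> \<open>The square root makes |q|^2 = h integrable, so \<open>q\<close> lies in L2; it
    vanishes nowhere, so it can be divided out again.\<close>
  define q where "q x = complex_of_real (sqrt (h x))" for x
  have q: "q \<in> L2 M" "q x \<noteq> 0" for x
    using \<open>integrable M h\<close> h0[THEN less_imp_le] h0[of x] unfolding q_def by (auto simp: L2_iff)
  note [measurable] = v[THEN L2_measurable] q(1)[THEN L2_measurable]
  have "\<exists>N. \<forall>i\<ge>N. \<forall>j\<ge>N. (LINT x|M. norm (v i x * q x - v j x * q x)) < e" if "0 < e" for e
  proof -
    have "0 < e / (L2norm M q + 1)"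
      using that by (smt (verit) L2norm_nonneg divide_pos_pos)
    then obtain N where N: "\<And>m n. m \<ge> N \<Longrightarrow> n \<ge> N \<Longrightarrow> L2norm M (\<lambda>x. v m x - v n x) < e / (L2norm M q + 1)"
      using cauchy by blast
    have "(LINT x|M. norm (v i x * q x - v j x * q x)) < e" if "i \<ge> N" "j \<ge> N" for i j
    proof -
      have "(LINT x|M. norm (v i x * q x - v j x * q x)) \<le> L2norm M (\<lambda>x. v i x - v j x) * L2norm M q"
        using L2_Cauchy_Schwarz_norm[OF L2_diff[OF v v] q(1), of i j]
        by (simp add: norm_mult[symmetric] left_diff_distrib)
      also have "\<dots> \<le> e / (L2norm M q + 1) * L2norm M q"
        using N[OF that] by (intro mult_right_mono) auto
      also have "\<dots> < e / (L2norm M q + 1) * (L2norm M q + 1)"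
        using \<open>0 < e\<close> \<open>0 < e / (L2norm M q + 1)\<close> by (intro mult_strict_left_mono) auto
      also have "\<dots> = e"
        using L2norm_nonneg[of M q] by (simp add: add_nonneg_eq_0_iff)
      finally show ?thesis .
    qed
    then show ?thesis by blast
  qed
  then obtain r where r: "strict_mono r" and rc: "AE x in M. Cauchy (\<lambda>i. v (r i) x * q x)"
    by (rule cauchy_L1_AE_cauchy_subseq[of M "\<lambda>n x. v n x * q x", rotated])
       (use L2_integrable_mult[OF v q(1)] in auto)
  define w where "w x = lim (\<lambda>i. v (r i) x)" for x
  have w [measurable]: "w \<in> borel_measurable M" unfolding w_def by measurable
  have lim: "AE x in M. (\<lambda>i. v (r i) x) \<longlonglongrightarrow> w x"
    using rc
  proof eventually_elim
    fix x assume "Cauchy (\<lambda>i. v (r i) x * q x)"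
    then have "convergent (\<lambda>i. v (r i) x * q x)"
      by (simp only: Cauchy_convergent_iff)
    then have "convergent (\<lambda>i. v (r i) x * q x * inverse (q x))"
      by (rule convergent_mult[OF _ convergent_const])
    then show "(\<lambda>i. v (r i) x) \<longlonglongrightarrow> w x"
      using q(2)[of x] by (simp add: w_def convergent_LIMSEQ_iff mult.assoc)
  qed
  \<comment> \<open>With \<open>m\<close> frozen and the other index running along the subsequence,
    the Cauchy condition becomes a bound on the distance of the full sequence to
    \<open>w\<close>.\<close>
  have fatou: "(\<lambda>x. v m x - w x) \<in> L2 M \<and> L2norm M (\<lambda>x. v m x - w x) \<le> e"
    if N: "\<And>n. n \<ge> N \<Longrightarrow> L2norm M (\<lambda>x. v m x - v n x) \<le> e" for m N e
  proof (rule L2_Fatou)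
    show "AE x in M. (\<lambda>i. v m x - v (r i) x) \<longlonglongrightarrow> v m x - w x"
      using lim by eventually_elim (intro tendsto_intros)
    show "\<forall>\<^sub>F i in sequentially. L2norm M (\<lambda>x. v m x - v (r i) x) \<le> e"
      using strict_mono_imp_increasing[OF r] N
      by (intro eventually_sequentiallyI[of N]) (meson order_trans)
  qed (use v in auto)
  obtain N1 where "\<And>m n. m \<ge> N1 \<Longrightarrow> n \<ge> N1 \<Longrightarrow> L2norm M (\<lambda>x. v m x - v n x) < 1"
    using cauchy[of 1] by auto
  then have "(\<lambda>x. v N1 x - w x) \<in> L2 M" using fatou[of N1 N1 1] by force
  from L2_diff[OF v this, of N1] have "w \<in> L2 M" by simp
  moreover have "(\<lambda>n. L2norm M (\<lambda>x. v n x - w x)) \<longlonglongrightarrow> 0"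
  proof (rule LIMSEQ_I)
    fix e :: real assume "0 < e"
    then obtain N where N: "\<And>m n. m \<ge> N \<Longrightarrow> n \<ge> N \<Longrightarrow> L2norm M (\<lambda>x. v m x - v n x) < e / 2"
      using cauchy[of "e / 2"] by auto
    have "L2norm M (\<lambda>x. v m x - w x) < e" if "m \<ge> N" for m
      using fatou[of N m "e / 2"] N[OF that] \<open>0 < e\<close> by (smt (verit) field_sum_of_halves)
    then show "\<exists>no. \<forall>n\<ge>no. norm (L2norm M (\<lambda>x. v n x - w x) - 0) < e" by auto
  qed
  ultimately show ?thesis using that by blast
qed

section \<open>Smooth bump functions\<close>

text \<open>k-fold differentiability, recursing on the innermost derivative and along every vector
  \<open>b\<close>. Continuity of the top order comes from the next one, as the predicate is imposed
  for all k.\<close>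

primrec Ck :: "nat \<Rightarrow> ('a::euclidean_space \<Rightarrow> complex) \<Rightarrow> bool" where
  "Ck 0 f \<longleftrightarrow> True"
| "Ck (Suc k) f \<longleftrightarrow> (\<forall>x. f differentiable at x) \<and> (\<forall>b. Ck k (\<lambda>x. frechet_derivative f (at x) b))"

lemma Ck_SucI:
  assumes "\<And>x. (f has_derivative F x) (at x)" "\<And>b. Ck k (\<lambda>x. F x b)"
  shows "Ck (Suc k) f"
proof -
  have "frechet_derivative f (at x) = F x" for x
    using frechet_derivative_at[OF assms(1)] by simp
  then show ?thesis using assms by (auto intro: differentiableI)
qed

lemma Ck_Suc_D: "Ck (Suc k) f \<Longrightarrow> Ck k f"
  by (induction k arbitrary: f) auto

lemma Ck_has_derivative:
  "Ck (Suc k) f \<Longrightarrow> (f has_derivative frechet_derivative f (at x)) (at x)"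
  by (simp add: frechet_derivative_works)

lemma Ck_const: "Ck k (\<lambda>x. c)"
proof (induction k arbitrary: c)
  case (Suc k)
  show ?case by (rule Ck_SucI[OF has_derivative_const Suc])
qed simp

lemma Ck_add: "Ck k f \<Longrightarrow> Ck k g \<Longrightarrow> Ck k (\<lambda>x. f x + g x)"
proof (induction k arbitrary: f g)
  case (Suc k)
  show ?case
    by (rule Ck_SucI[OF has_derivative_add[OF Ck_has_derivative[OF Suc.prems(1)] Ck_has_derivative[OF Suc.prems(2)]]])
       (use Suc in auto)
qed simp

lemma Ck_mult: "Ck k f \<Longrightarrow> Ck k g \<Longrightarrow> Ck k (\<lambda>x. f x * g x)"
proof (induction k arbitrary: f g)
  case (Suc k)
  have "Ck k f" "Ck k g" using Suc.prems Ck_Suc_D by blast+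
  then show ?case
    by (intro Ck_SucI[OF has_derivative_mult[OF Ck_has_derivative[OF Suc.prems(1)] Ck_has_derivative[OF Suc.prems(2)]]]
          Ck_add Suc.IH)
       (use Suc.prems in auto)
qed simp

lemma Ck_prod: "(\<And>i. i \<in> I \<Longrightarrow> Ck k (f i)) \<Longrightarrow> Ck k (\<lambda>x. \<Prod>i\<in>I. f i x)"
  by (induction I rule: infinite_finite_induct) (auto intro: Ck_const Ck_mult)

text \<open>The head of the list is differentiated last. Peeling off the other end exposes the
  innermost derivative, the one along which \<open>Ck\<close> recurses.\<close>

lemma iterated_partial_snoc:
  "iterated_partial (bs @ [b]) f = iterated_partial bs (\<lambda>x. frechet_derivative f (at x) b)"
  by (induction bs) auto

lemma iterated_partial_differentiable:
  "Ck (Suc (length bs)) f \<Longrightarrow> iterated_partial bs f differentiable at x"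
proof (induction bs arbitrary: f rule: rev_induct)
  case (snoc b bs)
  then show ?case by (simp add: iterated_partial_snoc)
qed simp

text \<open>The complement of a closed set is open, so vanishing there is a local property and
  survives differentiation.\<close>

lemma iterated_partial_eq_0:
  assumes S: "closed S" and f: "\<And>x. x \<notin> S \<Longrightarrow> f x = 0" and "x \<notin> S"
  shows "iterated_partial bs f x = 0"
  using \<open>x \<notin> S\<close>
proof (induction bs arbitrary: x)
  case (Cons b bs)
  have "(iterated_partial bs f has_derivative (\<lambda>_. 0)) (at x)"
    by (rule has_derivative_transform_within_open[where s = "- S" and f = "\<lambda>_. 0"])
       (use S Cons in auto)
  then have "frechet_derivative (iterated_partial bs f) (at x) = (\<lambda>_. 0)"
    by (rule frechet_derivative_at[symmetric])
  then show ?case by simp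
qed (simp add: f)

lemma schwartz_compact_support:
  assumes f: "\<And>k. Ck k f" and S: "compact S" and supp: "\<And>x. x \<notin> S \<Longrightarrow> f x = 0"
  shows "schwartz f"
  unfolding schwartz_def
proof (intro allI impI conjI)
  fix bs :: "'a list" and k :: nat
  let ?g = "\<lambda>x. norm x ^ k *\<^sub>R iterated_partial bs f x"
  have diff: "iterated_partial bs f differentiable at x" for x
    by (rule iterated_partial_differentiable[OF f])
  then show "iterated_partial bs f differentiable_on UNIV"
    by (simp add: differentiable_on_def)
  have "continuous_on S (iterated_partial bs f)"
    using diff differentiable_imp_continuous_within
    by (meson continuous_at_imp_continuous_on)
  then have "compact (?g ` S)"
    by (intro compact_continuous_image continuous_intros S)
  then have "bounded (insert 0 (?g ` S))"
    by (simp add: compact_imp_bounded)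
  moreover have "range ?g \<subseteq> insert 0 (?g ` S)"
    using iterated_partial_eq_0[OF compact_imp_closed[OF S] supp] by force
  ultimately show "bounded (range ?g)" by (rule bounded_subset)
qed

text \<open>The flat function p(1/t) e^(-1/t), extended by 0. The polynomial makes the family closed
  under differentiation, so smoothness becomes an induction on the order.\<close>

definition exp_inverse :: "real poly \<Rightarrow> real \<Rightarrow> real" where
  "exp_inverse p t = (if t \<le> 0 then 0 else poly p (1 / t) * exp (- (1 / t)))"

lemma tendsto_poly_exp_0: "((\<lambda>u. poly p u * exp (- u)) \<longlongrightarrow> (0::real)) at_top"
proof -
  have "((\<lambda>u. \<Sum>i\<le>degree p. coeff p i * (u ^ i / exp u)) \<longlongrightarrow> (\<Sum>i\<le>degree p. coeff p i * 0)) at_top"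
    by (intro tendsto_sum tendsto_mult tendsto_const tendsto_power_div_exp_0)
  then show ?thesis
    by (simp add: poly_altdef sum_distrib_right exp_minus divide_inverse mult.assoc)
qed

text \<open>With u = 1/t one has d/dt = - u^2 d/du, and the u-derivative of p(u) e^(-u) is (p' -
  p)(u) e^(-u); hence the new polynomial u^2 (p - p').\<close>

lemma exp_inverse_deriv:
  "(exp_inverse p has_real_derivative exp_inverse (monom 1 2 * (p - pderiv p)) t) (at t)"
proof -
  consider "t < 0" | "t = 0" | "0 < t" by linarith
  then show ?thesis
  proof cases
    case 1
    have "(exp_inverse p has_real_derivative 0) (at t)"
      by (rule has_field_derivative_transform_within_open[OF DERIV_const, of "{..<0}"])
         (use 1 in \<open>auto simp: exp_inverse_def\<close>)
    then show ?thesis using 1 by (simp add: exp_inverse_def)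
  next
    case 2
    have "((\<lambda>h. exp_inverse p h / h) \<longlongrightarrow> 0) (at 0)"
      unfolding filterlim_at_split
    proof
      have "((\<lambda>h. 0::real) \<longlongrightarrow> 0) (at_left 0)" by simp
      then show "((\<lambda>h. exp_inverse p h / h) \<longlongrightarrow> 0) (at_left 0)"
        by (rule Lim_transform_eventually)
           (auto simp: exp_inverse_def eventually_at_filter)
      \<comment> \<open>From the right the difference quotient at 0 is u p(u) e^(-u), where u = 1/h
        tends to infinity.\<close>
      have "((\<lambda>h. poly (monom 1 1 * p) (inverse h) * exp (- inverse h)) \<longlongrightarrow> (0::real)) (at_right 0)"
        by (rule filterlim_compose[OF tendsto_poly_exp_0 filterlim_inverse_at_top_right])
      then show "((\<lambda>h. exp_inverse p h / h) \<longlongrightarrow> 0) (at_right 0)"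
        by (rule Lim_transform_eventually)
           (auto simp: exp_inverse_def eventually_at_filter poly_monom field_simps)
    qed
    then show ?thesis
      by (simp add: 2 has_field_derivative_iff exp_inverse_def)
  next
    case 3
    have i: "((\<lambda>t. 1 / t) has_real_derivative - (1 / t\<^sup>2)) (at t)"
      using 3 by (auto intro!: derivative_eq_intros simp: power2_eq_square)
    have "((\<lambda>t. poly p (1 / t) * exp (- (1 / t))) has_real_derivative
        poly (pderiv p) (1 / t) * - (1 / t\<^sup>2) * exp (- (1 / t)) + exp (- (1 / t)) * - (- (1 / t\<^sup>2)) * poly p (1 / t)) (at t)"
      by (rule DERIV_mult[OF DERIV_chain2[OF poly_DERIV i] DERIV_chain2[OF DERIV_exp DERIV_minus[OF i]]])
    moreover have "poly (pderiv p) (1 / t) * - (1 / t\<^sup>2) * exp (- (1 / t)) + exp (- (1 / t)) * - (- (1 / t\<^sup>2)) * poly p (1 / t)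
        = exp_inverse (monom 1 2 * (p - pderiv p)) t"
      using 3 by (simp add: exp_inverse_def poly_monom power_divide left_diff_distrib right_diff_distrib)
    ultimately have "((\<lambda>t. poly p (1 / t) * exp (- (1 / t))) has_real_derivative
        exp_inverse (monom 1 2 * (p - pderiv p)) t) (at t)"
      by simp
    then show ?thesis
      by (rule has_field_derivative_transform_within_open[of _ _ _ "{0<..}"])
         (use 3 in \<open>auto simp: exp_inverse_def\<close>)
  qed
qed

text \<open>A derivative along \<open>b\<close> contributes the constant factor given by v and b and
  changes the polynomial, so the induction has to leave \<open>p\<close> arbitrary.\<close>

lemma Ck_exp_inverse: "Ck k (\<lambda>x. complex_of_real (exp_inverse p (v \<bullet> x + c)))"
proof (induction k arbitrary: p)
  case (Suc k)
  let ?p' = "monom 1 2 * (p - pderiv p)"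
  have "((\<lambda>x. exp_inverse p (v \<bullet> x + c)) has_derivative (\<lambda>h. exp_inverse ?p' (v \<bullet> x + c) * (v \<bullet> h))) (at x)" for x
  proof -
    have 1: "((\<lambda>x. v \<bullet> x + c) has_derivative (\<lambda>h. v \<bullet> h)) (at x)"
      by (auto intro!: derivative_eq_intros)
    have 2: "(exp_inverse p has_derivative (*) (exp_inverse ?p' (v \<bullet> x + c))) (at (v \<bullet> x + c))"
      using exp_inverse_deriv by (simp add: has_field_derivative_def)
    show ?thesis using has_derivative_compose[OF 1 2] .
  qed
  then have "((\<lambda>x. complex_of_real (exp_inverse p (v \<bullet> x + c))) has_derivative
      (\<lambda>h. complex_of_real (exp_inverse ?p' (v \<bullet> x + c) * (v \<bullet> h)))) (at x)" for x
    by (rule has_derivative_of_real)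
  then show ?case
    by (rule Ck_SucI) (use Ck_mult[OF Suc Ck_const] in simp)
qed simp

text \<open>Since \<open>exp_inverse 1 (n * t)\<close> is the \<open>n\<close>-th root of \<open>exp_inverse 1 t\<close>, these bumps converge to the
  indicator of the open box.\<close>

definition box_bump :: "'a::euclidean_space \<Rightarrow> 'a \<Rightarrow> nat \<Rightarrow> 'a \<Rightarrow> complex" where
  "box_bump l u n x = (\<Prod>b\<in>Basis. complex_of_real (exp_inverse 1 (n * (x \<bullet> b - l \<bullet> b))) *
     complex_of_real (exp_inverse 1 (n * (u \<bullet> b - x \<bullet> b))))"

lemma Ck_box_bump: "Ck k (box_bump l u n)"
proof -
  have "Ck k (\<lambda>x. \<Prod>b\<in>Basis. complex_of_real (exp_inverse 1 ((real n *\<^sub>R b) \<bullet> x + - real n * (l \<bullet> b))) *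
     complex_of_real (exp_inverse 1 ((- real n *\<^sub>R b) \<bullet> x + real n * (u \<bullet> b))))"
    by (intro Ck_prod Ck_mult Ck_exp_inverse)
  then show ?thesis
    by (simp add: box_bump_def[abs_def] algebra_simps inner_commute)
qed

lemma exp_inverse_bounds: "0 \<le> exp_inverse 1 t" "exp_inverse 1 t \<le> 1"
  by (auto simp: exp_inverse_def)

lemma exp_inverse_lim: "(\<lambda>n. exp_inverse 1 (real n * t)) \<longlonglongrightarrow> (if 0 < t then 1 else 0)"
proof (cases "0 < t")
  case True
  \<comment> \<open>Indices are shifted by one because at n = 0 the argument is 0 and the
    exponential formula does not apply.\<close>
  have "(\<lambda>n. exp (- (inverse t * inverse (real (Suc n))))) \<longlonglongrightarrow> exp (- (inverse t * 0))"
    by (intro tendsto_intros LIMSEQ_inverse_real_of_nat)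
  moreover have "exp (- (inverse t * inverse (real (Suc n)))) = exp_inverse 1 (real (Suc n) * t)" for n
  proof -
    have "\<not> real (Suc n) * t \<le> 0" using True by (simp add: mult_le_0_iff)
    then show ?thesis by (simp add: exp_inverse_def divide_inverse mult.commute)
  qed
  ultimately have "(\<lambda>n. exp_inverse 1 (real (Suc n) * t)) \<longlonglongrightarrow> 1" by simp
  then have "(\<lambda>n. exp_inverse 1 (real n * t)) \<longlonglongrightarrow> 1" by (rule LIMSEQ_imp_Suc)
  then show ?thesis using True by simp
qed (simp add: exp_inverse_def mult_le_0_iff)

lemma norm_box_bump_le: "cmod (box_bump l u n x) \<le> indicator (box l u) x"
proof (cases "x \<in> box l u")
  case True
  have "cmod (box_bump l u n x) \<le> 1"
    unfolding box_bump_def prod_norm[symmetric]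
    by (rule prod_le_1) (auto simp: norm_mult exp_inverse_bounds intro!: mult_le_one)
  then show ?thesis using True by simp
next
  case False
  then obtain b where b: "b \<in> Basis" "x \<bullet> b \<le> l \<bullet> b \<or> u \<bullet> b \<le> x \<bullet> b"
    by (auto simp: mem_box not_less)
  then have "box_bump l u n x = 0"
    unfolding box_bump_def
    by (intro prod_zero bexI[of _ b]) (auto simp: exp_inverse_def mult_le_0_iff)
  then show ?thesis by simp
qed

lemma box_bump_lim: "(\<lambda>n. box_bump l u n x) \<longlonglongrightarrow> indicator (box l u) x"
proof -
  have "(\<lambda>n. box_bump l u n x) \<longlonglongrightarrow> (\<Prod>b\<in>Basis. complex_of_real (if 0 < x \<bullet> b - l \<bullet> b then 1 else 0) *
     complex_of_real (if 0 < u \<bullet> b - x \<bullet> b then 1 else 0))"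
    unfolding box_bump_def by (intro tendsto_intros exp_inverse_lim)
  also have "(\<Prod>b\<in>Basis. complex_of_real (if 0 < x \<bullet> b - l \<bullet> b then 1 else 0) *
     complex_of_real (if 0 < u \<bullet> b - x \<bullet> b then 1 else 0)) = indicator (box l u) x"
  proof (cases "x \<in> box l u")
    case True
    then show ?thesis by (simp add: mem_box)
  next
    case False
    then obtain b where "b \<in> Basis" "\<not> 0 < x \<bullet> b - l \<bullet> b \<or> \<not> 0 < u \<bullet> b - x \<bullet> b"
      by (auto simp: mem_box not_less)
    then show ?thesis using False
      by (intro prod_zero[THEN trans]) auto
  qed
  finally show ?thesis .
qed

text \<open>Compactly supported smooth functions rather than all Schwartz functions: being bounded
  and supported in a ball, they are in L1 and L2 of \<mu> by local finiteness alone, without growth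
  estimates.\<close>

definition bump_functions :: "('a::euclidean_space \<Rightarrow> complex) set" where
  "bump_functions = {f. (\<forall>k. Ck k f) \<and> (\<exists>S. compact S \<and> (\<forall>x. x \<notin> S \<longrightarrow> f x = 0))}"

lemma bump_functions_schwartz: "f \<in> bump_functions \<Longrightarrow> schwartz f"
  unfolding bump_functions_def using schwartz_compact_support by blast

lemma bump_functions_add:
  assumes "f \<in> bump_functions" "g \<in> bump_functions"
  shows "(\<lambda>x. f x + g x) \<in> bump_functions"
proof -
  obtain S T where "compact S" "\<forall>x. x \<notin> S \<longrightarrow> f x = 0" "compact T" "\<forall>x. x \<notin> T \<longrightarrow> g x = 0"
    using assms unfolding bump_functions_def by blast
  then have "compact (S \<union> T)" "\<forall>x. x \<notin> S \<union> T \<longrightarrow> f x + g x = 0" by auto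
  then show ?thesis using assms unfolding bump_functions_def by (blast intro: Ck_add)
qed

lemma bump_functions_scale:
  assumes "f \<in> bump_functions"
  shows "(\<lambda>x. c * f x) \<in> bump_functions"
  using assms unfolding bump_functions_def by (auto intro: Ck_mult[OF Ck_const])

lemma box_bump_in_bump_functions: "box_bump l u n \<in> bump_functions"
proof -
  have "box_bump l u n x = 0" if "x \<notin> cbox l u" for x
  proof -
    have "x \<notin> box l u" using that box_subset_cbox by blast
    then show ?thesis using norm_box_bump_le[of l u n x] by simp
  qed
  then show ?thesis
    unfolding bump_functions_def by (auto intro!: Ck_box_bump exI[of _ "cbox l u"])
qed

lemma bump_functions_continuous:
  assumes "f \<in> bump_functions" shows "continuous_on UNIV f"
proof -
  have "Ck (Suc 0) f" using assms by (simp add: bump_functions_def del: Ck.simps)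
  then have "f differentiable at x" for x by simp
  then show ?thesis
    by (meson continuous_at_imp_continuous_on differentiable_imp_continuous_within)
qed

lemma bump_functions_bound:
  assumes "f \<in> bump_functions"
  obtains B n where "0 \<le> B" "\<And>x. cmod (f x) \<le> B * indicator (cball 0 (real n)) x"
proof -
  obtain S where S: "compact S" "\<And>x. x \<notin> S \<Longrightarrow> f x = 0"
    using assms unfolding bump_functions_def by blast
  have "compact (f ` S)"
    using bump_functions_continuous[OF assms] S(1) compact_continuous_image continuous_on_subset by blast
  then obtain B where B: "0 < B" "\<And>x. x \<in> S \<Longrightarrow> cmod (f x) \<le> B"
    using compact_imp_bounded bounded_pos by (metis imageI)
  obtain r where r: "\<And>x. x \<in> S \<Longrightarrow> norm x \<le> r"
    using S(1) compact_imp_bounded bounded_iff by metis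
  obtain n where n: "r \<le> real n" using real_arch_simple by blast
  have "cmod (f x) \<le> B * indicator (cball 0 (real n)) x" for x
    using B S(2)[of x] r[of x] n by (cases "x \<in> S") (auto simp: indicator_def)
  then show ?thesis using that[of B n] B(1) by auto
qed

section \<open>Density of bump functions and the Plancherel inequality\<close>

definition L12 :: "'a measure \<Rightarrow> ('a \<Rightarrow> complex) set" where
  "L12 M = {h \<in> L2 M. integrable M h}"

definition L12_norm :: "'a measure \<Rightarrow> ('a \<Rightarrow> complex) \<Rightarrow> real" where
  "L12_norm M h = (LINT x|M. cmod (h x)) + L2norm M h"

lemma L12_D: "h \<in> L12 M \<Longrightarrow> h \<in> L2 M" "h \<in> L12 M \<Longrightarrow> integrable M h"
  by (auto simp: L12_def)

lemma L12_add: "f \<in> L12 M \<Longrightarrow> g \<in> L12 M \<Longrightarrow> (\<lambda>x. f x + g x) \<in> L12 M"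
  by (auto simp: L12_def)

lemma L12_diff: "f \<in> L12 M \<Longrightarrow> g \<in> L12 M \<Longrightarrow> (\<lambda>x. f x - g x) \<in> L12 M"
  by (auto simp: L12_def)

lemma L12_scale: "f \<in> L12 M \<Longrightarrow> (\<lambda>x. c * f x) \<in> L12 M"
  by (auto simp: L12_def)

lemma L12_norm_triangle:
  assumes "f \<in> L12 M" "g \<in> L12 M"
  shows "L12_norm M (\<lambda>x. f x + g x) \<le> L12_norm M f + L12_norm M g"
proof -
  have "(LINT x|M. cmod (f x + g x)) \<le> (LINT x|M. cmod (f x) + cmod (g x))"
    by (rule integral_mono) (use assms[THEN L12_D(2)] in \<open>auto intro: norm_triangle_ineq\<close>)
  also have "\<dots> = (LINT x|M. cmod (f x)) + (LINT x|M. cmod (g x))"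
    using assms[THEN L12_D(2)] by simp
  finally show ?thesis
    using L2norm_triangle[OF assms[THEN L12_D(1)]] by (simp add: L12_norm_def)
qed

lemma L12_norm_scale: "L12_norm M (\<lambda>x. c * f x) = cmod c * L12_norm M f"
  by (simp add: L12_norm_def L2norm_scale norm_mult distrib_left)

lemma L12_norm_nonneg: "0 \<le> L12_norm M f"
  by (simp add: L12_norm_def)

text \<open>A single majorant \<open>w\<close>, integrable together with its square, serves both
  parts of the norm.\<close>

lemma L12_dominated_convergence:
  fixes w :: "'a \<Rightarrow> real"
  assumes s: "\<And>n. s n \<in> borel_measurable M" and h: "h \<in> borel_measurable M"
    and w: "integrable M w" "integrable M (\<lambda>x. (w x)\<^sup>2)"
    and bound: "\<And>n. AE x in M. cmod (s n x) \<le> w x"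
    and lim: "AE x in M. (\<lambda>n. s n x) \<longlonglongrightarrow> h x"
  shows "\<And>n. s n \<in> L12 M" "h \<in> L12 M" "(\<lambda>n. L12_norm M (\<lambda>x. s n x - h x)) \<longlonglongrightarrow> 0"
proof -
  have bound': "AE x in M. \<forall>n. cmod (s n x) \<le> w x"
    using bound by (simp add: AE_all_countable)
  have hw: "AE x in M. cmod (h x) \<le> w x"
    using lim bound'
  proof eventually_elim
    fix x assume lim: "(\<lambda>n. s n x) \<longlonglongrightarrow> h x" and bd: "\<forall>n. cmod (s n x) \<le> w x"
    show "cmod (h x) \<le> w x"
      by (rule tendsto_upperbound[OF tendsto_norm[OF lim]]) (use bd in auto)
  qed
  have L12: "f \<in> L12 M" if "f \<in> borel_measurable M" "AE x in M. cmod (f x) \<le> w x" for f :: "'a \<Rightarrow> complex"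
  proof -
    have "AE x in M. norm (f x) \<le> norm (w x)" "AE x in M. norm ((cmod (f x))\<^sup>2) \<le> norm ((w x)\<^sup>2)"
      using that(2) by (eventually_elim; simp add: power_mono)+
    then show ?thesis
      using w that(1) by (simp add: L12_def L2_iff Bochner_Integration.integrable_bound[OF w(1)]
          Bochner_Integration.integrable_bound[OF w(2)])
  qed
  show "s n \<in> L12 M" for n using L12[OF s bound] .
  show "h \<in> L12 M" using L12[OF h hw] .
  have bd: "AE x in M. cmod (s n x - h x) \<le> 2 * w x" for n
    using bound[of n] hw
  proof eventually_elim
    fix x assume "cmod (s n x) \<le> w x" "cmod (h x) \<le> w x"
    then show "cmod (s n x - h x) \<le> 2 * w x" using norm_triangle_ineq4[of "s n x" "h x"] by linarith
  qed
  have bd2: "AE x in M. (cmod (s n x - h x))\<^sup>2 \<le> 4 * (w x)\<^sup>2" for n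
    using bd[of n]
  proof eventually_elim
    fix x assume "cmod (s n x - h x) \<le> 2 * w x"
    then have "(cmod (s n x - h x))\<^sup>2 \<le> (2 * w x)\<^sup>2" by (intro power_mono) auto
    then show "(cmod (s n x - h x))\<^sup>2 \<le> 4 * (w x)\<^sup>2" by (simp add: power_mult_distrib)
  qed
  have lim0: "AE x in M. (\<lambda>n. cmod (s n x - h x)) \<longlonglongrightarrow> 0"
    using lim by eventually_elim (simp add: LIM_zero tendsto_norm_zero)
  note [measurable] = s h
  have "(\<lambda>n. LINT x|M. cmod (s n x - h x)) \<longlonglongrightarrow> (LINT x|M. 0)"
    by (rule integral_dominated_convergence[where w = "\<lambda>x. 2 * w x"]) (use w(1) bd lim0 in auto)
  moreover have "(\<lambda>n. LINT x|M. (cmod (s n x - h x))\<^sup>2) \<longlonglongrightarrow> (LINT x|M. 0)"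
  proof (rule integral_dominated_convergence[where w = "\<lambda>x. 4 * (w x)\<^sup>2"])
    show "AE x in M. (\<lambda>n. (cmod (s n x - h x))\<^sup>2) \<longlonglongrightarrow> 0"
      using lim0 by eventually_elim (use tendsto_power[of _ 0 _ 2] in force)
  qed (use w(2) bd2 in auto)
  then have "(\<lambda>n. L2norm M (\<lambda>x. s n x - h x)) \<longlonglongrightarrow> sqrt 0"
    unfolding L2norm_eq by (intro tendsto_real_sqrt) simp
  ultimately show "(\<lambda>n. L12_norm M (\<lambda>x. s n x - h x)) \<longlonglongrightarrow> 0"
    unfolding L12_norm_def using tendsto_add by fastforce
qed

section \<open>Local finiteness of the measure\<close>

context homogeneous_transform
begin

lemma space_mu: "space \<mu> = \<Omega>"
  using sets_eq_imp_space_eq[OF sets_mu] by (simp add: space_restrict_space)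

lemma borel_measurable_mu:
  assumes "f \<in> borel_measurable borel" shows "f \<in> borel_measurable \<mu>"
  using measurable_restrict_space1[OF assms, of \<Omega>] by (simp cong: measurable_cong_sets add: sets_mu)

lemma sets_mu_iff: "B \<in> sets \<mu> \<longleftrightarrow> (\<exists>A\<in>sets borel. B = \<Omega> \<inter> A)"
  by (auto simp: sets_mu sets_restrict_space)

lemma cball_sets_mu: "\<Omega> \<inter> cball 0 R \<in> sets \<mu>"
  unfolding sets_mu_iff by (rule bexI[of _ "cball 0 R"]) auto

text \<open>In polar coordinates the radial integral of r^(2a-1) over [0, R] is R^(2a) / (2a),
  finite because a > 0, and the angular density is integrable. Integrability of bumps and
  \<sigma>-finiteness both rest on this.\<close>

lemma emeasure_cball_finite: "emeasure \<mu> (\<Omega> \<inter> cball 0 R) < \<infinity>"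
proof -
  define b where "b = 2 * a - 1"
  \<comment> \<open>A negative radius, whose ball is empty, is replaced by 0 to keep the integral
    formula applicable.\<close>
  define R' where "R' = max 0 R"
  have "((\<lambda>r. r powr b) has_integral (R' powr (b + 1) / (b + 1))) {0..R'}"
    by (rule has_integral_powr_from_0) (use a_pos in \<open>auto simp: b_def R'_def\<close>)
  from nn_integral_has_integral_lebesgue[OF _ this]
  have I: "(\<integral>\<^sup>+r. indicator {0..R'} r * r powr b \<partial>lborel) = ennreal (R' powr (b + 1) / (b + 1))"
    by simp
  have "emeasure \<mu> (\<Omega> \<inter> cball 0 R) =
      (\<integral>\<^sup>+ \<zeta>. (\<integral>\<^sup>+ r. indicator {0<..} r * indicator (\<Omega> \<inter> cball 0 R) (r *\<^sub>R \<zeta>) * ennreal (r powr b) \<partial>lborel)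
                * ennreal (Q \<zeta>) \<partial>sphere_measure)"
    unfolding b_def by (rule polar_mu[OF cball_sets_mu])
  also have "\<dots> \<le> (\<integral>\<^sup>+ \<zeta>. ennreal (R' powr (b + 1) / (b + 1)) * ennreal (Q \<zeta>) \<partial>sphere_measure)"
  proof (rule nn_integral_mono, rule mult_right_mono)
    fix \<zeta> :: 'a assume "\<zeta> \<in> space sphere_measure"
    then have "norm \<zeta> = 1" by (simp add: space_sphere_measure)
    then show "(\<integral>\<^sup>+ r. indicator {0<..} r * indicator (\<Omega> \<inter> cball 0 R) (r *\<^sub>R \<zeta>) * ennreal (r powr b) \<partial>lborel)
        \<le> ennreal (R' powr (b + 1) / (b + 1))"
      unfolding I[symmetric]
      by (intro nn_integral_mono) (auto simp: indicator_def R'_def ennreal_mult'')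
  qed simp
  also have "\<dots> = ennreal (R' powr (b + 1) / (b + 1)) * (\<integral>\<^sup>+ \<zeta>. ennreal (Q \<zeta>) \<partial>sphere_measure)"
    by (rule nn_integral_cmult) (use integrable_Q in auto)
  also have "\<dots> < \<infinity>"
  proof -
    have "(\<integral>\<^sup>+ \<zeta>. ennreal (Q \<zeta>) \<partial>sphere_measure) \<le> (\<integral>\<^sup>+ \<zeta>. ennreal (norm (Q \<zeta>)) \<partial>sphere_measure)"
      by (intro nn_integral_mono ennreal_leI) simp
    also have "\<dots> < \<infinity>" using integrable_Q by (simp add: integrable_iff_bounded)
    finally show ?thesis by (simp add: ennreal_mult_less_top)
  qed
  finally show ?thesis .
qed

lemma integrable_indicator_cball: "integrable \<mu> (\<lambda>x. indicator (cball 0 R) x :: real)"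
  using emeasure_cball_finite[of R]
  by (subst integrable_indicator_iff) (simp add: space_mu Int_commute[of _ \<Omega>] cball_sets_mu)

text \<open>Makes completeness of L2 and Fubini available for \<mu>.\<close>

sublocale sigma_finite_measure \<mu>
proof
  show "\<exists>A. countable A \<and> A \<subseteq> sets \<mu> \<and> \<Union> A = space \<mu> \<and> (\<forall>a\<in>A. emeasure \<mu> a \<noteq> \<infinity>)"
  proof (intro exI[of _ "range (\<lambda>n::nat. \<Omega> \<inter> cball 0 (real n))"] conjI ballI)
    show "\<Union> (range (\<lambda>n::nat. \<Omega> \<inter> cball 0 (real n))) = space \<mu>"
    proof (intro equalityI subsetI)
      fix x assume "x \<in> space \<mu>"
      moreover obtain n where "norm x \<le> real n" using real_arch_simple by blast
      ultimately have "x \<in> \<Omega> \<inter> cball 0 (real n)" by (simp add: space_mu)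
      then show "x \<in> \<Union> (range (\<lambda>n::nat. \<Omega> \<inter> cball 0 (real n)))" by blast
    qed (auto simp: space_mu)
    show "emeasure \<mu> B \<noteq> \<infinity>" if "B \<in> range (\<lambda>n::nat. \<Omega> \<inter> cball 0 (real n))" for B
      using that emeasure_cball_finite by (auto simp: less_top)
  qed (auto simp: cball_sets_mu)
qed

section \<open>Density of the bump functions in L1 and L2\<close>

lemma indicator_power2: "(indicator A x :: real)\<^sup>2 = indicator A x"
  by (simp add: indicator_def)

lemma L12_bounded_support:
  assumes "h \<in> borel_measurable \<mu>" "\<And>x. x \<in> \<Omega> \<Longrightarrow> cmod (h x) \<le> B * indicator (cball 0 R) x"
  shows "h \<in> L12 \<mu>"
proof (rule L12_dominated_convergence(2)[of "\<lambda>_. h" _ _ "\<lambda>x. B * indicator (cball 0 R) x"])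
  have "(\<lambda>x::'a. (B * indicator (cball 0 R) x)\<^sup>2) = (\<lambda>x. B\<^sup>2 * indicator (cball 0 R) x)"
    by (auto simp: indicator_def)
  then show "integrable \<mu> (\<lambda>x. (B * indicator (cball 0 R) x)\<^sup>2)"
    using integrable_mult_right[OF integrable_indicator_cball[of R], of "B\<^sup>2"] by (simp only:)
qed (use assms integrable_indicator_cball[of R] in \<open>auto simp: space_mu intro!: AE_I2\<close>)

lemma bump_functions_L12:
  assumes "f \<in> bump_functions" shows "f \<in> L12 \<mu>"
proof -
  obtain B n where "\<And>x. cmod (f x) \<le> B * indicator (cball 0 (real n)) x"
    using bump_functions_bound[OF assms] by metis
  moreover have "f \<in> borel_measurable \<mu>"
    by (intro borel_measurable_mu borel_measurable_continuous_onI bump_functions_continuous assms)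
  ultimately show ?thesis by (intro L12_bounded_support)
qed

text \<open>The closure of the bump functions in the sum norm. As a predicate it is stable under
  linear combinations and dominated limits, the operations that lead from boxes to bounded Borel
  sets and from these to all of \<open>L12\<close>.\<close>

definition bump_approx :: "('a \<Rightarrow> complex) \<Rightarrow> bool" where
  "bump_approx h \<longleftrightarrow> h \<in> L12 \<mu> \<and> (\<forall>e>0. \<exists>s\<in>bump_functions. L12_norm \<mu> (\<lambda>x. s x - h x) < e)"

lemma bump_approx_bump: "f \<in> bump_functions \<Longrightarrow> bump_approx f"
  unfolding bump_approx_def by (auto simp: bump_functions_L12 L12_norm_def L2norm_eq intro!: bexI[of _ f])

text \<open>The measure lives on \<Omega> but functions are total; this discards values off
  \<Omega>.\<close>

lemma bump_approx_cong:
  assumes "bump_approx f" "\<And>x. x \<in> \<Omega> \<Longrightarrow> f x = g x" shows "bump_approx g"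
proof -
  have "g \<in> L12 \<mu>"
  proof -
    have "f \<in> borel_measurable \<mu> \<longleftrightarrow> g \<in> borel_measurable \<mu>"
      by (rule measurable_cong) (simp add: space_mu assms(2))
    moreover have "integrable \<mu> f \<longleftrightarrow> integrable \<mu> g"
      by (rule Bochner_Integration.integrable_cong) (simp_all add: space_mu assms(2))
    moreover have "integrable \<mu> (\<lambda>x. (cmod (f x))\<^sup>2) \<longleftrightarrow> integrable \<mu> (\<lambda>x. (cmod (g x))\<^sup>2)"
      by (rule Bochner_Integration.integrable_cong) (simp_all add: space_mu assms(2))
    ultimately show ?thesis using assms(1) by (simp add: bump_approx_def L12_def L2_iff)
  qed
  moreover have "L12_norm \<mu> (\<lambda>x. s x - g x) = L12_norm \<mu> (\<lambda>x. s x - f x)" for s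
    unfolding L12_norm_def L2norm_eq
    by (intro arg_cong2[where f = "(+)"] arg_cong[where f = sqrt] Bochner_Integration.integral_cong refl)
       (simp_all add: space_mu assms(2))
  ultimately show ?thesis using assms(1) by (simp add: bump_approx_def)
qed

lemma bump_approx_add:
  assumes "bump_approx f" "bump_approx g" shows "bump_approx (\<lambda>x. f x + g x)"
  unfolding bump_approx_def
proof (intro conjI allI impI)
  have fg: "f \<in> L12 \<mu>" "g \<in> L12 \<mu>" using assms by (auto simp: bump_approx_def)
  show "(\<lambda>x. f x + g x) \<in> L12 \<mu>" using fg by (rule L12_add)
  fix e :: real assume "0 < e"
  then obtain s t where st: "s \<in> bump_functions" "t \<in> bump_functions"
      "L12_norm \<mu> (\<lambda>x. s x - f x) < e / 2" "L12_norm \<mu> (\<lambda>x. t x - g x) < e / 2"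
    using assms unfolding bump_approx_def by (meson half_gt_zero)
  have "L12_norm \<mu> (\<lambda>x. (s x - f x) + (t x - g x)) < e"
    using L12_norm_triangle[OF L12_diff[OF bump_functions_L12[OF st(1)] fg(1)] L12_diff[OF bump_functions_L12[OF st(2)] fg(2)]]
      st by simp
  then show "\<exists>s\<in>bump_functions. L12_norm \<mu> (\<lambda>x. s x - (f x + g x)) < e"
    using st by (intro bexI[OF _ bump_functions_add[OF st(1,2)]]) (simp add: algebra_simps)
qed

lemma bump_approx_scale:
  assumes "bump_approx f" shows "bump_approx (\<lambda>x. c * f x)"
  unfolding bump_approx_def
proof (intro conjI allI impI)
  show "(\<lambda>x. c * f x) \<in> L12 \<mu>" using assms by (auto simp: bump_approx_def intro: L12_scale)
  fix e :: real assume "0 < e"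
  then have "0 < e / (cmod c + 1)" by (simp add: add_nonneg_pos)
  then obtain s where s: "s \<in> bump_functions" "L12_norm \<mu> (\<lambda>x. s x - f x) < e / (cmod c + 1)"
    using assms unfolding bump_approx_def by blast
  have "L12_norm \<mu> (\<lambda>x. c * s x - c * f x) = cmod c * L12_norm \<mu> (\<lambda>x. s x - f x)"
    by (simp add: L12_norm_scale[symmetric] right_diff_distrib)
  also have "\<dots> \<le> (cmod c + 1) * L12_norm \<mu> (\<lambda>x. s x - f x)"
    by (simp add: distrib_right L12_norm_nonneg)
  also have "\<dots> < (cmod c + 1) * (e / (cmod c + 1))"
    using s(2) by (intro mult_strict_left_mono) (auto simp: add_nonneg_pos)
  also have "\<dots> = e" by (simp add: add_nonneg_eq_0_iff)
  finally show "\<exists>s\<in>bump_functions. L12_norm \<mu> (\<lambda>x. s x - c * f x) < e"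
    by (rule bexI[OF _ bump_functions_scale[OF s(1)]])
qed

lemma bump_approx_sum:
  "finite I \<Longrightarrow> (\<And>i. i \<in> I \<Longrightarrow> bump_approx (f i)) \<Longrightarrow> bump_approx (\<lambda>x. \<Sum>i\<in>I. f i x)"
proof (induction I rule: finite_induct)
  case empty
  show ?case using bump_approx_scale[OF bump_approx_bump[OF box_bump_in_bump_functions], of 0] by simp
qed (simp add: bump_approx_add)

lemma bump_approx_limit:
  fixes w :: "'a \<Rightarrow> real"
  assumes s: "\<And>n. bump_approx (s n)" and h: "h \<in> borel_measurable \<mu>"
    and w: "integrable \<mu> w" "integrable \<mu> (\<lambda>x. (w x)\<^sup>2)"
    and bound: "\<And>n x. x \<in> \<Omega> \<Longrightarrow> cmod (s n x) \<le> w x"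
    and lim: "\<And>x. x \<in> \<Omega> \<Longrightarrow> (\<lambda>n. s n x) \<longlonglongrightarrow> h x"
  shows "bump_approx h"
  unfolding bump_approx_def
proof (intro conjI allI impI)
  have sL: "s n \<in> L12 \<mu>" for n using s by (simp add: bump_approx_def)
  note L = L12_dominated_convergence[of s \<mu> h w]
  have bound': "AE x in \<mu>. cmod (s n x) \<le> w x" for n using bound by (auto simp: space_mu intro!: AE_I2)
  have lim': "AE x in \<mu>. (\<lambda>n. s n x) \<longlonglongrightarrow> h x" using lim by (auto simp: space_mu intro!: AE_I2)
  have sm: "s n \<in> borel_measurable \<mu>" for n using sL[of n] by (auto simp: L12_def L2_iff)
  show hL: "h \<in> L12 \<mu>" using L(2)[OF sm h w bound' lim'] .
  fix e :: real assume "0 < e"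
  then have "eventually (\<lambda>n. L12_norm \<mu> (\<lambda>x. s n x - h x) < e / 2) sequentially"
    using order_tendstoD(2)[OF L(3)[OF sm h w bound' lim'], of "e / 2"] by simp
  then obtain n where n: "L12_norm \<mu> (\<lambda>x. s n x - h x) < e / 2"
    using eventually_happens' sequentially_bot by blast
  obtain t where t: "t \<in> bump_functions" "L12_norm \<mu> (\<lambda>x. t x - s n x) < e / 2"
    using s[of n] \<open>0 < e\<close> unfolding bump_approx_def by (meson half_gt_zero)
  have "L12_norm \<mu> (\<lambda>x. (t x - s n x) + (s n x - h x)) < e"
    using L12_norm_triangle[OF L12_diff[OF bump_functions_L12[OF t(1)] sL[of n]] L12_diff[OF sL[of n] hL]] t(2) n
    by simp
  then show "\<exists>s\<in>bump_functions. L12_norm \<mu> (\<lambda>x. s x - h x) < e" using t(1) by auto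
qed

lemma box_subset_cball:
  obtains n where "box l u \<subseteq> cball (0::'a) (real n)"
proof -
  obtain r where "\<And>x. x \<in> box l u \<Longrightarrow> norm x \<le> r"
    using bounded_box[of l u] bounded_iff by metis
  moreover obtain n where "r \<le> real n" using real_arch_simple by blast
  ultimately have "box l u \<subseteq> cball 0 (real n)" by force
  then show ?thesis by (rule that)
qed

lemma bump_approx_box: "bump_approx (indicator (box l u))"
proof -
  obtain n where n: "box l u \<subseteq> cball 0 (real n)" using box_subset_cball .
  have i: "integrable \<mu> (\<lambda>x. indicator (box l u) x :: real)"
    by (rule Bochner_Integration.integrable_bound[OF integrable_indicator_cball[of "real n"]])
       (use n in \<open>auto intro!: borel_measurable_mu AE_I2 simp: indicator_def simp del: AE_I2\<close>)
  show ?thesis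
    by (rule bump_approx_limit[of "box_bump l u" _ "indicator (box l u)"])
       (use i in \<open>auto simp: indicator_power2 norm_box_bump_le box_bump_lim bump_approx_bump box_bump_in_bump_functions
         intro!: borel_measurable_mu\<close>)
qed

text \<open>Induction over the \<sigma>-algebra generated by the intersection-stable family of
  boxes. Cutting with one fixed box keeps complements and countable unions of finite
  measure.\<close>

lemma bump_approx_bounded_Borel:
  assumes "A \<in> sets borel"
  shows "bump_approx (indicator (A \<inter> box l u))"
proof -
  have eq: "sets borel = sigma_sets UNIV (range (\<lambda>(a, b). box a b :: 'a set))"
    by (subst borel_eq_box) simp
  have "Int_stable (range (\<lambda>(a, b). box a b :: 'a set))"
    by (auto simp: Int_stable_def box_Int_box)
  moreover have "range (\<lambda>(a, b). box a b :: 'a set) \<subseteq> Pow UNIV" by simp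
  moreover have "A \<in> sigma_sets UNIV (range (\<lambda>(a, b). box a b))"
    using assms by (simp add: eq)
  ultimately show ?thesis
  proof (induction A rule: sigma_sets_induct_disjoint)
    case (basic A)
    then show ?case using bump_approx_box by (auto simp: box_Int_box)
  next
    case empty
    show ?case using bump_approx_scale[OF bump_approx_box, of 0] by (simp add: indicator_def)
  next
    case (compl A)
    have "(indicator ((UNIV - A) \<inter> box l u) :: 'a \<Rightarrow> complex)
        = (\<lambda>x. indicator (box l u) x + - 1 * indicator (A \<inter> box l u) x)"
      by (auto simp: indicator_def)
    then show ?case using bump_approx_add[OF bump_approx_box bump_approx_scale[OF compl(2), of "-1"]] by simp
  next
    case (union A)
    define s where "s n x = (\<Sum>i<n. indicator (A i \<inter> box l u) x :: complex)" for n x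
    have A: "A i \<in> sets borel" for i using union(2) by (auto simp: eq)
    have disj: "disjoint_family (\<lambda>i. A i \<inter> box l u)"
      using union(1) by (auto simp: disjoint_family_on_def)
    \<comment> \<open>Disjointness makes the partial sums indicators, hence bounded by the indicator
      of one ball uniformly in n.\<close>
    have s_eq: "s n = indicator ((\<Union>i<n. A i) \<inter> box l u)" for n
    proof (induction n)
      case 0
      show ?case by (simp add: s_def fun_eq_iff)
    next
      case (Suc n)
      have "indicator ((\<Union>i<Suc n. A i) \<inter> box l u) x
          = indicator ((\<Union>i<n. A i) \<inter> box l u) x + (indicator (A n \<inter> box l u) x :: complex)" for x
      proof -
        have "x \<notin> A i" if "x \<in> A n" "i < n" for i
        proof -
          have "A i \<inter> A n = {}" using union(1) that(2) by (simp add: disjoint_family_on_def)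
          then show ?thesis using that(1) by blast
        qed
        then show ?thesis by (auto simp: indicator_def lessThan_Suc)
      qed
      moreover have "s (Suc n) x = s n x + indicator (A n \<inter> box l u) x" for x
        by (simp add: s_def)
      ultimately show ?case using Suc by (simp add: fun_eq_iff)
    qed
    obtain k where k: "box l u \<subseteq> cball 0 (real k)" using box_subset_cball by blast
    show ?case
    proof (rule bump_approx_limit[of s _ "indicator (cball 0 (real k))"])
      show "bump_approx (s n)" for n
        unfolding s_def using union(3) by (intro bump_approx_sum) auto
      show "indicator (\<Union> (range A) \<inter> box l u) \<in> borel_measurable \<mu>"
        using A by (intro borel_measurable_mu) auto
      show "cmod (s n x) \<le> indicator (cball 0 (real k)) x" for n x
        using k by (auto simp: s_eq indicator_def)
      show "(\<lambda>n. s n x) \<longlonglongrightarrow> indicator (\<Union> (range A) \<inter> box l u) x" for x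
      proof (rule tendsto_eventually)
        show "\<forall>\<^sub>F n in sequentially. s n x = indicator (\<Union> (range A) \<inter> box l u) x"
        proof (cases "\<exists>i. x \<in> A i")
          case True
          then obtain i where "x \<in> A i" by blast
          then show ?thesis
            by (intro eventually_sequentiallyI[of "Suc i"]) (auto simp: s_eq indicator_def)
        qed (auto simp: s_eq indicator_def)
      qed
    qed (use integrable_indicator_cball[of "real k"] in \<open>simp_all add: indicator_power2\<close>)
  qed
qed

lemma L12_bump_approx:
  assumes h: "h \<in> L12 \<mu>" shows "bump_approx h"
proof -
  have hm [measurable]: "h \<in> borel_measurable \<mu>" using h by (auto simp: L12_def L2_iff)
  obtain F where F: "\<And>i. simple_function \<mu> (F i)" "\<And>x. x \<in> \<Omega> \<Longrightarrow> (\<lambda>i. F i x) \<longlonglongrightarrow> h x"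
      "\<And>i x. x \<in> \<Omega> \<Longrightarrow> cmod (F i x) \<le> 2 * cmod (h x)"
    using borel_measurable_implies_sequence_metric[OF hm, of 0] by (simp add: space_mu) blast
  define b where "b n = box (- (real n *\<^sub>R One)) (real n *\<^sub>R One :: 'a)" for n
  have simple: "bump_approx (\<lambda>x. F i x * indicator (b n) x)" for i n
  proof -
    \<comment> \<open>Level sets of the simple function are only traces on \<Omega>; Borel sets of
      the whole space with these traces are chosen so that the preceding result applies.\<close>
    have "\<exists>B. B \<in> sets borel \<and> F i -` {y} \<inter> \<Omega> = \<Omega> \<inter> B" for y
      using simple_functionD(2)[OF F(1), of i "{y}"] by (auto simp: sets_mu_iff space_mu)
    then obtain B where B: "\<And>y. B y \<in> sets borel" "\<And>y. F i -` {y} \<inter> \<Omega> = \<Omega> \<inter> B y" by metis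
    have fin: "finite (F i ` \<Omega>)" using simple_functionD(1)[OF F(1), of i] by (simp add: space_mu)
    have "bump_approx (\<lambda>x. \<Sum>y\<in>F i ` \<Omega>. y * indicator (B y \<inter> b n) x)"
      using fin B(1) unfolding b_def by (intro bump_approx_sum bump_approx_scale bump_approx_bounded_Borel)
    then show ?thesis
    proof (rule bump_approx_cong)
      fix x assume x: "x \<in> \<Omega>"
      have "indicator (B y \<inter> b n) x = (if y = F i x then indicator (b n) x else 0 :: complex)" for y
        using B(2)[of y] x by (auto simp: indicator_def)
      then have "(\<Sum>y\<in>F i ` \<Omega>. y * indicator (B y \<inter> b n) x)
          = (\<Sum>y\<in>F i ` \<Omega>. if y = F i x then y * indicator (b n) x else 0)"
        by (intro sum.cong) auto
      then show "(\<Sum>y\<in>F i ` \<Omega>. y * indicator (B y \<inter> b n) x) = F i x * indicator (b n) x"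
        using fin x by simp
    qed
  qed
  show ?thesis
  proof (rule bump_approx_limit[of "\<lambda>n x. F n x * indicator (b n) x" _ "\<lambda>x. 2 * cmod (h x)"])
    show "integrable \<mu> (\<lambda>x. 2 * cmod (h x))" "integrable \<mu> (\<lambda>x. (2 * cmod (h x))\<^sup>2)"
      using h by (auto simp: L12_def L2_iff power_mult_distrib)
    show "cmod (F n x * indicator (b n) x) \<le> 2 * cmod (h x)" if "x \<in> \<Omega>" for n x
      using F(3)[OF that, of n] by (simp add: norm_mult indicator_def)
    show "(\<lambda>n. F n x * indicator (b n) x) \<longlonglongrightarrow> h x" if "x \<in> \<Omega>" for x
    proof (rule Lim_transform_eventually[OF F(2)[OF that]])
      obtain k where k: "norm x < real k" using reals_Archimedean2 by blast
      have "x \<in> b n" if "k \<le> n" for n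
        unfolding b_def mem_box
      proof
        fix i :: 'a assume "i \<in> Basis"
        then have "\<bar>x \<bullet> i\<bar> \<le> norm x" by (rule Basis_le_norm)
        then have "\<bar>x \<bullet> i\<bar> < real n" using k that by linarith
        then show "(- (real n *\<^sub>R One)) \<bullet> i < x \<bullet> i \<and> x \<bullet> i < (real n *\<^sub>R One) \<bullet> i"
          using \<open>i \<in> Basis\<close> by (auto simp: abs_less_iff)
      qed
      then show "\<forall>\<^sub>F n in sequentially. F n x = F n x * indicator (b n) x"
        by (intro eventually_sequentiallyI[of k]) simp
    qed
  qed (use simple in auto)
qed

section \<open>The integral transform on L1 and L2\<close>

abbreviation T :: "('a \<Rightarrow> complex) \<Rightarrow> 'a \<Rightarrow> complex" where
  "T \<equiv> integral_op \<mu> K"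

text \<open>\<open>K\<close> is continuous on \<Omega> x \<Omega> only, so measurability passes
  through the Borel sets of that subspace; the product of the Borel \<sigma>-algebras is the Borel
  \<sigma>-algebra of the product by second countability.\<close>

lemma K_measurable [measurable]: "(\<lambda>p. K (fst p) (snd p)) \<in> borel_measurable (\<mu> \<Otimes>\<^sub>M \<mu>)"
proof -
  have id: "(\<lambda>x. x) \<in> measurable \<mu> borel"
    by (rule borel_measurable_mu) simp
  have "(\<lambda>p. p) \<in> measurable (\<mu> \<Otimes>\<^sub>M \<mu>) (borel \<Otimes>\<^sub>M borel)"
    using measurable_Pair[OF measurable_compose[OF measurable_fst id] measurable_compose[OF measurable_snd id]]
    by simp
  then have "(\<lambda>p. p) \<in> measurable (\<mu> \<Otimes>\<^sub>M \<mu>) (restrict_space borel (\<Omega> \<times> \<Omega>))"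
    by (intro measurable_restrict_space2) (auto simp: space_pair_measure space_mu borel_prod)
  moreover have "(\<lambda>(x, \<xi>). K x \<xi>) \<in> borel_measurable (restrict_space borel (\<Omega> \<times> \<Omega>))"
    by (rule borel_measurable_continuous_on_restrict[OF continuous_K])
  ultimately have "(\<lambda>p. case p of (x, \<xi>) \<Rightarrow> K x \<xi>) \<in> borel_measurable (\<mu> \<Otimes>\<^sub>M \<mu>)"
    by (rule measurable_compose)
  then show ?thesis by (simp add: case_prod_beta)
qed

lemma T_measurable [measurable]:
  assumes [measurable]: "f \<in> borel_measurable \<mu>" shows "T f \<in> borel_measurable \<mu>"
proof -
  have "(\<lambda>p. f (snd p) * K (snd p) (fst p)) \<in> borel_measurable (\<mu> \<Otimes>\<^sub>M \<mu>)"
    using measurable_compose[OF measurable_pair_swap' K_measurable] by (simp add: split_beta)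
  then have "(\<lambda>\<xi>. LINT x|\<mu>. f x * K x \<xi>) \<in> borel_measurable \<mu>"
    by (intro borel_measurable_lebesgue_integral) (simp add: split_beta)
  then show ?thesis by (simp add: integral_op_def)
qed

lemma K_sections_measurable [measurable]:
  "x \<in> \<Omega> \<Longrightarrow> K x \<in> borel_measurable \<mu>" "\<xi> \<in> \<Omega> \<Longrightarrow> (\<lambda>x. K x \<xi>) \<in> borel_measurable \<mu>"
  using measurable_Pair2[OF K_measurable] measurable_Pair1[OF K_measurable] by (auto simp: space_mu)

lemma cK_nonneg: "0 \<le> c\<^sub>K"
proof -
  obtain x where "x \<in> \<Omega>" using interior_Omega interior_subset by fastforce
  then have "norm (K x x) \<le> c\<^sub>K" by (intro bounded_K)
  then show ?thesis using norm_ge_zero order_trans by blast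
qed

lemma T_integrable:
  assumes "integrable \<mu> f" "\<xi> \<in> \<Omega>" shows "integrable \<mu> (\<lambda>x. f x * K x \<xi>)"
proof (rule Bochner_Integration.integrable_bound)
  show "integrable \<mu> (\<lambda>x. c\<^sub>K * cmod (f x))" using assms(1) by simp
  show "AE x in \<mu>. norm (f x * K x \<xi>) \<le> norm (c\<^sub>K * cmod (f x))"
    using bounded_K[OF _ assms(2)] cK_nonneg
    by (intro AE_I2) (auto simp: norm_mult space_mu mult.commute[of c\<^sub>K] intro!: mult_left_mono)
  show "(\<lambda>x. f x * K x \<xi>) \<in> borel_measurable \<mu>"
    using assms by measurable
qed

lemma T_bound:
  assumes "integrable \<mu> f" "\<xi> \<in> \<Omega>" shows "cmod (T f \<xi>) \<le> c\<^sub>K * (LINT x|\<mu>. cmod (f x))"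
proof -
  have "cmod (T f \<xi>) \<le> (LINT x|\<mu>. cmod (f x * K x \<xi>))"
    unfolding integral_op_def by (rule integral_norm_bound)
  also have "\<dots> \<le> (LINT x|\<mu>. c\<^sub>K * cmod (f x))"
  proof (rule integral_mono)
    show "cmod (f x * K x \<xi>) \<le> c\<^sub>K * cmod (f x)" if "x \<in> space \<mu>" for x
      using bounded_K[OF _ assms(2), of x] that
      by (auto simp: norm_mult space_mu mult.commute[of c\<^sub>K] intro!: mult_left_mono)
  qed (use assms T_integrable in auto)
  finally show ?thesis by simp
qed

lemma T_diff:
  assumes "integrable \<mu> f" "integrable \<mu> g" "\<xi> \<in> \<Omega>"
  shows "T (\<lambda>x. f x - g x) \<xi> = T f \<xi> - T g \<xi>"
  using assms T_integrable by (simp add: integral_op_def left_diff_distrib)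

lemma T_add:
  assumes "integrable \<mu> f" "integrable \<mu> g" "\<xi> \<in> \<Omega>"
  shows "T (\<lambda>x. f x + g x) \<xi> = T f \<xi> + T g \<xi>"
  using assms T_integrable by (simp add: integral_op_def distrib_right)

lemma T_scale: "T (\<lambda>x. c * f x) \<xi> = c * T f \<xi>"
  by (simp add: integral_op_def mult.assoc)

text \<open>A non-integrable function has integral \<open>0\<close>, so Parseval's identity itself forces \<open>T s\<close> to be square
  integrable unless \<open>s = 0\<close> almost everywhere.\<close>

lemma T_bump:
  assumes s: "s \<in> bump_functions"
  shows "T s \<in> L2 \<mu> \<and> L2norm \<mu> (T s) = L2norm \<mu> s"
proof -
  have sL: "s \<in> L2 \<mu>" using bump_functions_L12[OF s] by (rule L12_D)
  have m: "T s \<in> borel_measurable \<mu>" using sL by (auto simp: L2_iff)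
  have P: "L2_inner \<mu> (T s) (T s) = L2_inner \<mu> s s"
    using bump_functions_schwartz[OF s] by (intro parseval)
  then have eq: "L2norm \<mu> (T s) = L2norm \<mu> s"
    by (simp add: L2_inner_self flip: of_real_power)
  have "integrable \<mu> (\<lambda>\<xi>. (cmod (T s \<xi>))\<^sup>2)"
  proof (cases "L2norm \<mu> s = 0")
    case True
    then have "AE x in \<mu>. s x = 0" using L2norm_eq_0_iff[OF sL] by simp
    then have "T s \<xi> = 0" for \<xi>
      unfolding integral_op_def by (intro integral_eq_zero_AE) auto
    then show ?thesis by simp
  next
    case False
    show ?thesis
    proof (rule ccontr)
      assume "\<not> integrable \<mu> (\<lambda>\<xi>. (cmod (T s \<xi>))\<^sup>2)"
      then have "L2norm \<mu> (T s) = 0" by (simp add: L2norm_eq not_integrable_integral_eq)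
      with eq False show False by simp
    qed
  qed
  then show ?thesis using m eq by (simp add: L2_iff)
qed

text \<open>Approximate \<open>h\<close> by bumps: L1 convergence gives pointwise convergence of the
  transforms, L2 convergence and Parseval bound their norms, and Fatou passes to the limit. This
  yields an inequality, which is enough for all later estimates.\<close>

lemma Plancherel_L12:
  assumes h: "h \<in> L12 \<mu>"
  shows "T h \<in> L2 \<mu>" "L2norm \<mu> (T h) \<le> L2norm \<mu> h"
proof -
  have "\<exists>s\<in>bump_functions. L12_norm \<mu> (\<lambda>x. s x - h x) < inverse (real (Suc n))" for n
    using L12_bump_approx[OF h] unfolding bump_approx_def by simp
  then obtain s where s: "\<And>n. s n \<in> bump_functions"
      and sh: "\<And>n. L12_norm \<mu> (\<lambda>x. s n x - h x) < inverse (real (Suc n))"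
    by metis
  have sL: "s n \<in> L12 \<mu>" for n using bump_functions_L12[OF s] .
  note dL = L12_diff[OF sL h]
  have "(\<lambda>n. T (s n) \<xi>) \<longlonglongrightarrow> T h \<xi>" if "\<xi> \<in> \<Omega>" for \<xi>
  proof (rule LIM_zero_cancel, rule Lim_null_comparison)
    have "norm (T (s n) \<xi> - T h \<xi>) \<le> c\<^sub>K * inverse (real (Suc n))" for n
    proof -
      have "norm (T (s n) \<xi> - T h \<xi>) \<le> c\<^sub>K * (LINT x|\<mu>. cmod (s n x - h x))"
        using T_bound[OF L12_D(2)[OF dL] that, of n] T_diff[OF L12_D(2)[OF sL] L12_D(2)[OF h] that, of n] by simp
      also have "\<dots> \<le> c\<^sub>K * inverse (real (Suc n))"
        using sh[of n] L2norm_nonneg[of \<mu> "\<lambda>x. s n x - h x"] cK_nonneg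
        unfolding L12_norm_def by (intro mult_left_mono) linarith+
      finally show ?thesis .
    qed
    then show "\<forall>\<^sub>F n in sequentially. norm (T (s n) \<xi> - T h \<xi>) \<le> c\<^sub>K * inverse (real (Suc n))" by simp
    show "(\<lambda>n. c\<^sub>K * inverse (real (Suc n))) \<longlonglongrightarrow> 0"
      using tendsto_mult_right_zero[OF LIMSEQ_inverse_real_of_nat] .
  qed
  then have lim: "AE \<xi> in \<mu>. (\<lambda>n. T (s n) \<xi>) \<longlonglongrightarrow> T h \<xi>" by (auto simp: space_mu)
  have hm: "h \<in> borel_measurable \<mu>" using h by (auto simp: L12_def L2_iff)
  \<comment> \<open>The slack \<open>e\<close> absorbs the approximation error, which falls below it
    only eventually.\<close>
  have *: "T h \<in> L2 \<mu> \<and> L2norm \<mu> (T h) \<le> L2norm \<mu> h + e" if "0 < e" for e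
  proof (rule L2_Fatou[OF _ T_measurable[OF hm] lim])
    show "T (s n) \<in> L2 \<mu>" for n using T_bump[OF s] by blast
    have le: "L2norm \<mu> (T (s n)) \<le> L2norm \<mu> h + inverse (real (Suc n))" for n
    proof -
      have "0 \<le> (LINT x|\<mu>. cmod (s n x - h x))" by simp
      then have "L2norm \<mu> (\<lambda>x. s n x - h x) \<le> inverse (real (Suc n))"
        using sh[of n] unfolding L12_norm_def by linarith
      then show ?thesis
        using L2norm_triangle[OF L12_D(1)[OF dL[of n]] L12_D(1)[OF h]] T_bump[OF s, of n] by simp
    qed
    have "\<forall>\<^sub>F n in sequentially. inverse (real (Suc n)) < e"
      using order_tendstoD(2)[OF LIMSEQ_inverse_real_of_nat that] .
    then show "\<forall>\<^sub>F n in sequentially. L2norm \<mu> (T (s n)) \<le> L2norm \<mu> h + e"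
    proof eventually_elim
      fix n assume "inverse (real (Suc n)) < e"
      then show "L2norm \<mu> (T (s n)) \<le> L2norm \<mu> h + e" using le[of n] by linarith
    qed
  qed
  show "T h \<in> L2 \<mu>" using *[of 1] by simp
  show "L2norm \<mu> (T h) \<le> L2norm \<mu> h" by (rule field_le_epsilon) (use * in blast)
qed

end

section \<open>Sums over singular values and weighted means\<close>

text \<open>The index set may be uncountable, as the positive reals are below. A bound on finite
  sums makes each set where f exceeds 1/(n+1) finite, and f is the increasing limit of its
  restrictions to these sets.\<close>

lemma nn_integral_count_space_le:
  fixes f :: "'b \<Rightarrow> ennreal"
  assumes fin: "\<And>F. finite F \<Longrightarrow> F \<subseteq> A \<Longrightarrow> sum f F \<le> ennreal B"
  shows "(\<integral>\<^sup>+s. f s \<partial>count_space A) \<le> ennreal B"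
proof -
  define C where "C n = {s\<in>A. ennreal (inverse (real (Suc n))) < f s}" for n
  have C: "finite (C n)" for n
  proof (rule ccontr)
    assume inf: "infinite (C n)"
    \<comment> \<open>More than B (n+1) points, each contributing over 1/(n+1), would exceed B. The
      maximum with 0 is taken because \<open>ennreal\<close> sends negative reals to 0.\<close>
    obtain k where k: "max 0 B * real (Suc n) < real k" using reals_Archimedean2 by blast
    obtain X where X: "finite X" "card X = k" "X \<subseteq> C n" using infinite_arbitrarily_large[OF inf] by blast
    have "ennreal (real k * inverse (real (Suc n))) = (\<Sum>s\<in>X. ennreal (inverse (real (Suc n))))"
      using X(2) by (simp add: ennreal_mult ennreal_of_nat_eq_real_of_nat)
    also have "\<dots> \<le> sum f X"
      by (rule sum_mono) (use X(3) in \<open>auto simp: C_def less_imp_le\<close>)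
    also have "\<dots> \<le> ennreal B" by (rule fin) (use X in \<open>auto simp: C_def\<close>)
    also have "\<dots> \<le> ennreal (max 0 B)" by (simp add: ennreal_leI)
    finally have "real k * inverse (real (Suc n)) \<le> max 0 B" by (subst (asm) ennreal_le_iff) auto
    with k show False by (simp add: field_simps)
  qed
  have SUP: "f s = (SUP n. f s * indicator (C n) s)" if "s \<in> A" for s
  proof (rule antisym)
    show "f s \<le> (SUP n. f s * indicator (C n) s)"
    proof (cases "f s = 0")
      case False
      have "f s \<le> ennreal B" using fin[of "{s}"] that by simp
      then have "f s < top" using ennreal_less_top le_less_trans by blast
      then obtain r where r: "f s = ennreal r" "0 < r"
        using False by (cases "f s") (auto simp: less_le)
      obtain n where "inverse (real (Suc n)) < r" using reals_Archimedean[OF r(2)] by blast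
      then have "s \<in> C n" using that r by (simp add: C_def ennreal_lessI)
      then have "f s = f s * indicator (C n) s" by simp
      then show ?thesis by (metis (no_types, lifting) SUP_upper UNIV_I)
    qed simp
  qed (auto intro!: SUP_least simp: indicator_def)
  have mono: "incseq (\<lambda>n s. f s * indicator (C n) s)"
  proof (rule incseq_SucI, rule le_funI)
    fix n s
    have "C n \<subseteq> C (Suc n)"
    proof
      fix s assume "s \<in> C n"
      moreover have "ennreal (inverse (real (Suc (Suc n)))) \<le> ennreal (inverse (real (Suc n)))"
        by (intro ennreal_leI) (simp add: field_simps)
      ultimately show "s \<in> C (Suc n)" unfolding C_def using le_less_trans by blast
    qed
    then show "f s * indicator (C n) s \<le> f s * indicator (C (Suc n)) s"
      by (auto simp: indicator_def)
  qed
  have "(\<integral>\<^sup>+s. f s \<partial>count_space A) = (\<integral>\<^sup>+s. (SUP n. f s * indicator (C n) s) \<partial>count_space A)"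
    by (rule nn_integral_cong) (simp flip: SUP)
  also have "\<dots> = (SUP n. \<integral>\<^sup>+s. f s * indicator (C n) s \<partial>count_space A)"
    by (rule nn_integral_monotone_convergence_SUP[OF mono]) simp
  also have "\<dots> \<le> ennreal B"
  proof (rule SUP_least)
    fix n
    have sub: "C n \<subseteq> A" by (auto simp: C_def)
    have "(\<integral>\<^sup>+s. f s * indicator (C n) s \<partial>count_space A) = (\<Sum>s\<in>C n. f s * indicator (C n) s)"
      by (rule nn_integral_count_space'[OF C _ sub]) simp
    also have "\<dots> = sum f (C n)" by simp
    also have "\<dots> \<le> ennreal B" by (rule fin[OF C sub])
    finally show "(\<integral>\<^sup>+s. f s * indicator (C n) s \<partial>count_space A) \<le> ennreal B" .
  qed
  finally show ?thesis .
qed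

text \<open>A finite sum of suprema is a supremum over simultaneous choices. The summand
  \<open>C\<close> collects the choices already made, so the induction can treat one supremum at a
  time.\<close>

lemma ennreal_sum_SUP_le:
  fixes g :: "'i \<Rightarrow> 'b \<Rightarrow> ennreal"
  assumes "finite I" "\<And>i. i \<in> I \<Longrightarrow> X i \<noteq> {}"
    and "\<And>c. (\<And>i. i \<in> I \<Longrightarrow> c i \<in> X i) \<Longrightarrow> C + (\<Sum>i\<in>I. g i (c i)) \<le> B"
  shows "C + (\<Sum>i\<in>I. SUP x\<in>X i. g i x) \<le> B"
  using assms
proof (induction I arbitrary: C rule: finite_induct)
  case empty
  then show ?case by simp
next
  case (insert j I)
  have "(C + g j x) + (\<Sum>i\<in>I. SUP x\<in>X i. g i x) \<le> B" if x: "x \<in> X j" for x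
  proof (rule insert.IH)
    fix c assume c: "\<And>i. i \<in> I \<Longrightarrow> c i \<in> X i"
    have "C + (\<Sum>i\<in>insert j I. g i ((c(j := x)) i)) \<le> B"
      by (rule insert.prems(2)) (use c x in auto)
    moreover have "(\<Sum>i\<in>I. g i ((c(j := x)) i)) = (\<Sum>i\<in>I. g i (c i))"
      by (rule sum.cong) (use insert.hyps in auto)
    ultimately show "C + g j x + (\<Sum>i\<in>I. g i (c i)) \<le> B"
      using insert.hyps by (simp add: add.assoc)
  qed (use insert.prems in auto)
  then have "(SUP x\<in>X j. g j x + (C + (\<Sum>i\<in>I. SUP x\<in>X i. g i x))) \<le> B"
    by (intro SUP_least) (simp add: ac_simps)
  then have "(SUP x\<in>X j. g j x) + (C + (\<Sum>i\<in>I. SUP x\<in>X i. g i x)) \<le> B"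
    using insert.prems(1)[of j] by (subst (asm) ennreal_SUP_add_left) auto
  then show ?case using insert.hyps by (simp add: ac_simps)
qed

text \<open>Bernoulli's inequality, obtained from Young's inequality for x^p and 1 with weights 1/p
  and 1 - 1/p.\<close>

lemma powr_ge_tangent:
  fixes x p :: real
  assumes "1 \<le> p" "0 \<le> x"
  shows "1 + p * (x - 1) \<le> x powr p"
proof (cases "x = 0")
  case False
  then have "(x powr p) powr (1 / p) * 1 powr (1 - 1 / p) \<le> 1 / p * x powr p + (1 - 1 / p) * 1"
    using assms by (intro Youngs_inequality_0) auto
  then have "x \<le> x powr p / p + (1 - 1 / p)"
    using assms False by (simp add: powr_powr)
  then have "p * x \<le> p * (x powr p / p + (1 - 1 / p))"
    using assms by (intro mult_left_mono) auto
  also have "\<dots> = x powr p + p - 1" using assms by (simp add: field_simps)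
  finally show ?thesis by (simp add: algebra_simps)
qed (use assms in simp)

lemma le_one_plus_powr:
  fixes x p :: real
  assumes "1 \<le> p" "0 \<le> x"
  shows "x \<le> 1 + x powr p"
proof (cases "x \<le> 1")
  case False
  then have "x powr 1 \<le> x powr p" using assms by (intro powr_mono) auto
  then show ?thesis using False by simp
qed (simp add: add_increasing2)

lemma integrable_powr_weight:
  fixes h w :: "'a \<Rightarrow> real"
  assumes p: "1 \<le> p" and h: "h \<in> borel_measurable M" "\<And>x. 0 \<le> h x" and w: "integrable M w" "\<And>x. 0 \<le> w x"
    and hw: "integrable M (\<lambda>x. h x powr p * w x)"
  shows "integrable M (\<lambda>x. h x * w x)"
proof (rule Bochner_Integration.integrable_bound)
  show "integrable M (\<lambda>x. w x + h x powr p * w x)" using w hw by simp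
  have "h x * w x \<le> w x + h x powr p * w x" for x
    using mult_right_mono[OF le_one_plus_powr[OF p h(2)] w(2), of x x] by (simp add: distrib_right)
  then show "AE x in M. norm (h x * w x) \<le> norm (w x + h x powr p * w x)"
    using h(2) w(2) by (intro AE_I2) (simp add: abs_mult)
qed (use h w in measurable)

text \<open>Integrate the tangent of the \<open>p\<close>-th power at the mean; since \<open>p \<ge> 1\<close>, mass less than one only helps.\<close>

lemma Jensen_powr_weight:
  fixes h w :: "'a \<Rightarrow> real"
  assumes p: "1 \<le> p" and h: "h \<in> borel_measurable M" "\<And>x. 0 \<le> h x" and w: "integrable M w" "\<And>x. 0 \<le> w x"
    and hw: "integrable M (\<lambda>x. h x powr p * w x)" and mass: "(LINT x|M. w x) \<le> 1"
  shows "(LINT x|M. h x * w x) powr p \<le> (LINT x|M. h x powr p * w x)"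
proof -
  define m where "m = (LINT x|M. h x * w x)"
  define W where "W = (LINT x|M. w x)"
  have i: "integrable M (\<lambda>x. h x * w x)"
    using integrable_powr_weight[OF p h w hw] .
  have "0 \<le> m" unfolding m_def using h w by simp
  show ?thesis
  proof (cases "m = 0")
    case True
    have "0 \<le> (LINT x|M. h x powr p * w x)" using w by simp
    then show ?thesis using True p by (simp add: m_def)
  next
    case False
    then have "0 < m" using \<open>0 \<le> m\<close> by simp
    have "m powr p * (1 - p) * w x + m powr p * (p / m) * (h x * w x) \<le> h x powr p * w x" for x
    proof -
      have "m powr p * (1 + p * (h x / m - 1)) \<le> m powr p * (h x / m) powr p"
        using powr_ge_tangent[OF p, of "h x / m"] h(2) \<open>0 < m\<close> by (intro mult_left_mono) auto
      also have "\<dots> = h x powr p" using h(2) \<open>0 < m\<close> by (simp add: powr_divide)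
      finally have "m powr p * (1 + p * (h x / m - 1)) * w x \<le> h x powr p * w x"
        using w(2) by (rule mult_right_mono)
      then show ?thesis by (simp add: algebra_simps)
    qed
    then have "(LINT x|M. m powr p * (1 - p) * w x + m powr p * (p / m) * (h x * w x)) \<le> (LINT x|M. h x powr p * w x)"
      using w i hw by (intro integral_mono) auto
    moreover have "(LINT x|M. m powr p * (1 - p) * w x + m powr p * (p / m) * (h x * w x))
        = m powr p * (1 - p) * W + m powr p * (p / m) * m"
      using w i by (simp add: W_def m_def)
    moreover have "m powr p * 1 \<le> m powr p * ((1 - p) * W + p)"
    proof (rule mult_left_mono)
      have "(p - 1) * W \<le> (p - 1) * 1" using mass p by (intro mult_left_mono) (auto simp: W_def)
      then show "1 \<le> (1 - p) * W + p" by (simp add: algebra_simps)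
    qed simp
    ultimately show ?thesis using \<open>0 < m\<close> by (simp add: m_def[symmetric] algebra_simps)
  qed
qed

section \<open>Wavelet multipliers\<close>

context homogeneous_transform
begin

text \<open>\<open>m\<close> is any bound valid almost everywhere; the essential supremum norm is
  inserted for it only in the final theorem.\<close>

definition window :: "('a \<Rightarrow> complex) \<Rightarrow> real \<Rightarrow> bool" where
  "window \<phi> m \<longleftrightarrow> \<phi> \<in> L2 \<mu> \<and> L2norm \<mu> \<phi> = 1 \<and> 0 \<le> m \<and> (AE x in \<mu>. cmod (\<phi> x) \<le> m)"

text \<open>The product is in L1 by Cauchy-Schwarz and in L2 because the window is bounded, which
  places it in the domain of the Plancherel inequality.\<close>

lemma window_mult_L12:
  assumes \<phi>: "window \<phi> m" and f: "f \<in> L2 \<mu>"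
  shows "(\<lambda>x. \<phi> x * f x) \<in> L12 \<mu>" "L2norm \<mu> (\<lambda>x. \<phi> x * f x) \<le> m * L2norm \<mu> f"
proof -
  have \<phi>': "\<phi> \<in> L2 \<mu>" "0 \<le> m" "AE x in \<mu>. cmod (\<phi> x) \<le> m" using \<phi> by (auto simp: window_def)
  have ae: "AE x in \<mu>. cmod (\<phi> x * f x) \<le> m * cmod (f x)"
    using \<phi>'(3) by eventually_elim (simp add: norm_mult mult_right_mono)
  have m: "(\<lambda>x. \<phi> x * f x) \<in> borel_measurable \<mu>"
    using \<phi>'(1) f by (intro borel_measurable_times) (auto simp: L2_iff)
  show "(\<lambda>x. \<phi> x * f x) \<in> L12 \<mu>"
    using L2_dominated[OF f m ae] L2_integrable_mult[OF \<phi>'(1) f] by (simp add: L12_def)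
  show "L2norm \<mu> (\<lambda>x. \<phi> x * f x) \<le> m * L2norm \<mu> f"
    using L2norm_dominated[OF f m ae \<phi>'(2)] .
qed

lemma window_T_L2:
  assumes \<phi>: "window \<phi> m" and f: "f \<in> L2 \<mu>"
  shows "T (\<lambda>x. \<phi> x * f x) \<in> L2 \<mu>" "L2norm \<mu> (T (\<lambda>x. \<phi> x * f x)) \<le> m * L2norm \<mu> f"
  using Plancherel_L12[OF window_mult_L12(1)[OF assms]] window_mult_L12(2)[OF assms] by auto

lemma window_T_bound:
  assumes \<phi>: "window \<phi> m" and f: "f \<in> L2 \<mu>" and \<xi>: "\<xi> \<in> \<Omega>"
  shows "cmod (T (\<lambda>x. \<phi> x * f x) \<xi>) \<le> c\<^sub>K * L2norm \<mu> f"
proof -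
  have "cmod (T (\<lambda>x. \<phi> x * f x) \<xi>) \<le> c\<^sub>K * (LINT x|\<mu>. cmod (\<phi> x * f x))"
    using T_bound[OF L12_D(2)[OF window_mult_L12(1)[OF \<phi> f]] \<xi>] .
  also have "\<dots> \<le> c\<^sub>K * L2norm \<mu> f"
    using L2_Cauchy_Schwarz_norm[of \<phi> \<mu> f] f \<phi> cK_nonneg
    by (intro mult_left_mono) (auto simp: norm_mult window_def)
  finally show ?thesis .
qed

section \<open>The adjoint integral and representing vectors\<close>

definition T_adj :: "('a \<Rightarrow> complex) \<Rightarrow> 'a \<Rightarrow> complex" where
  "T_adj u x = (LINT \<xi>|\<mu>. u \<xi> * cnj (K x \<xi>))"

lemma T_adj_measurable:
  assumes [measurable]: "u \<in> borel_measurable \<mu>" shows "T_adj u \<in> borel_measurable \<mu>"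
proof -
  have "(\<lambda>p. u (snd p) * cnj (K (fst p) (snd p))) \<in> borel_measurable (\<mu> \<Otimes>\<^sub>M \<mu>)"
    by measurable
  then have "(\<lambda>x. LINT \<xi>|\<mu>. u \<xi> * cnj (K x \<xi>)) \<in> borel_measurable \<mu>"
    by (intro borel_measurable_lebesgue_integral) (simp add: split_beta)
  then show ?thesis by (simp add: T_adj_def[abs_def])
qed

lemma T_adj_bound:
  assumes "integrable \<mu> u" "x \<in> \<Omega>" shows "cmod (T_adj u x) \<le> c\<^sub>K * (LINT \<xi>|\<mu>. cmod (u \<xi>))"
proof -
  have le: "cmod (u \<xi> * cnj (K x \<xi>)) \<le> c\<^sub>K * cmod (u \<xi>)" if "\<xi> \<in> space \<mu>" for \<xi>
    using bounded_K[OF assms(2), of \<xi>] that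
    by (auto simp: norm_mult space_mu mult.commute[of c\<^sub>K] intro!: mult_left_mono)
  have "integrable \<mu> (\<lambda>\<xi>. u \<xi> * cnj (K x \<xi>))"
    by (rule Bochner_Integration.integrable_bound[of _ "\<lambda>\<xi>. c\<^sub>K * cmod (u \<xi>)"])
       (use assms le cK_nonneg in \<open>auto intro!: AE_I2 borel_measurable_times borel_measurable_cnj K_sections_measurable\<close>)
  then have "(LINT \<xi>|\<mu>. cmod (u \<xi> * cnj (K x \<xi>))) \<le> (LINT \<xi>|\<mu>. c\<^sub>K * cmod (u \<xi>))"
    by (intro integral_mono le) (use assms in auto)
  then show ?thesis
    unfolding T_adj_def by (intro order_trans[OF integral_norm_bound]) simp
qed

lemma T_adj_Fubini:
  assumes u: "integrable \<mu> u" and h: "integrable \<mu> h"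
  shows "(LINT x|\<mu>. T_adj u x * cnj (h x)) = (LINT \<xi>|\<mu>. u \<xi> * cnj (T h \<xi>))"
proof -
  interpret P: pair_sigma_finite \<mu> \<mu> ..
  let ?g = "\<lambda>x \<xi>. u \<xi> * cnj (h x * K x \<xi>)"
  have [measurable]: "u \<in> borel_measurable \<mu>" "h \<in> borel_measurable \<mu>" using u h by auto
  have gm: "(\<lambda>p. ?g (fst p) (snd p)) \<in> borel_measurable (\<mu> \<Otimes>\<^sub>M \<mu>)" by measurable
  have uh: "integrable (\<mu> \<Otimes>\<^sub>M \<mu>) (\<lambda>p. c\<^sub>K * (cmod (h (fst p)) * cmod (u (snd p))))"
  proof (rule P.Fubini_integrable)
    show "integrable \<mu> (\<lambda>x. LINT y|\<mu>. norm (c\<^sub>K * (cmod (h (fst (x, y))) * cmod (u (snd (x, y))))))"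
      using h cK_nonneg by (simp add: abs_mult)
  qed (use u in auto)
  have "integrable (\<mu> \<Otimes>\<^sub>M \<mu>) (\<lambda>p. ?g (fst p) (snd p))"
  proof (rule Bochner_Integration.integrable_bound[OF uh gm], rule AE_I2)
    fix p assume "p \<in> space (\<mu> \<Otimes>\<^sub>M \<mu>)"
    then have "cmod (K (fst p) (snd p)) \<le> c\<^sub>K"
      by (intro bounded_K) (auto simp: space_pair_measure space_mu)
    then have "cmod (u (snd p)) * cmod (h (fst p)) * cmod (K (fst p) (snd p))
        \<le> cmod (u (snd p)) * cmod (h (fst p)) * c\<^sub>K"
      by (intro mult_left_mono) auto
    then show "norm (?g (fst p) (snd p)) \<le> norm (c\<^sub>K * (cmod (h (fst p)) * cmod (u (snd p))))"
      using cK_nonneg by (simp add: norm_mult abs_mult mult_ac)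
  qed
  then have "integrable (\<mu> \<Otimes>\<^sub>M \<mu>) (case_prod ?g)" by (simp add: case_prod_beta')
  from P.Fubini_integral[OF this]
  have "(LINT x|\<mu>. LINT \<xi>|\<mu>. ?g x \<xi>) = (LINT \<xi>|\<mu>. LINT x|\<mu>. ?g x \<xi>)" by simp
  moreover have "(LINT \<xi>|\<mu>. ?g x \<xi>) = T_adj u x * cnj (h x)" for x
  proof -
    have "(\<lambda>\<xi>. ?g x \<xi>) = (\<lambda>\<xi>. (u \<xi> * cnj (K x \<xi>)) * cnj (h x))" by (simp add: mult_ac)
    then show ?thesis unfolding T_adj_def by simp
  qed
  moreover have "(LINT x|\<mu>. ?g x \<xi>) = u \<xi> * cnj (T h \<xi>)" for \<xi>
    unfolding integral_op_def Bochner_Integration.integral_cnj[symmetric] by simp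
  ultimately show ?thesis by (simp only:)
qed

text \<open>Fubini moves the kernel across, so the vector is explicit: the conjugate window times
  the adjoint integral of \<open>u\<close>. It is in L2 because that integral is bounded and the
  window is in L2.\<close>

lemma representation_L1:
  assumes \<psi>: "window \<psi> m" and u: "integrable \<mu> u"
  shows "\<exists>v\<in>L2 \<mu>. \<forall>g\<in>L2 \<mu>. L2_inner \<mu> v g = (LINT \<xi>|\<mu>. u \<xi> * cnj (T (\<lambda>x. \<psi> x * g x) \<xi>))"
proof (rule bexI[of _ "\<lambda>x. cnj (\<psi> x) * T_adj u x"], rule ballI)
  have um: "u \<in> borel_measurable \<mu>" using u by auto
  have \<psi>': "\<psi> \<in> L2 \<mu>" using \<psi> by (simp add: window_def)
  show "(\<lambda>x. cnj (\<psi> x) * T_adj u x) \<in> L2 \<mu>"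
  proof (rule L2_dominated[OF \<psi>'])
    show "(\<lambda>x. cnj (\<psi> x) * T_adj u x) \<in> borel_measurable \<mu>"
      using L2_measurable[OF \<psi>'] T_adj_measurable[OF um] by measurable
    show "AE x in \<mu>. cmod (cnj (\<psi> x) * T_adj u x) \<le> (c\<^sub>K * (LINT \<xi>|\<mu>. cmod (u \<xi>))) * cmod (\<psi> x)"
      using T_adj_bound[OF u] by (intro AE_I2) (simp add: norm_mult space_mu mult.commute mult_left_mono)
  qed
  fix g assume g: "g \<in> L2 \<mu>"
  have "L2_inner \<mu> (\<lambda>x. cnj (\<psi> x) * T_adj u x) g = (LINT x|\<mu>. T_adj u x * cnj (\<psi> x * g x))"
    by (simp add: L2_inner_def mult_ac)
  also have "\<dots> = (LINT \<xi>|\<mu>. u \<xi> * cnj (T (\<lambda>x. \<psi> x * g x) \<xi>))"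
    using u L12_D(2)[OF window_mult_L12(1)[OF \<psi> g]] by (rule T_adj_Fubini)
  finally show "L2_inner \<mu> (\<lambda>x. cnj (\<psi> x) * T_adj u x) g = (LINT \<xi>|\<mu>. u \<xi> * cnj (T (\<lambda>x. \<psi> x * g x) \<xi>))" .
qed

text \<open>For \<open>u\<close> in L2 the adjoint integral need not converge, so no formula is
  available. Truncations of \<open>u\<close> to balls are integrable and have explicit vectors;
  these form a Cauchy sequence whose limit represents \<open>u\<close>.\<close>

lemma representation_L2:
  assumes \<psi>: "window \<psi> m" and u: "u \<in> L2 \<mu>"
  shows "\<exists>v\<in>L2 \<mu>. \<forall>g\<in>L2 \<mu>. L2_inner \<mu> v g = (LINT \<xi>|\<mu>. u \<xi> * cnj (T (\<lambda>x. \<psi> x * g x) \<xi>))"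
proof -
  let ?G = "\<lambda>g. T (\<lambda>x. \<psi> x * g x)"
  have m: "0 \<le> m" using \<psi> by (simp add: window_def)
  define U where "U n \<xi> = u \<xi> * indicator (cball 0 (real n)) \<xi>" for n :: nat and \<xi>
  have [measurable]: "u \<in> borel_measurable \<mu>" using u by (simp add: L2_iff)
  have indm [measurable]: "(\<lambda>x. indicator (cball 0 (real n)) x :: complex) \<in> borel_measurable \<mu>" for n
    by (intro borel_measurable_mu borel_measurable_indicator borel_closed closed_cball)
  have Um [measurable]: "U n \<in> borel_measurable \<mu>" for n unfolding U_def by measurable
  have UL2: "U n \<in> L2 \<mu>" for n
    by (rule L2_dominated[OF u Um, of _ 1]) (auto simp: U_def norm_mult indicator_def)
  have ind: "(\<lambda>x. indicator (cball 0 (real n)) x :: complex) \<in> L2 \<mu>" for n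
    by (rule L12_D(1)[OF L12_bounded_support[OF indm, of _ 1 "real n"]]) (simp add: indicator_def)
  have Ui: "integrable \<mu> (U n)" for n unfolding U_def by (rule L2_integrable_mult[OF u ind])
  have Ulim: "(\<lambda>n. L2norm \<mu> (\<lambda>\<xi>. U n \<xi> - u \<xi>)) \<longlonglongrightarrow> 0"
  proof -
    have "(\<lambda>n. LINT \<xi>|\<mu>. (cmod (U n \<xi> - u \<xi>))\<^sup>2) \<longlonglongrightarrow> (LINT \<xi>|\<mu>. 0)"
    proof (rule integral_dominated_convergence[where w = "\<lambda>\<xi>. (cmod (u \<xi>))\<^sup>2"])
      show "integrable \<mu> (\<lambda>\<xi>. (cmod (u \<xi>))\<^sup>2)" using u by (simp add: L2_iff)
      show "AE \<xi> in \<mu>. norm ((cmod (U n \<xi> - u \<xi>))\<^sup>2) \<le> (cmod (u \<xi>))\<^sup>2" for n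
        by (intro AE_I2) (auto simp: U_def indicator_def)
      show "AE \<xi> in \<mu>. (\<lambda>n. (cmod (U n \<xi> - u \<xi>))\<^sup>2) \<longlonglongrightarrow> 0"
      proof (intro AE_I2 tendsto_eventually)
        fix \<xi> :: 'a
        obtain k where "norm \<xi> \<le> real k" using real_arch_simple by blast
        then show "\<forall>\<^sub>F n in sequentially. (cmod (U n \<xi> - u \<xi>))\<^sup>2 = 0"
          by (intro eventually_sequentiallyI[of k]) (auto simp: U_def indicator_def)
      qed
    qed measurable
    then show ?thesis unfolding L2norm_eq using tendsto_real_sqrt by fastforce
  qed
  have "\<forall>n. \<exists>v\<in>L2 \<mu>. \<forall>g\<in>L2 \<mu>. L2_inner \<mu> v g = (LINT \<xi>|\<mu>. U n \<xi> * cnj (?G g \<xi>))"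
    using representation_L1[OF \<psi> Ui] by blast
  then obtain v where v: "\<And>n. v n \<in> L2 \<mu>"
      and vU: "\<And>n g. g \<in> L2 \<mu> \<Longrightarrow> L2_inner \<mu> (v n) g = L2_inner \<mu> (U n) (?G g)"
    unfolding L2_inner_def[of \<mu> "U _"] by metis
  note GL2 = window_T_L2[OF \<psi>]
  \<comment> \<open>Testing \<open>?d\<close> against itself bounds its squared norm by the norms of
    \<open>U i - U j\<close> and of \<open>?G ?d\<close>; one factor, the norm of \<open>?d\<close>,
    cancels.\<close>
  have bound: "L2norm \<mu> (\<lambda>x. v i x - v j x) \<le> m * L2norm \<mu> (\<lambda>\<xi>. U i \<xi> - U j \<xi>)" for i j
  proof -
    let ?d = "\<lambda>x. v i x - v j x"
    have d: "?d \<in> L2 \<mu>" using v by blast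
    have "L2_inner \<mu> ?d ?d = L2_inner \<mu> (\<lambda>\<xi>. U i \<xi> - U j \<xi>) (?G ?d)"
      by (simp add: L2_inner_diff_left[OF v v d] vU[OF d] L2_inner_diff_left[OF UL2 UL2 GL2(1)[OF d]])
    then have "(L2norm \<mu> ?d)\<^sup>2 = cmod (L2_inner \<mu> (\<lambda>\<xi>. U i \<xi> - U j \<xi>) (?G ?d))"
      by (metis L2_inner_self norm_of_real abs_of_nonneg zero_le_power2)
    also have "\<dots> \<le> L2norm \<mu> (\<lambda>\<xi>. U i \<xi> - U j \<xi>) * L2norm \<mu> (?G ?d)"
      by (rule L2_Cauchy_Schwarz[OF L2_diff[OF UL2 UL2] GL2(1)[OF d]])
    also have "\<dots> \<le> L2norm \<mu> (\<lambda>\<xi>. U i \<xi> - U j \<xi>) * (m * L2norm \<mu> ?d)"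
      by (rule mult_left_mono[OF GL2(2)[OF d]]) simp
    finally have "L2norm \<mu> ?d * L2norm \<mu> ?d \<le> (m * L2norm \<mu> (\<lambda>\<xi>. U i \<xi> - U j \<xi>)) * L2norm \<mu> ?d"
      by (simp add: power2_eq_square mult_ac)
    then show ?thesis
      by (cases "L2norm \<mu> ?d = 0") (auto simp: m mult_le_cancel_right less_le)
  qed
  have cauchy: "\<exists>N. \<forall>i\<ge>N. \<forall>j\<ge>N. L2norm \<mu> (\<lambda>x. v i x - v j x) < e" if "0 < e" for e
  proof -
    \<comment> \<open>Only 0 \<le> m is at hand, so the division is by m + 1.\<close>
    have "0 < e / (m + 1) / 2" using that m by simp
    then have "\<forall>\<^sub>F n in sequentially. L2norm \<mu> (\<lambda>\<xi>. U n \<xi> - u \<xi>) < e / (m + 1) / 2"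
      using order_tendstoD(2)[OF Ulim] by blast
    then obtain N where N: "\<And>n. N \<le> n \<Longrightarrow> L2norm \<mu> (\<lambda>\<xi>. U n \<xi> - u \<xi>) < e / (m + 1) / 2"
      by (auto simp: eventually_sequentially)
    have "L2norm \<mu> (\<lambda>x. v i x - v j x) < e" if "N \<le> i" "N \<le> j" for i j
    proof -
      have "L2norm \<mu> (\<lambda>\<xi>. U i \<xi> - U j \<xi>) < e / (m + 1) / 2 + e / (m + 1) / 2"
        using L2norm_triangle_diff[OF UL2 u UL2, of i j] N[OF that(1)] N[OF that(2)]
        by (simp add: L2norm_minus_commute[of \<mu> u])
      also have "\<dots> = e / (m + 1)" by (rule field_sum_of_halves)
      finally have "(m + 1) * L2norm \<mu> (\<lambda>\<xi>. U i \<xi> - U j \<xi>) < e"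
        using m by (simp add: field_simps)
      moreover have "m * L2norm \<mu> (\<lambda>\<xi>. U i \<xi> - U j \<xi>) \<le> (m + 1) * L2norm \<mu> (\<lambda>\<xi>. U i \<xi> - U j \<xi>)"
        by (intro mult_right_mono) auto
      ultimately show ?thesis using bound[of i j] by linarith
    qed
    then show ?thesis by blast
  qed
  obtain w where w: "w \<in> L2 \<mu>" "(\<lambda>n. L2norm \<mu> (\<lambda>x. v n x - w x)) \<longlonglongrightarrow> 0"
    using L2_complete[OF v cauchy] by blast
  have "L2_inner \<mu> w g = L2_inner \<mu> u (?G g)" if g: "g \<in> L2 \<mu>" for g
    using LIMSEQ_unique[OF L2_inner_tendsto_left[OF v w(1) g w(2)]]
      L2_inner_tendsto_left[OF UL2 u GL2(1)[OF g] Ulim] by (simp add: vU[OF g])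
  then show ?thesis using w(1) unfolding L2_inner_def[of \<mu> u] by blast
qed

end

section \<open>Existence of the multiplier and admissible symbols\<close>

lemma is_wavelet_multiplierI:
  assumes "\<And>f. f \<in> L2 M \<Longrightarrow> \<exists>v\<in>L2 M. \<forall>g\<in>L2 M. L2_inner M v g =
      (LINT \<xi>|M. \<sigma> \<xi> * integral_op M K (\<lambda>x. \<phi> x * f x) \<xi> * cnj (integral_op M K (\<lambda>x. \<psi> x * g x) \<xi>))"
  shows "is_wavelet_multiplier M K \<psi> \<sigma> \<phi> (wavelet_multiplier M K \<psi> \<sigma> \<phi>)"
proof -
  \<comment> \<open>The weak identity is solved for one \<open>f\<close> at a time and choice
    assembles the solutions into a map; its linearity is derived later from uniqueness.\<close>
  obtain L where "\<forall>f\<in>L2 M. L f \<in> L2 M \<and> (\<forall>g\<in>L2 M. L2_inner M (L f) g =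
      (LINT \<xi>|M. \<sigma> \<xi> * integral_op M K (\<lambda>x. \<phi> x * f x) \<xi> * cnj (integral_op M K (\<lambda>x. \<psi> x * g x) \<xi>)))"
    using bchoice[of "L2 M" "\<lambda>f v. v \<in> L2 M \<and> (\<forall>g\<in>L2 M. L2_inner M v g =
      (LINT \<xi>|M. \<sigma> \<xi> * integral_op M K (\<lambda>x. \<phi> x * f x) \<xi> * cnj (integral_op M K (\<lambda>x. \<psi> x * g x) \<xi>)))"]
      assms by blast
  then have "is_wavelet_multiplier M K \<psi> \<sigma> \<phi> L" by (simp add: is_wavelet_multiplier_def)
  then show ?thesis
    unfolding wavelet_multiplier_def by (rule someI[of "is_wavelet_multiplier M K \<psi> \<sigma> \<phi>"])
qed

text \<open>The assumptions are symmetric in the two windows. Interpreting the locale with the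
  windows exchanged provides the adjoint and the Bessel inequality for the second window.\<close>

locale wavelet_windows = homogeneous_transform +
  fixes \<phi> \<psi> :: "'a \<Rightarrow> complex" and m n :: real
  assumes \<phi>: "window \<phi> m" and \<psi>: "window \<psi> n" and mn: "m * n \<le> 1"
begin

abbreviation F :: "('a \<Rightarrow> complex) \<Rightarrow> 'a \<Rightarrow> complex" where
  "F f \<equiv> T (\<lambda>x. \<phi> x * f x)"

abbreviation G :: "('a \<Rightarrow> complex) \<Rightarrow> 'a \<Rightarrow> complex" where
  "G g \<equiv> T (\<lambda>x. \<psi> x * g x)"

definition form :: "('a \<Rightarrow> complex) \<Rightarrow> ('a \<Rightarrow> complex) \<Rightarrow> ('a \<Rightarrow> complex) \<Rightarrow> complex" where
  "form \<sigma> f g = (LINT \<xi>|\<mu>. \<sigma> \<xi> * F f \<xi> * cnj (G g \<xi>))"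

text \<open>Integrability belongs to the predicate because linearity of \<open>form\<close> depends
  on it, and a representing vector because it is built case by case. All clauses survive addition of
  symbols.\<close>

definition bounded_symbol :: "('a \<Rightarrow> complex) \<Rightarrow> real \<Rightarrow> bool" where
  "bounded_symbol \<sigma> C \<longleftrightarrow> 0 \<le> C \<and>
     (\<forall>f\<in>L2 \<mu>. \<forall>g\<in>L2 \<mu>. integrable \<mu> (\<lambda>\<xi>. \<sigma> \<xi> * F f \<xi> * cnj (G g \<xi>)) \<and>
        cmod (form \<sigma> f g) \<le> C * (L2norm \<mu> f * L2norm \<mu> g)) \<and>
     (\<forall>f\<in>L2 \<mu>. \<exists>v\<in>L2 \<mu>. \<forall>g\<in>L2 \<mu>. L2_inner \<mu> v g = form \<sigma> f g)"

lemma F_L2: "f \<in> L2 \<mu> \<Longrightarrow> F f \<in> L2 \<mu>" "f \<in> L2 \<mu> \<Longrightarrow> L2norm \<mu> (F f) \<le> m * L2norm \<mu> f"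
  using window_T_L2[OF \<phi>] by auto

lemma G_L2: "g \<in> L2 \<mu> \<Longrightarrow> G g \<in> L2 \<mu>" "g \<in> L2 \<mu> \<Longrightarrow> L2norm \<mu> (G g) \<le> n * L2norm \<mu> g"
  using window_T_L2[OF \<psi>] by auto

lemma FG_weight:
  assumes f: "f \<in> L2 \<mu>" and g: "g \<in> L2 \<mu>"
  shows "integrable \<mu> (\<lambda>\<xi>. cmod (F f \<xi>) * cmod (G g \<xi>))"
    and "(LINT \<xi>|\<mu>. cmod (F f \<xi>) * cmod (G g \<xi>)) \<le> L2norm \<mu> f * L2norm \<mu> g"
proof -
  show "integrable \<mu> (\<lambda>\<xi>. cmod (F f \<xi>) * cmod (G g \<xi>))"
    by (rule L2_integrable_norm_mult[OF F_L2(1)[OF f] G_L2(1)[OF g]])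
  have "(LINT \<xi>|\<mu>. cmod (F f \<xi>) * cmod (G g \<xi>)) \<le> L2norm \<mu> (F f) * L2norm \<mu> (G g)"
    by (rule L2_Cauchy_Schwarz_norm[OF F_L2(1)[OF f] G_L2(1)[OF g]])
  also have "\<dots> \<le> (m * L2norm \<mu> f) * (n * L2norm \<mu> g)"
    using F_L2(2)[OF f] G_L2(2)[OF g] \<phi> by (intro mult_mono) (auto simp: window_def)
  also have "\<dots> = (m * n) * (L2norm \<mu> f * L2norm \<mu> g)" by simp
  also have "\<dots> \<le> 1 * (L2norm \<mu> f * L2norm \<mu> g)"
    using mn by (intro mult_right_mono) auto
  finally show "(LINT \<xi>|\<mu>. cmod (F f \<xi>) * cmod (G g \<xi>)) \<le> L2norm \<mu> f * L2norm \<mu> g" by simp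
qed

lemma F_bound: "f \<in> L2 \<mu> \<Longrightarrow> \<xi> \<in> \<Omega> \<Longrightarrow> cmod (F f \<xi>) \<le> c\<^sub>K * L2norm \<mu> f"
  using window_T_bound[OF \<phi>] .

lemma G_bound: "g \<in> L2 \<mu> \<Longrightarrow> \<xi> \<in> \<Omega> \<Longrightarrow> cmod (G g \<xi>) \<le> c\<^sub>K * L2norm \<mu> g"
  using window_T_bound[OF \<psi>] .

lemma FG_bound:
  assumes "f \<in> L2 \<mu>" "g \<in> L2 \<mu>" "\<xi> \<in> \<Omega>"
  shows "cmod (F f \<xi>) * cmod (G g \<xi>) \<le> c\<^sub>K\<^sup>2 * (L2norm \<mu> f * L2norm \<mu> g)"
proof -
  have "cmod (F f \<xi>) * cmod (G g \<xi>) \<le> (c\<^sub>K * L2norm \<mu> f) * (c\<^sub>K * L2norm \<mu> g)"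
    using F_bound G_bound assms cK_nonneg by (intro mult_mono) auto
  then show ?thesis by (simp add: power2_eq_square mult_ac)
qed

lemma bounded_symbol_L1:
  assumes \<sigma>: "integrable \<mu> \<sigma>"
  shows "bounded_symbol \<sigma> (c\<^sub>K\<^sup>2 * (LINT \<xi>|\<mu>. cmod (\<sigma> \<xi>)))"
  unfolding bounded_symbol_def
proof (intro conjI ballI)
  fix f g assume f: "f \<in> L2 \<mu>" and g: "g \<in> L2 \<mu>"
  let ?N = "c\<^sub>K\<^sup>2 * (L2norm \<mu> f * L2norm \<mu> g)"
  have le: "norm (\<sigma> \<xi> * F f \<xi> * cnj (G g \<xi>)) \<le> ?N * cmod (\<sigma> \<xi>)" if "\<xi> \<in> space \<mu>" for \<xi>
    using mult_left_mono[OF FG_bound[OF f g], of \<xi> "cmod (\<sigma> \<xi>)"] that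
    by (simp add: norm_mult space_mu mult_ac)
  have "0 \<le> ?N" by simp
  show int: "integrable \<mu> (\<lambda>\<xi>. \<sigma> \<xi> * F f \<xi> * cnj (G g \<xi>))"
  proof (rule Bochner_Integration.integrable_bound[of _ "\<lambda>\<xi>. ?N * cmod (\<sigma> \<xi>)"])
    show "(\<lambda>\<xi>. \<sigma> \<xi> * F f \<xi> * cnj (G g \<xi>)) \<in> borel_measurable \<mu>"
      using \<sigma> F_L2(1)[OF f, THEN L2_measurable] G_L2(1)[OF g, THEN L2_measurable]
      by (intro borel_measurable_times borel_measurable_cnj) auto
  qed (use \<sigma> le in \<open>auto intro!: AE_I2 order_trans[OF _ abs_ge_self]\<close>)
  have "cmod (form \<sigma> f g) \<le> (LINT \<xi>|\<mu>. norm (\<sigma> \<xi> * F f \<xi> * cnj (G g \<xi>)))"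
    unfolding form_def by (rule integral_norm_bound)
  also have "\<dots> \<le> (LINT \<xi>|\<mu>. ?N * cmod (\<sigma> \<xi>))"
    by (rule integral_mono[OF integrable_norm[OF int] _ le]) (use \<sigma> in auto)
  finally show "cmod (form \<sigma> f g) \<le> c\<^sub>K\<^sup>2 * (LINT \<xi>|\<mu>. cmod (\<sigma> \<xi>)) * (L2norm \<mu> f * L2norm \<mu> g)"
    by (simp add: mult_ac)
next
  fix f assume f: "f \<in> L2 \<mu>"
  have "integrable \<mu> (\<lambda>\<xi>. \<sigma> \<xi> * F f \<xi>)"
  proof (rule Bochner_Integration.integrable_bound[of _ "\<lambda>\<xi>. (c\<^sub>K * L2norm \<mu> f) * cmod (\<sigma> \<xi>)"])
    show "(\<lambda>\<xi>. \<sigma> \<xi> * F f \<xi>) \<in> borel_measurable \<mu>"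
      using \<sigma> F_L2(1)[OF f, THEN L2_measurable] by (intro borel_measurable_times) auto
    show "AE \<xi> in \<mu>. norm (\<sigma> \<xi> * F f \<xi>) \<le> norm (c\<^sub>K * L2norm \<mu> f * cmod (\<sigma> \<xi>))"
      using mult_left_mono[OF F_bound[OF f], of _ "cmod (\<sigma> _)"] cK_nonneg
      by (intro AE_I2) (simp add: norm_mult space_mu abs_mult mult.commute[of _ "cmod (\<sigma> _)"])
  qed (use \<sigma> in auto)
  from representation_L1[OF \<psi> this]
  show "\<exists>v\<in>L2 \<mu>. \<forall>g\<in>L2 \<mu>. L2_inner \<mu> v g = form \<sigma> f g" by (simp add: form_def)
qed (use cK_nonneg in auto)

lemma bounded_symbol_bounded:
  assumes \<sigma>: "\<sigma> \<in> borel_measurable \<mu>" "AE \<xi> in \<mu>. cmod (\<sigma> \<xi>) \<le> s" "0 \<le> s"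
  shows "bounded_symbol \<sigma> s"
proof -
  have sF: "(\<lambda>\<xi>. \<sigma> \<xi> * F f \<xi>) \<in> L2 \<mu>" if f: "f \<in> L2 \<mu>" for f
  proof (rule L2_dominated[OF F_L2(1)[OF f]])
    show "(\<lambda>\<xi>. \<sigma> \<xi> * F f \<xi>) \<in> borel_measurable \<mu>"
      using \<sigma>(1) F_L2(1)[OF f, THEN L2_measurable] by (intro borel_measurable_times) auto
    show "AE \<xi> in \<mu>. cmod (\<sigma> \<xi> * F f \<xi>) \<le> s * cmod (F f \<xi>)"
      using \<sigma>(2) by eventually_elim (simp add: norm_mult mult_right_mono)
  qed
  show ?thesis
    unfolding bounded_symbol_def
  proof (intro conjI ballI)
    fix f g assume f: "f \<in> L2 \<mu>" and g: "g \<in> L2 \<mu>"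
    show int: "integrable \<mu> (\<lambda>\<xi>. \<sigma> \<xi> * F f \<xi> * cnj (G g \<xi>))"
      by (rule L2_integrable_inner[OF sF[OF f] G_L2(1)[OF g]])
    have "cmod (form \<sigma> f g) \<le> (LINT \<xi>|\<mu>. norm (\<sigma> \<xi> * F f \<xi> * cnj (G g \<xi>)))"
      unfolding form_def by (rule integral_norm_bound)
    also have "\<dots> \<le> (LINT \<xi>|\<mu>. s * (cmod (F f \<xi>) * cmod (G g \<xi>)))"
    proof (rule integral_mono_AE[OF integrable_norm[OF int]])
      show "AE \<xi> in \<mu>. norm (\<sigma> \<xi> * F f \<xi> * cnj (G g \<xi>)) \<le> s * (cmod (F f \<xi>) * cmod (G g \<xi>))"
        using \<sigma>(2) by eventually_elim (simp add: norm_mult mult.assoc mult_right_mono)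
    qed (use FG_weight(1)[OF f g] in simp)
    also have "\<dots> \<le> s * (L2norm \<mu> f * L2norm \<mu> g)"
      using mult_left_mono[OF FG_weight(2)[OF f g] \<sigma>(3)] by simp
    finally show "cmod (form \<sigma> f g) \<le> s * (L2norm \<mu> f * L2norm \<mu> g)" .
  next
    fix f assume f: "f \<in> L2 \<mu>"
    from representation_L2[OF \<psi> sF[OF f]]
    show "\<exists>v\<in>L2 \<mu>. \<forall>g\<in>L2 \<mu>. L2_inner \<mu> v g = form \<sigma> f g" by (simp add: form_def)
  qed (rule \<sigma>(3))
qed

lemma bounded_symbol_add:
  assumes 1: "bounded_symbol \<sigma>\<^sub>1 C\<^sub>1" and 2: "bounded_symbol \<sigma>\<^sub>2 C\<^sub>2"
  shows "bounded_symbol (\<lambda>\<xi>. \<sigma>\<^sub>1 \<xi> + \<sigma>\<^sub>2 \<xi>) (C\<^sub>1 + C\<^sub>2)"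
proof -
  let ?\<sigma> = "\<lambda>\<xi>. \<sigma>\<^sub>1 \<xi> + \<sigma>\<^sub>2 \<xi>"
  have int: "integrable \<mu> (\<lambda>\<xi>. \<sigma>\<^sub>1 \<xi> * F f \<xi> * cnj (G g \<xi>))" "integrable \<mu> (\<lambda>\<xi>. \<sigma>\<^sub>2 \<xi> * F f \<xi> * cnj (G g \<xi>))"
    if "f \<in> L2 \<mu>" "g \<in> L2 \<mu>" for f g
    using that 1 2 by (auto simp: bounded_symbol_def)
  have form: "form ?\<sigma> f g = form \<sigma>\<^sub>1 f g + form \<sigma>\<^sub>2 f g" if "f \<in> L2 \<mu>" "g \<in> L2 \<mu>" for f g
    using int[OF that] by (simp add: form_def distrib_right)
  show ?thesis
    unfolding bounded_symbol_def
  proof (intro conjI ballI)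
    fix f g assume f: "f \<in> L2 \<mu>" and g: "g \<in> L2 \<mu>"
    show "integrable \<mu> (\<lambda>\<xi>. ?\<sigma> \<xi> * F f \<xi> * cnj (G g \<xi>))"
      using int[OF f g] by (simp add: distrib_right)
    have "cmod (form ?\<sigma> f g) \<le> cmod (form \<sigma>\<^sub>1 f g) + cmod (form \<sigma>\<^sub>2 f g)"
      unfolding form[OF f g] by (rule norm_triangle_ineq)
    also have "\<dots> \<le> C\<^sub>1 * (L2norm \<mu> f * L2norm \<mu> g) + C\<^sub>2 * (L2norm \<mu> f * L2norm \<mu> g)"
      using 1 2 f g by (intro add_mono) (auto simp: bounded_symbol_def)
    finally show "cmod (form ?\<sigma> f g) \<le> (C\<^sub>1 + C\<^sub>2) * (L2norm \<mu> f * L2norm \<mu> g)"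
      by (simp add: distrib_right)
  next
    fix f assume f: "f \<in> L2 \<mu>"
    obtain v\<^sub>1 where v1: "v\<^sub>1 \<in> L2 \<mu>" "\<And>g. g \<in> L2 \<mu> \<Longrightarrow> L2_inner \<mu> v\<^sub>1 g = form \<sigma>\<^sub>1 f g"
      using 1 f unfolding bounded_symbol_def by blast
    obtain v\<^sub>2 where v2: "v\<^sub>2 \<in> L2 \<mu>" "\<And>g. g \<in> L2 \<mu> \<Longrightarrow> L2_inner \<mu> v\<^sub>2 g = form \<sigma>\<^sub>2 f g"
      using 2 f unfolding bounded_symbol_def by blast
    have "\<forall>g\<in>L2 \<mu>. L2_inner \<mu> (\<lambda>x. v\<^sub>1 x + v\<^sub>2 x) g = form ?\<sigma> f g"
      using v1 v2 by (simp add: L2_inner_add_left form[OF f])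
    then show "\<exists>v\<in>L2 \<mu>. \<forall>g\<in>L2 \<mu>. L2_inner \<mu> v g = form ?\<sigma> f g"
      using L2_add[OF v1(1) v2(1)] by blast
  qed (use 1 2 in \<open>auto simp: bounded_symbol_def\<close>)
qed

text \<open>Cut at height 1: where |\<sigma>| > 1 it is at most |\<sigma>|^p, hence integrable, and
  the rest is bounded. The constant only ensures that the operator exists and is bounded; the sharp
  estimate comes from the singular values.\<close>

lemma bounded_symbol_Lp:
  assumes p: "1 \<le> p" and \<sigma>: "\<sigma> \<in> borel_measurable \<mu>" "integrable \<mu> (\<lambda>\<xi>. cmod (\<sigma> \<xi>) powr p)"
  shows "\<exists>C. bounded_symbol \<sigma> C"
proof -
  define \<sigma>\<^sub>1 where "\<sigma>\<^sub>1 \<xi> = (if 1 < cmod (\<sigma> \<xi>) then \<sigma> \<xi> else 0)" for \<xi>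
  define \<sigma>\<^sub>2 where "\<sigma>\<^sub>2 \<xi> = (if 1 < cmod (\<sigma> \<xi>) then 0 else \<sigma> \<xi>)" for \<xi>
  note [measurable] = \<sigma>(1)
  have "integrable \<mu> \<sigma>\<^sub>1"
  proof (rule Bochner_Integration.integrable_bound[OF \<sigma>(2)])
    have "cmod (\<sigma> \<xi>) \<le> cmod (\<sigma> \<xi>) powr p" if "1 < cmod (\<sigma> \<xi>)" for \<xi>
      using powr_mono[OF p, of "cmod (\<sigma> \<xi>)"] that by simp
    then show "AE \<xi> in \<mu>. norm (\<sigma>\<^sub>1 \<xi>) \<le> norm (cmod (\<sigma> \<xi>) powr p)"
      by (intro AE_I2) (simp add: \<sigma>\<^sub>1_def)
    show "\<sigma>\<^sub>1 \<in> borel_measurable \<mu>" unfolding \<sigma>\<^sub>1_def by measurable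
  qed
  moreover have "bounded_symbol \<sigma>\<^sub>2 1"
  proof (rule bounded_symbol_bounded)
    show "\<sigma>\<^sub>2 \<in> borel_measurable \<mu>" unfolding \<sigma>\<^sub>2_def by measurable
  qed (auto simp: \<sigma>\<^sub>2_def)
  moreover have "(\<lambda>\<xi>. \<sigma>\<^sub>1 \<xi> + \<sigma>\<^sub>2 \<xi>) = \<sigma>" by (auto simp: \<sigma>\<^sub>1_def \<sigma>\<^sub>2_def)
  ultimately show ?thesis using bounded_symbol_add[OF bounded_symbol_L1] by metis
qed

section \<open>The multiplier as a bounded operator\<close>

abbreviation W :: "('a \<Rightarrow> complex) \<Rightarrow> ('a \<Rightarrow> complex) \<Rightarrow> 'a \<Rightarrow> complex" where
  "W \<sigma> \<equiv> wavelet_multiplier \<mu> K \<psi> \<sigma> \<phi>"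

lemma W_is_wavelet_multiplier:
  "bounded_symbol \<sigma> C \<Longrightarrow> is_wavelet_multiplier \<mu> K \<psi> \<sigma> \<phi> (W \<sigma>)"
  by (rule is_wavelet_multiplierI) (simp add: bounded_symbol_def form_def)

lemma W_L2: "bounded_symbol \<sigma> C \<Longrightarrow> f \<in> L2 \<mu> \<Longrightarrow> W \<sigma> f \<in> L2 \<mu>"
  using W_is_wavelet_multiplier by (auto simp: is_wavelet_multiplier_def)

lemma W_form: "bounded_symbol \<sigma> C \<Longrightarrow> f \<in> L2 \<mu> \<Longrightarrow> g \<in> L2 \<mu> \<Longrightarrow> L2_inner \<mu> (W \<sigma> f) g = form \<sigma> f g"
  using W_is_wavelet_multiplier by (auto simp: is_wavelet_multiplier_def form_def)

text \<open>Test against \<open>W \<sigma> f\<close> itself and cancel one factor.\<close>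

lemma W_norm:
  assumes \<sigma>: "bounded_symbol \<sigma> C" and f: "f \<in> L2 \<mu>"
  shows "L2norm \<mu> (W \<sigma> f) \<le> C * L2norm \<mu> f"
proof -
  let ?v = "W \<sigma> f"
  have v: "?v \<in> L2 \<mu>" using W_L2[OF \<sigma> f] .
  have "(L2norm \<mu> ?v)\<^sup>2 = cmod (L2_inner \<mu> ?v ?v)" by (simp add: L2_inner_self norm_power)
  also have "\<dots> \<le> C * (L2norm \<mu> f * L2norm \<mu> ?v)"
    using W_form[OF \<sigma> f v] \<sigma> f v by (simp add: bounded_symbol_def)
  finally have "L2norm \<mu> ?v * L2norm \<mu> ?v \<le> (C * L2norm \<mu> f) * L2norm \<mu> ?v"
    by (simp add: power2_eq_square mult_ac)
  moreover have "0 \<le> C * L2norm \<mu> f" using \<sigma> by (simp add: bounded_symbol_def)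
  ultimately show ?thesis
    by (cases "L2norm \<mu> ?v = 0") (auto simp: mult_le_cancel_right less_le)
qed

lemma F_lincomb:
  assumes "f \<in> L2 \<mu>" "g \<in> L2 \<mu>" "\<xi> \<in> \<Omega>"
  shows "F (\<lambda>x. b * f x + c * g x) \<xi> = b * F f \<xi> + c * F g \<xi>"
proof -
  note i = L12_D(2)[OF window_mult_L12(1)[OF \<phi>]]
  have "F (\<lambda>x. b * f x + c * g x) \<xi> = T (\<lambda>x. b * (\<phi> x * f x) + c * (\<phi> x * g x)) \<xi>"
    by (simp add: algebra_simps)
  also have "\<dots> = b * F f \<xi> + c * F g \<xi>"
    using i[OF assms(1)] i[OF assms(2)] assms(3) by (subst T_add) (auto simp: T_scale)
  finally show ?thesis .
qed

lemma form_lincomb: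
  assumes \<sigma>: "bounded_symbol \<sigma> C" and f: "f \<in> L2 \<mu>" and g: "g \<in> L2 \<mu>" and h: "h \<in> L2 \<mu>"
  shows "form \<sigma> (\<lambda>x. b * f x + c * g x) h = b * form \<sigma> f h + c * form \<sigma> g h"
proof -
  have "form \<sigma> (\<lambda>x. b * f x + c * g x) h
      = (LINT \<xi>|\<mu>. b * (\<sigma> \<xi> * F f \<xi> * cnj (G h \<xi>)) + c * (\<sigma> \<xi> * F g \<xi> * cnj (G h \<xi>)))"
    unfolding form_def
  proof (rule Bochner_Integration.integral_cong[OF refl])
    fix \<xi> assume "\<xi> \<in> space \<mu>"
    then have "F (\<lambda>x. b * f x + c * g x) \<xi> = b * F f \<xi> + c * F g \<xi>"
      by (intro F_lincomb[OF f g]) (simp add: space_mu)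
    then show "\<sigma> \<xi> * F (\<lambda>x. b * f x + c * g x) \<xi> * cnj (G h \<xi>)
        = b * (\<sigma> \<xi> * F f \<xi> * cnj (G h \<xi>)) + c * (\<sigma> \<xi> * F g \<xi> * cnj (G h \<xi>))"
      by (simp only: distrib_left distrib_right mult_ac)
  qed
  also have "\<dots> = b * form \<sigma> f h + c * form \<sigma> g h"
    using \<sigma> f g h by (simp add: bounded_symbol_def form_def)
  finally show ?thesis .
qed

lemma W_bounded_op:
  assumes \<sigma>: "bounded_symbol \<sigma> C" shows "L2_bounded_op \<mu> (W \<sigma>)"
  unfolding L2_bounded_op_def
proof (intro conjI ballI allI)
  fix f g b c assume f: "f \<in> L2 \<mu>" and g: "g \<in> L2 \<mu>"
  have l: "(\<lambda>y. b * f y + c * g y) \<in> L2 \<mu>" using f g by (intro L2_add L2_scale)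
  note WL = W_L2[OF \<sigma>]
  show "AE x in \<mu>. W \<sigma> (\<lambda>y. b * f y + c * g y) x = b * W \<sigma> f x + c * W \<sigma> g x"
  proof (rule L2_inner_ext)
    fix h assume h: "h \<in> L2 \<mu>"
    have "L2_inner \<mu> (\<lambda>x. b * W \<sigma> f x + c * W \<sigma> g x) h = b * form \<sigma> f h + c * form \<sigma> g h"
      using WL[OF f] WL[OF g] h
      by (subst L2_inner_add_left) (auto simp: L2_inner_scale_left W_form[OF \<sigma>] f g)
    then show "L2_inner \<mu> (W \<sigma> (\<lambda>y. b * f y + c * g y)) h = L2_inner \<mu> (\<lambda>x. b * W \<sigma> f x + c * W \<sigma> g x) h"
      by (simp add: W_form[OF \<sigma> l h] form_lincomb[OF \<sigma> f g h])
  qed (intro WL l L2_add L2_scale f g)+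
next
  show "\<exists>C. \<forall>f\<in>L2 \<mu>. L2norm \<mu> (W \<sigma> f) \<le> C * L2norm \<mu> f"
    using W_norm[OF \<sigma>] by blast
qed (rule W_L2[OF \<sigma>])

lemma W_opnorm:
  assumes \<sigma>: "bounded_symbol \<sigma> C" shows "L2_opnorm \<mu> (W \<sigma>) \<le> C"
  unfolding L2_opnorm_def
  by (rule cInf_lower) (use W_norm[OF \<sigma>] \<sigma> in \<open>auto simp: bounded_symbol_def intro!: bdd_belowI[of _ 0]\<close>)

end

section \<open>Adjoints, singular values and compactness\<close>

lemma L2_adjoint_spec:
  assumes "L2_bounded_op M B" "\<And>f g. f \<in> L2 M \<Longrightarrow> g \<in> L2 M \<Longrightarrow> L2_inner M (A f) g = L2_inner M f (B g)"
  shows "L2_bounded_op M (L2_adjoint M A)"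
    and "\<And>f g. f \<in> L2 M \<Longrightarrow> g \<in> L2 M \<Longrightarrow> L2_inner M (A f) g = L2_inner M f (L2_adjoint M A g)"
proof -
  let ?P = "\<lambda>B. L2_bounded_op M B \<and> (\<forall>f\<in>L2 M. \<forall>g\<in>L2 M. L2_inner M (A f) g = L2_inner M f (B g))"
  have "?P (L2_adjoint M A)"
    unfolding L2_adjoint_def by (rule someI[of ?P B]) (use assms in blast)
  then show "L2_bounded_op M (L2_adjoint M A)"
    "\<And>f g. f \<in> L2 M \<Longrightarrow> g \<in> L2 M \<Longrightarrow> L2_inner M (A f) g = L2_inner M f (L2_adjoint M A g)"
    by blast+
qed

lemma Linf_norm_AE:
  assumes "f \<in> Lp_space \<infinity> M"
  shows "AE x in M. cmod (f x) \<le> Lp_norm \<infinity> M f"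
proof -
  have m: "(\<lambda>x. ennreal (cmod (f x))) \<in> borel_measurable M" and fin: "esssup M (\<lambda>x. ennreal (cmod (f x))) < top"
    using assms by (auto simp: Lp_space_def)
  have "AE x in M. ennreal (cmod (f x)) \<le> esssup M (\<lambda>x. ennreal (cmod (f x)))"
    by (rule esssup_AE)
  then show ?thesis
  proof eventually_elim
    fix x assume "ennreal (cmod (f x)) \<le> esssup M (\<lambda>x. ennreal (cmod (f x)))"
    from enn2real_mono[OF this fin] show "cmod (f x) \<le> Lp_norm \<infinity> M f"
      by (simp add: Lp_norm_def)
  qed
qed

lemma Linf_norm_nonneg: "0 \<le> Lp_norm \<infinity> M f"
  by (simp add: Lp_norm_def)

context wavelet_windows
begin

lemma swap: "wavelet_windows \<Omega> \<mu> a Q K c\<^sub>K \<psi> \<phi> n m"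
  by unfold_locales (use \<phi> \<psi> mn in \<open>simp_all add: mult.commute\<close>)

text \<open>The adjoint is again a multiplier, with the windows exchanged and the symbol conjugated.
  Once one adjoint is exhibited, the chosen \<open>L2_adjoint\<close> satisfies the defining
  identity too.\<close>

lemma W_adjoint:
  assumes p: "1 \<le> p" and \<sigma>: "\<sigma> \<in> borel_measurable \<mu>" "integrable \<mu> (\<lambda>\<xi>. cmod (\<sigma> \<xi>) powr p)"
    and f: "f \<in> L2 \<mu>" and g: "g \<in> L2 \<mu>"
  shows "L2_adjoint \<mu> (W \<sigma>) g \<in> L2 \<mu>"
    and "L2_inner \<mu> (W \<sigma> f) g = L2_inner \<mu> f (L2_adjoint \<mu> (W \<sigma>) g)"
proof -
  interpret S: wavelet_windows \<Omega> \<mu> a Q K c\<^sub>K \<psi> \<phi> n m by (rule swap)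
  obtain C where C: "bounded_symbol \<sigma> C" using bounded_symbol_Lp[OF p \<sigma>] by blast
  have "integrable \<mu> (\<lambda>\<xi>. cmod (cnj (\<sigma> \<xi>)) powr p)" using \<sigma>(2) by simp
  then obtain D where D: "S.bounded_symbol (\<lambda>\<xi>. cnj (\<sigma> \<xi>)) D"
    using S.bounded_symbol_Lp[OF p borel_measurable_cnj[OF \<sigma>(1)]] by blast
  have adj: "L2_inner \<mu> (W \<sigma> f) g = L2_inner \<mu> f (S.W (\<lambda>\<xi>. cnj (\<sigma> \<xi>)) g)"
    if f: "f \<in> L2 \<mu>" and g: "g \<in> L2 \<mu>" for f g
  proof -
    have "L2_inner \<mu> f (S.W (\<lambda>\<xi>. cnj (\<sigma> \<xi>)) g) = cnj (S.form (\<lambda>\<xi>. cnj (\<sigma> \<xi>)) g f)"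
      by (subst L2_inner_cnj) (simp only: S.W_form[OF D g f])
    also have "\<dots> = form \<sigma> f g"
      unfolding S.form_def form_def
      by (subst Bochner_Integration.integral_cnj[symmetric]) (simp add: mult_ac)
    finally show ?thesis by (simp only: W_form[OF C f g])
  qed
  have "L2_bounded_op \<mu> (L2_adjoint \<mu> (W \<sigma>))"
    by (rule L2_adjoint_spec(1)[OF S.W_bounded_op[OF D]]) (rule adj)
  then show "L2_adjoint \<mu> (W \<sigma>) g \<in> L2 \<mu>" using g by (simp add: L2_bounded_op_def)
  show "L2_inner \<mu> (W \<sigma> f) g = L2_inner \<mu> f (L2_adjoint \<mu> (W \<sigma>) g)"
    by (rule L2_adjoint_spec(2)[OF S.W_bounded_op[OF D] _ f g]) (rule adj)
qed

text \<open>Evaluating \<open>F f\<close> at a point is pairing \<open>f\<close> with a vector whose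
  norm is at most \<open>c\<^sub>K\<close>. Bessel's inequality and equicontinuity are both read off
  from this.\<close>

lemma F_inner: "F f \<xi> = L2_inner \<mu> f (\<lambda>x. cnj (\<phi> x * K x \<xi>))"
  by (simp add: integral_op_def L2_inner_def mult_ac)

lemma \<phi>_L2: "\<phi> \<in> L2 \<mu>" and \<phi>_norm: "L2norm \<mu> \<phi> = 1"
  using \<phi> by (auto simp: window_def)

lemma F_kernel:
  assumes "\<xi> \<in> \<Omega>"
  shows "(\<lambda>x. cnj (\<phi> x * K x \<xi>)) \<in> L2 \<mu>" "L2norm \<mu> (\<lambda>x. cnj (\<phi> x * K x \<xi>)) \<le> c\<^sub>K"
proof -
  have m: "(\<lambda>x. cnj (\<phi> x * K x \<xi>)) \<in> borel_measurable \<mu>"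
    using L2_measurable[OF \<phi>_L2] K_sections_measurable(2)[OF assms]
    by (intro borel_measurable_cnj borel_measurable_times)
  have ae: "AE x in \<mu>. cmod (cnj (\<phi> x * K x \<xi>)) \<le> c\<^sub>K * cmod (\<phi> x)"
    using bounded_K[OF _ assms] by (intro AE_I2) (simp add: norm_mult space_mu mult.commute[of c\<^sub>K] mult_left_mono)
  show "(\<lambda>x. cnj (\<phi> x * K x \<xi>)) \<in> L2 \<mu>" using L2_dominated[OF \<phi>_L2 m ae] .
  show "L2norm \<mu> (\<lambda>x. cnj (\<phi> x * K x \<xi>)) \<le> c\<^sub>K"
    using L2norm_dominated[OF \<phi>_L2 m ae cK_nonneg] by (simp add: \<phi>_norm)
qed

lemma F_Bessel:
  assumes "finite J" "\<And>j. j \<in> J \<Longrightarrow> e j \<in> L2 \<mu>"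
    and "\<And>i j. i \<in> J \<Longrightarrow> j \<in> J \<Longrightarrow> L2_inner \<mu> (e i) (e j) = (if i = j then 1 else 0)"
    and \<xi>: "\<xi> \<in> \<Omega>"
  shows "(\<Sum>j\<in>J. (cmod (F (e j) \<xi>))\<^sup>2) \<le> c\<^sub>K\<^sup>2"
proof -
  have "(\<Sum>j\<in>J. (cmod (F (e j) \<xi>))\<^sup>2) \<le> (L2norm \<mu> (\<lambda>x. cnj (\<phi> x * K x \<xi>)))\<^sup>2"
    unfolding F_inner by (rule L2_Bessel[OF assms(1,2) F_kernel(1)[OF \<xi>] assms(3)])
  also have "\<dots> \<le> c\<^sub>K\<^sup>2"
    using F_kernel(2)[OF \<xi>] by (intro power_mono) auto
  finally show ?thesis .
qed

section \<open>Power sums of singular values\<close>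

lemma Lp_weight_integrable:
  assumes \<sigma>: "\<sigma> \<in> borel_measurable \<mu>" "integrable \<mu> (\<lambda>\<xi>. cmod (\<sigma> \<xi>) powr p)"
    and f: "f \<in> L2 \<mu>" and g: "g \<in> L2 \<mu>"
  shows "integrable \<mu> (\<lambda>\<xi>. cmod (\<sigma> \<xi>) powr p * (cmod (F f \<xi>) * cmod (G g \<xi>)))"
proof (rule Bochner_Integration.integrable_bound)
  show "integrable \<mu> (\<lambda>\<xi>. c\<^sub>K\<^sup>2 * (L2norm \<mu> f * L2norm \<mu> g) * cmod (\<sigma> \<xi>) powr p)"
    using \<sigma>(2) by simp
  show "(\<lambda>\<xi>. cmod (\<sigma> \<xi>) powr p * (cmod (F f \<xi>) * cmod (G g \<xi>))) \<in> borel_measurable \<mu>"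
    using borel_measurable_times[OF borel_measurable_integrable[OF \<sigma>(2)]
        borel_measurable_integrable[OF FG_weight(1)[OF f g]]] .
  show "AE \<xi> in \<mu>. norm (cmod (\<sigma> \<xi>) powr p * (cmod (F f \<xi>) * cmod (G g \<xi>)))
      \<le> norm (c\<^sub>K\<^sup>2 * (L2norm \<mu> f * L2norm \<mu> g) * cmod (\<sigma> \<xi>) powr p)"
    using FG_bound[OF f g]
    by (intro AE_I2) (simp add: space_mu abs_mult mult.commute[of _ "cmod (\<sigma> _) powr p"] mult_left_mono)
qed

lemma form_powr_le:
  assumes p: "1 \<le> p" and \<sigma>: "\<sigma> \<in> borel_measurable \<mu>" "integrable \<mu> (\<lambda>\<xi>. cmod (\<sigma> \<xi>) powr p)"
    and f: "f \<in> L2 \<mu>" and g: "g \<in> L2 \<mu>" and fg: "L2norm \<mu> f * L2norm \<mu> g \<le> 1"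
  shows "cmod (form \<sigma> f g) powr p \<le> (LINT \<xi>|\<mu>. cmod (\<sigma> \<xi>) powr p * (cmod (F f \<xi>) * cmod (G g \<xi>)))"
proof -
  have "cmod (form \<sigma> f g) \<le> (LINT \<xi>|\<mu>. cmod (\<sigma> \<xi> * F f \<xi> * cnj (G g \<xi>)))"
    unfolding form_def by (rule integral_norm_bound)
  then have "cmod (form \<sigma> f g) powr p \<le> (LINT \<xi>|\<mu>. cmod (\<sigma> \<xi>) * (cmod (F f \<xi>) * cmod (G g \<xi>))) powr p"
    using p by (intro powr_mono2) (auto simp: norm_mult mult.assoc)
  also have "\<dots> \<le> (LINT \<xi>|\<mu>. cmod (\<sigma> \<xi>) powr p * (cmod (F f \<xi>) * cmod (G g \<xi>)))"
    using FG_weight[OF f g] fg \<sigma>(1)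
    by (intro Jensen_powr_weight[OF p _ _ _ _ Lp_weight_integrable[OF \<sigma> f g]]) auto
  finally show ?thesis .
qed

text \<open>With \<open>f j = A (e j) / s j\<close> one has \<open>s j = \<langle>A (e j), f j\<rangle>\<close>; Jensen's inequality handles each
  summand and Bessel's inequality for the orthonormal systems \<open>e\<close> and \<open>f\<close> bounds the sum of the weights
  \<open>\<bar>F (e j)\<bar> \<bar>G (f j)\<bar>\<close> pointwise.\<close>

lemma singular_values_powr_sum_le:
  assumes p: "1 \<le> p" and \<sigma>: "\<sigma> \<in> borel_measurable \<mu>" "integrable \<mu> (\<lambda>\<xi>. cmod (\<sigma> \<xi>) powr p)"
    and J: "finite J" and e: "\<And>j. j \<in> J \<Longrightarrow> e j \<in> L2 \<mu>"
    and on: "\<And>i j. i \<in> J \<Longrightarrow> j \<in> J \<Longrightarrow> L2_inner \<mu> (e i) (e j) = (if i = j then 1 else 0)"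
    and s: "\<And>j. j \<in> J \<Longrightarrow> 0 < s j" "\<And>j. j \<in> J \<Longrightarrow> e j \<in> singular_space \<mu> (W \<sigma>) (s j)"
  shows "(\<Sum>j\<in>J. s j powr p) \<le> c\<^sub>K\<^sup>2 * (LINT \<xi>|\<mu>. cmod (\<sigma> \<xi>) powr p)"
proof -
  interpret S: wavelet_windows \<Omega> \<mu> a Q K c\<^sub>K \<psi> \<phi> n m by (rule swap)
  obtain C where C: "bounded_symbol \<sigma> C" using bounded_symbol_Lp[OF p \<sigma>] by blast
  define v where "v j = (\<lambda>x. complex_of_real (inverse (s j)) * W \<sigma> (e j) x)" for j
  have Ae: "W \<sigma> (e j) \<in> L2 \<mu>" if "j \<in> J" for j using W_L2[OF C e[OF that]] .
  have v: "v j \<in> L2 \<mu>" if "j \<in> J" for j unfolding v_def using L2_scale[OF Ae[OF that]] .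
  \<comment> \<open>Moving one factor across with the adjoint turns the eigenvector equation into
    orthogonality of the images, with squared norms s^2; division by s then makes \<open>v\<close>
    orthonormal.\<close>
  have AA: "L2_inner \<mu> (W \<sigma> (e i)) (W \<sigma> (e j)) = (if i = j then complex_of_real ((s j)\<^sup>2) else 0)"
    if i: "i \<in> J" and j: "j \<in> J" for i j
  proof -
    let ?B = "L2_adjoint \<mu> (W \<sigma>)"
    have "L2_inner \<mu> (W \<sigma> (e i)) (W \<sigma> (e j)) = L2_inner \<mu> (e i) (?B (W \<sigma> (e j)))"
      by (rule W_adjoint(2)[OF p \<sigma> e[OF i] Ae[OF j]])
    also have "\<dots> = L2_inner \<mu> (e i) (\<lambda>x. complex_of_real ((s j)\<^sup>2) * e j x)"
      using s(2)[OF j] W_adjoint(1)[OF p \<sigma> e[OF i] Ae[OF j]] e[OF i] e[OF j]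
      by (intro L2_inner_cong_AE) (auto simp: singular_space_def L2_iff)
    also have "\<dots> = (if i = j then complex_of_real ((s j)\<^sup>2) else 0)"
      by (simp add: L2_inner_scale_right on[OF i j])
    finally show ?thesis .
  qed
  have vv: "L2_inner \<mu> (v i) (v j) = (if i = j then 1 else 0)" if "i \<in> J" "j \<in> J" for i j
  proof -
    have "L2_inner \<mu> (v i) (v j) = complex_of_real (inverse (s i)) *
        (complex_of_real (inverse (s j)) * L2_inner \<mu> (W \<sigma> (e i)) (W \<sigma> (e j)))"
      unfolding v_def L2_inner_scale_left L2_inner_scale_right by simp
    moreover have "complex_of_real (inverse (s j)) * (complex_of_real (inverse (s j)) * complex_of_real ((s j)\<^sup>2)) = 1"
    proof -
      have "inverse (s j) * (inverse (s j) * (s j)\<^sup>2) = 1"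
        using s(1)[OF that(2)] by (simp add: power2_eq_square field_simps)
      then show ?thesis by (simp only: of_real_mult[symmetric] of_real_1)
    qed
    ultimately show ?thesis using AA[OF that] by (cases "i = j") auto
  qed
  have norm1: "L2norm \<mu> g = 1" if "L2_inner \<mu> g g = 1" for g
  proof -
    have "(L2norm \<mu> g)\<^sup>2 = 1" using that unfolding L2_inner_self by (simp only: of_real_eq_1_iff)
    then show ?thesis using L2norm_nonneg[of \<mu> g] by (simp add: power2_eq_1_iff)
  qed
  have sj: "cmod (form \<sigma> (e j) (v j)) = s j" if j: "j \<in> J" for j
  proof -
    have "form \<sigma> (e j) (v j) = L2_inner \<mu> (W \<sigma> (e j)) (v j)" using W_form[OF C e[OF j] v[OF j]] by simp
    also have "\<dots> = complex_of_real (s j)"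
      using AA[OF j j] s(1)[OF j] unfolding v_def L2_inner_scale_right by (simp add: power2_eq_square)
    finally show ?thesis using s(1)[OF j] by simp
  qed
  let ?w = "\<lambda>j \<xi>. cmod (F (e j) \<xi>) * cmod (G (v j) \<xi>)"
  have int: "integrable \<mu> (\<lambda>\<xi>. cmod (\<sigma> \<xi>) powr p * ?w j \<xi>)" if "j \<in> J" for j
    using Lp_weight_integrable[OF \<sigma> e[OF that] v[OF that]] .
  have "(\<Sum>j\<in>J. s j powr p) \<le> (\<Sum>j\<in>J. (LINT \<xi>|\<mu>. cmod (\<sigma> \<xi>) powr p * ?w j \<xi>))"
  proof (rule sum_mono)
    fix j assume j: "j \<in> J"
    have "L2norm \<mu> (e j) * L2norm \<mu> (v j) \<le> 1"
      using norm1[of "e j"] norm1[of "v j"] on[OF j j] vv[OF j j] by simp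
    from form_powr_le[OF p \<sigma> e[OF j] v[OF j] this]
    show "s j powr p \<le> (LINT \<xi>|\<mu>. cmod (\<sigma> \<xi>) powr p * ?w j \<xi>)" by (simp only: sj[OF j])
  qed
  also have "\<dots> = (LINT \<xi>|\<mu>. (\<Sum>j\<in>J. cmod (\<sigma> \<xi>) powr p * ?w j \<xi>))"
    using int by simp
  also have "\<dots> \<le> (LINT \<xi>|\<mu>. c\<^sub>K\<^sup>2 * cmod (\<sigma> \<xi>) powr p)"
  proof (rule integral_mono)
    show "integrable \<mu> (\<lambda>\<xi>. \<Sum>j\<in>J. cmod (\<sigma> \<xi>) powr p * ?w j \<xi>)" using int by simp
    show "integrable \<mu> (\<lambda>\<xi>. c\<^sub>K\<^sup>2 * cmod (\<sigma> \<xi>) powr p)" using \<sigma>(2) by simp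
    fix \<xi> assume "\<xi> \<in> space \<mu>"
    then have \<xi>: "\<xi> \<in> \<Omega>" by (simp add: space_mu)
    \<comment> \<open>The 2 in 2ab \<le> a^2 + b^2 is matched by the two Bessel bounds, one per
      window, so the constant stays \<open>c\<^sub>K\<^sup>2\<close>.\<close>
    have "2 * (\<Sum>j\<in>J. ?w j \<xi>) \<le> (\<Sum>j\<in>J. (cmod (F (e j) \<xi>))\<^sup>2 + (cmod (G (v j) \<xi>))\<^sup>2)"
      unfolding sum_distrib_left
    proof (rule sum_mono)
      fix j
      show "2 * ?w j \<xi> \<le> (cmod (F (e j) \<xi>))\<^sup>2 + (cmod (G (v j) \<xi>))\<^sup>2"
        using sum_squares_bound[of "cmod (F (e j) \<xi>)" "cmod (G (v j) \<xi>)"] by (simp only: mult.assoc)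
    qed
    also have "\<dots> \<le> c\<^sub>K\<^sup>2 + c\<^sub>K\<^sup>2"
      using add_mono[OF F_Bessel[OF J e on \<xi>] S.F_Bessel[OF J v vv \<xi>]]
      by (simp add: sum.distrib)
    finally have "(\<Sum>j\<in>J. ?w j \<xi>) \<le> c\<^sub>K\<^sup>2" by simp
    then have "cmod (\<sigma> \<xi>) powr p * (\<Sum>j\<in>J. ?w j \<xi>) \<le> cmod (\<sigma> \<xi>) powr p * c\<^sub>K\<^sup>2"
      by (intro mult_left_mono) auto
    then show "(\<Sum>j\<in>J. cmod (\<sigma> \<xi>) powr p * ?w j \<xi>) \<le> c\<^sub>K\<^sup>2 * cmod (\<sigma> \<xi>) powr p"
      by (simp add: sum_distrib_left mult.commute)
  qed
  finally show ?thesis by simp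
qed

text \<open>The inner product of the images of \<open>f\<close> and \<open>g\<close>, computed with
  the adjoint on either side, equals both s^2 and t^2 times that of \<open>f\<close> and
  \<open>g\<close>. Positivity turns s \<noteq> t into different squares.\<close>

lemma singular_spaces_orthogonal:
  assumes p: "1 \<le> p" and \<sigma>: "\<sigma> \<in> borel_measurable \<mu>" "integrable \<mu> (\<lambda>\<xi>. cmod (\<sigma> \<xi>) powr p)"
    and f: "f \<in> singular_space \<mu> (W \<sigma>) s" and g: "g \<in> singular_space \<mu> (W \<sigma>) t"
    and st: "0 < s" "0 < t" "s \<noteq> t"
  shows "L2_inner \<mu> f g = 0"
proof -
  obtain C where C: "bounded_symbol \<sigma> C" using bounded_symbol_Lp[OF p \<sigma>] by blast
  have eq: "L2_inner \<mu> (W \<sigma> f) (W \<sigma> g) = complex_of_real (t\<^sup>2) * L2_inner \<mu> f g"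
    if f: "f \<in> L2 \<mu>" and g: "g \<in> singular_space \<mu> (W \<sigma>) t" for f g t
  proof -
    have g': "g \<in> L2 \<mu>" using g by (simp add: singular_space_def)
    have "L2_inner \<mu> (W \<sigma> f) (W \<sigma> g) = L2_inner \<mu> f (L2_adjoint \<mu> (W \<sigma>) (W \<sigma> g))"
      by (rule W_adjoint(2)[OF p \<sigma> f W_L2[OF C g']])
    also have "\<dots> = L2_inner \<mu> f (\<lambda>x. complex_of_real (t\<^sup>2) * g x)"
      using g W_adjoint(1)[OF p \<sigma> f W_L2[OF C g']] f g'
      by (intro L2_inner_cong_AE) (auto simp: singular_space_def L2_iff)
    finally show ?thesis by (simp add: L2_inner_scale_right)
  qed
  have fL: "f \<in> L2 \<mu>" and gL: "g \<in> L2 \<mu>" using f g by (auto simp: singular_space_def)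
  have "complex_of_real (t\<^sup>2) * L2_inner \<mu> f g = L2_inner \<mu> (W \<sigma> f) (W \<sigma> g)"
    by (rule eq[OF fL g, symmetric])
  also have "\<dots> = cnj (L2_inner \<mu> (W \<sigma> g) (W \<sigma> f))" by (rule L2_inner_cnj)
  also have "\<dots> = complex_of_real (s\<^sup>2) * cnj (L2_inner \<mu> g f)" by (simp add: eq[OF gL f])
  also have "cnj (L2_inner \<mu> g f) = L2_inner \<mu> f g" by (rule L2_inner_cnj[symmetric])
  finally have "complex_of_real (t\<^sup>2 - s\<^sup>2) * L2_inner \<mu> f g = 0"
    by (simp add: left_diff_distrib)
  moreover have "t\<^sup>2 \<noteq> s\<^sup>2" using st by (simp add: power2_eq_iff)
  ultimately show ?thesis by (simp del: of_real_diff of_real_power)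
qed

text \<open>Multiplicities are suprema over finite orthonormal systems. For finitely many values of
  s one such system is chosen in each eigenspace; together they are orthonormal, and the finite
  estimate applies.\<close>

lemma singular_power_sum_le:
  assumes p: "1 \<le> p" and \<sigma>: "\<sigma> \<in> borel_measurable \<mu>" "integrable \<mu> (\<lambda>\<xi>. cmod (\<sigma> \<xi>) powr p)"
  shows "singular_power_sum p \<mu> (W \<sigma>) \<le> ennreal (c\<^sub>K\<^sup>2 * (LINT \<xi>|\<mu>. cmod (\<sigma> \<xi>) powr p))"
  unfolding singular_power_sum_def
proof (rule nn_integral_count_space_le)
  fix I :: "real set" assume I: "finite I" "I \<subseteq> {0<..}"
  define X where "X s = {F. finite F \<and> F \<subseteq> singular_space \<mu> (W \<sigma>) s \<and>
      (\<forall>f\<in>F. \<forall>g\<in>F. L2_inner \<mu> f g = (if f = g then 1 else 0))}" for s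
  \<comment> \<open>The leading 0 is the initial value of the accumulator in
    \<open>ennreal_sum_SUP_le\<close>.\<close>
  have "0 + (\<Sum>s\<in>I. SUP F\<in>X s. of_nat (card F) * ennreal (s powr p))
      \<le> ennreal (c\<^sub>K\<^sup>2 * (LINT \<xi>|\<mu>. cmod (\<sigma> \<xi>) powr p))"
  proof (rule ennreal_sum_SUP_le[OF I(1)])
    show "X s \<noteq> {}" for s by (auto simp: X_def intro!: exI[of _ "{}"])
    fix c assume c: "\<And>s. s \<in> I \<Longrightarrow> c s \<in> X s"
    \<comment> \<open>Indexing by pairs keeps with each vector the singular value it belongs
      to.\<close>
    let ?J = "Sigma I c"
    have fin: "finite (c s)" if "s \<in> I" for s using c[OF that] by (simp add: X_def)
    have "(\<Sum>(s, f)\<in>?J. s powr p) \<le> c\<^sub>K\<^sup>2 * (LINT \<xi>|\<mu>. cmod (\<sigma> \<xi>) powr p)"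
      unfolding case_prod_beta
    proof (rule singular_values_powr_sum_le[OF p \<sigma>, where e = snd])
      show "finite ?J" using I(1) fin by auto
      show sing: "snd j \<in> singular_space \<mu> (W \<sigma>) (fst j)" if "j \<in> ?J" for j
        using that c[of "fst j"] by (auto simp: X_def)
      then show "snd j \<in> L2 \<mu>" if "j \<in> ?J" for j using that by (auto simp: singular_space_def)
      show pos: "0 < fst j" if "j \<in> ?J" for j using that I(2) by auto
      show "L2_inner \<mu> (snd i) (snd j) = (if i = j then 1 else 0)" if i: "i \<in> ?J" and j: "j \<in> ?J" for i j
      proof (cases "fst i = fst j")
        case True
        then have "snd i \<in> c (fst i)" "snd j \<in> c (fst i)" "fst i \<in> I" using i j by auto
        then show ?thesis using c[of "fst i"] True by (auto simp: X_def prod_eq_iff)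
      next
        case False
        then show ?thesis
          using singular_spaces_orthogonal[OF p \<sigma> sing[OF i] sing[OF j] pos[OF i] pos[OF j]] by auto
      qed
    qed
    moreover have "(\<Sum>(s, f)\<in>?J. s powr p) = (\<Sum>s\<in>I. real (card (c s)) * s powr p)"
      using I(1) fin by (subst sum.Sigma[symmetric]) auto
    moreover have "(\<Sum>s\<in>I. of_nat (card (c s)) * ennreal (s powr p)) = ennreal (\<Sum>s\<in>I. real (card (c s)) * s powr p)"
      by (subst sum_ennreal[symmetric]) (auto simp: ennreal_mult ennreal_of_nat_eq_real_of_nat)
    ultimately show "0 + (\<Sum>s\<in>I. of_nat (card (c s)) * ennreal (s powr p))
        \<le> ennreal (c\<^sub>K\<^sup>2 * (LINT \<xi>|\<mu>. cmod (\<sigma> \<xi>) powr p))"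
      by (simp add: ennreal_leI)
  qed
  then show "(\<Sum>s\<in>I. singular_multiplicity \<mu> (W \<sigma>) s * ennreal (s powr p))
      \<le> ennreal (c\<^sub>K\<^sup>2 * (LINT \<xi>|\<mu>. cmod (\<sigma> \<xi>) powr p))"
    unfolding singular_multiplicity_def L2_dim_def X_def SUP_mult_right_ennreal by simp
qed

section \<open>Compactness of the multiplier\<close>

lemma F_kernel_continuous:
  assumes d: "\<And>k. d k \<in> \<Omega>" and lim: "d \<longlonglongrightarrow> \<xi>" and \<xi>: "\<xi> \<in> \<Omega>"
  shows "(\<lambda>k. L2norm \<mu> (\<lambda>x. cnj (\<phi> x * K x (d k)) - cnj (\<phi> x * K x \<xi>))) \<longlonglongrightarrow> 0"
proof -
  have m: "(\<lambda>x. cnj (\<phi> x * K x \<eta>)) \<in> borel_measurable \<mu>" if "\<eta> \<in> \<Omega>" for \<eta>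
    using F_kernel(1)[OF that] by (rule L2_measurable)
  \<comment> \<open>Continuity of \<open>K\<close> only gives convergence for each fixed x;
    boundedness of \<open>K\<close> and the square integrable window supply a majorant that does not
    depend on k.\<close>
  have "(\<lambda>k. LINT x|\<mu>. (cmod (cnj (\<phi> x * K x (d k)) - cnj (\<phi> x * K x \<xi>)))\<^sup>2) \<longlonglongrightarrow> (LINT x|\<mu>. 0)"
  proof (rule integral_dominated_convergence[where w = "\<lambda>x. (2 * c\<^sub>K)\<^sup>2 * (cmod (\<phi> x))\<^sup>2"])
    show "(\<lambda>x. (cmod (cnj (\<phi> x * K x (d k)) - cnj (\<phi> x * K x \<xi>)))\<^sup>2) \<in> borel_measurable \<mu>" for k
      using m[OF d[of k]] m[OF \<xi>] by measurable
    show "integrable \<mu> (\<lambda>x. (2 * c\<^sub>K)\<^sup>2 * (cmod (\<phi> x))\<^sup>2)"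
      using \<phi>_L2 by (simp add: L2_iff)
    show "AE x in \<mu>. (\<lambda>k. (cmod (cnj (\<phi> x * K x (d k)) - cnj (\<phi> x * K x \<xi>)))\<^sup>2) \<longlonglongrightarrow> 0"
    proof (rule AE_I2)
      fix x assume "x \<in> space \<mu>"
      then have x: "x \<in> \<Omega>" by (simp add: space_mu)
      have "(\<lambda>k. (case (x, d k) of (x, \<xi>) \<Rightarrow> K x \<xi>)) \<longlonglongrightarrow> (case (x, \<xi>) of (x, \<xi>) \<Rightarrow> K x \<xi>)"
        by (rule continuous_on_tendsto_compose[OF continuous_K tendsto_Pair[OF tendsto_const lim]])
           (use x d \<xi> in auto)
      then have "(\<lambda>k. (cmod (cnj (\<phi> x * K x (d k)) - cnj (\<phi> x * K x \<xi>)))\<^sup>2)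
          \<longlonglongrightarrow> (cmod (cnj (\<phi> x * K x \<xi>) - cnj (\<phi> x * K x \<xi>)))\<^sup>2"
        by (intro tendsto_intros) simp
      then show "(\<lambda>k. (cmod (cnj (\<phi> x * K x (d k)) - cnj (\<phi> x * K x \<xi>)))\<^sup>2) \<longlonglongrightarrow> 0" by simp
    qed
    show "AE x in \<mu>. norm ((cmod (cnj (\<phi> x * K x (d k)) - cnj (\<phi> x * K x \<xi>)))\<^sup>2) \<le> (2 * c\<^sub>K)\<^sup>2 * (cmod (\<phi> x))\<^sup>2" for k
    proof (rule AE_I2)
      fix x assume "x \<in> space \<mu>"
      then have x: "x \<in> \<Omega>" by (simp add: space_mu)
      have "cmod (K x (d k) - K x \<xi>) \<le> 2 * c\<^sub>K"
        using norm_triangle_ineq4[of "K x (d k)" "K x \<xi>"] bounded_K[OF x d, of k] bounded_K[OF x \<xi>] by linarith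
      then have "cmod (\<phi> x) * cmod (K x (d k) - K x \<xi>) \<le> cmod (\<phi> x) * (2 * c\<^sub>K)"
        by (intro mult_left_mono) auto
      moreover have "cmod (cnj (\<phi> x * K x (d k)) - cnj (\<phi> x * K x \<xi>)) = cmod (\<phi> x) * cmod (K x (d k) - K x \<xi>)"
        by (simp only: complex_cnj_diff[symmetric] complex_mod_cnj right_diff_distrib[symmetric] norm_mult)
      ultimately have "(cmod (cnj (\<phi> x * K x (d k)) - cnj (\<phi> x * K x \<xi>)))\<^sup>2 \<le> (cmod (\<phi> x) * (2 * c\<^sub>K))\<^sup>2"
        by (intro power_mono) auto
      then show "norm ((cmod (cnj (\<phi> x * K x (d k)) - cnj (\<phi> x * K x \<xi>)))\<^sup>2) \<le> (2 * c\<^sub>K)\<^sup>2 * (cmod (\<phi> x))\<^sup>2"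
        by (simp add: power_mult_distrib mult.commute)
    qed
  qed simp
  then show ?thesis unfolding L2norm_eq using tendsto_real_sqrt by fastforce
qed

text \<open>The functions \<open>F (u k)\<close> are uniformly bounded and equicontinuous since \<open>\<xi> \<mapsto> \<phi> K(\<cdot>, \<xi>)\<close> is
  continuous into \<open>L\<^sup>2\<close>, so a diagonal subsequence converges pointwise.\<close>

lemma F_pointwise_convergent_subseq:
  assumes u: "\<And>k. u k \<in> L2 \<mu>" "\<And>k. L2norm \<mu> (u k) \<le> 1"
  obtains r \<tau> where "strict_mono (r :: nat \<Rightarrow> nat)" "\<And>\<xi>. \<xi> \<in> \<Omega> \<Longrightarrow> (\<lambda>k. F (u (r k)) \<xi>) \<longlonglongrightarrow> \<tau> \<xi>"
proof -
  obtain D where D: "countable D" "D \<subseteq> \<Omega>" "\<Omega> \<subseteq> closure D" using separable[of \<Omega>] .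
  have bd: "cmod (F (u k) \<xi>) \<le> c\<^sub>K" if "\<xi> \<in> D" for k \<xi>
  proof -
    have "cmod (F (u k) \<xi>) \<le> c\<^sub>K * L2norm \<mu> (u k)" using F_bound[OF u(1)] that D(2) by blast
    also have "\<dots> \<le> c\<^sub>K * 1" using u(2) cK_nonneg by (intro mult_left_mono)
    finally show ?thesis by simp
  qed
  obtain r where r: "strict_mono (r :: nat \<Rightarrow> nat)" "\<And>\<xi>. \<xi> \<in> D \<Longrightarrow> \<exists>l. (\<lambda>k. F (u (r k)) \<xi>) \<longlonglongrightarrow> l"
    using function_convergent_subsequence[OF D(1), of "\<lambda>k. F (u k)" c\<^sub>K] bd by blast
  have "\<exists>l. (\<lambda>k. F (u (r k)) \<xi>) \<longlonglongrightarrow> l" if \<xi>: "\<xi> \<in> \<Omega>" for \<xi>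
  proof -
    obtain d where d: "\<And>k. d k \<in> D" "d \<longlonglongrightarrow> \<xi>"
      using D(3) \<xi> closure_sequential by blast
    then have d': "\<And>k. d k \<in> \<Omega>" using D(2) by blast
    let ?q = "\<lambda>j. L2norm \<mu> (\<lambda>x. cnj (\<phi> x * K x (d j)) - cnj (\<phi> x * K x \<xi>))"
    \<comment> \<open>The bound \<open>?q j\<close> does not depend on \<open>k\<close>: this is the
      equicontinuity at \<xi>.\<close>
    have q: "cmod (F (u k) (d j) - F (u k) \<xi>) \<le> ?q j" for k j
    proof -
      have kd: "(\<lambda>x. cnj (\<phi> x * K x (d j)) - cnj (\<phi> x * K x \<xi>)) \<in> L2 \<mu>"
        using F_kernel(1)[OF d'] F_kernel(1)[OF \<xi>] by (rule L2_diff)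
      have "F (u k) (d j) - F (u k) \<xi> = L2_inner \<mu> (u k) (\<lambda>x. cnj (\<phi> x * K x (d j)) - cnj (\<phi> x * K x \<xi>))"
        unfolding F_inner
        by (subst (1 2 3) L2_inner_cnj)
           (simp only: L2_inner_diff_left[OF F_kernel(1)[OF d'] F_kernel(1)[OF \<xi>] u(1)] complex_cnj_diff)
      then have "cmod (F (u k) (d j) - F (u k) \<xi>) \<le> L2norm \<mu> (u k) * ?q j"
        using L2_Cauchy_Schwarz[OF u(1) kd] by simp
      also have "\<dots> \<le> 1 * ?q j" using u(2) by (intro mult_right_mono) auto
      finally show ?thesis by simp
    qed
    have "Cauchy (\<lambda>k. F (u (r k)) \<xi>)"
    proof (rule metric_CauchyI)
      fix e :: real assume "0 < e"
      then have "\<forall>\<^sub>F j in sequentially. ?q j < e / 3"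
        using order_tendstoD(2)[OF F_kernel_continuous[OF d' d(2) \<xi>], of "e / 3"] by simp
      then obtain j where j: "?q j < e / 3" using eventually_happens' sequentially_bot by blast
      have "Cauchy (\<lambda>k. F (u (r k)) (d j))"
        using r(2)[OF d(1)] convergent_def convergent_Cauchy by blast
      then obtain N where N: "\<And>k l. N \<le> k \<Longrightarrow> N \<le> l \<Longrightarrow> dist (F (u (r k)) (d j)) (F (u (r l)) (d j)) < e / 3"
        using metric_CauchyD[of _ "e / 3"] \<open>0 < e\<close> by (meson divide_pos_pos zero_less_numeral)
      have "dist (F (u (r k)) \<xi>) (F (u (r l)) \<xi>) < e" if "N \<le> k" "N \<le> l" for k l
      proof -
        have "dist (F (u (r k)) \<xi>) (F (u (r k)) (d j)) < e / 3" "dist (F (u (r l)) (d j)) (F (u (r l)) \<xi>) < e / 3"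
          using q[of "r k" j] q[of "r l" j] j by (simp_all add: dist_norm norm_minus_commute)
        then show ?thesis
          using N[OF that] dist_triangle[of "F (u (r k)) \<xi>" "F (u (r l)) \<xi>" "F (u (r k)) (d j)"]
            dist_triangle[of "F (u (r k)) (d j)" "F (u (r l)) \<xi>" "F (u (r l)) (d j)"]
          by linarith
      qed
      then show "\<exists>M. \<forall>k\<ge>M. \<forall>l\<ge>M. dist (F (u (r k)) \<xi>) (F (u (r l)) \<xi>) < e" by blast
    qed
    then show ?thesis using Cauchy_convergent convergent_def by blast
  qed
  then obtain \<tau> where "\<And>\<xi>. \<xi> \<in> \<Omega> \<Longrightarrow> (\<lambda>k. F (u (r k)) \<xi>) \<longlonglongrightarrow> \<tau> \<xi>" by metis
  then show ?thesis using that r(1) by blast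
qed

text \<open>Testing against the normalised function \<open>d / (2 \<parallel>d\<parallel>)\<close> where \<open>d = A f - A g\<close>.\<close>

lemma W_diff_norm_powr_le:
  assumes p: "1 \<le> p" and \<sigma>: "\<sigma> \<in> borel_measurable \<mu>" "integrable \<mu> (\<lambda>\<xi>. cmod (\<sigma> \<xi>) powr p)"
    and f: "f \<in> L2 \<mu>" "L2norm \<mu> f \<le> 1" and g: "g \<in> L2 \<mu>" "L2norm \<mu> g \<le> 1"
  shows "(L2norm \<mu> (\<lambda>x. W \<sigma> f x - W \<sigma> g x) / 2) powr p
    \<le> c\<^sub>K * (LINT \<xi>|\<mu>. cmod (\<sigma> \<xi>) powr p * cmod (F f \<xi> - F g \<xi>))"
proof -
  obtain C where C: "bounded_symbol \<sigma> C" using bounded_symbol_Lp[OF p \<sigma>] by blast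
  define d where "d = (\<lambda>x. W \<sigma> f x - W \<sigma> g x)"
  define N where "N = L2norm \<mu> d"
  have Wf: "W \<sigma> f \<in> L2 \<mu>" and Wg: "W \<sigma> g \<in> L2 \<mu>" using W_L2[OF C] f g by auto
  have d: "d \<in> L2 \<mu>" unfolding d_def using Wf Wg by (rule L2_diff)
  \<comment> \<open>The difference is spelled as a linear combination to fit
    \<open>F_lincomb\<close> and \<open>form_lincomb\<close>.\<close>
  have h: "(\<lambda>x. 1 * f x + (- 1) * g x) \<in> L2 \<mu>" using f g by (intro L2_add L2_scale)
  define h where "h = (\<lambda>x. 1 * f x + (- 1) * g x)"
  note h = h[folded h_def]
  have Fh: "F h \<xi> = F f \<xi> - F g \<xi>" if "\<xi> \<in> \<Omega>" for \<xi>
    unfolding h_def using F_lincomb[OF f(1) g(1) that, of 1 "- 1"] by simp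
  have h2: "L2norm \<mu> h \<le> 2"
    using L2norm_triangle[OF f(1) L2_scale[OF g(1)], of "- 1"] L2norm_scale[of \<mu> "- 1" g] f(2) g(2)
    by (simp add: h_def)
  have nn: "0 \<le> c\<^sub>K * (LINT \<xi>|\<mu>. cmod (\<sigma> \<xi>) powr p * cmod (F f \<xi> - F g \<xi>))"
    using cK_nonneg by (intro mult_nonneg_nonneg integral_nonneg_AE AE_I2) auto
  show ?thesis
  proof (cases "N = 0")
    case True
    then show ?thesis using nn p by (simp add: N_def d_def)
  next
    case False
    moreover have "0 \<le> N" by (simp add: N_def)
    ultimately have N: "0 < N" by simp
    \<comment> \<open>\<open>h\<close> may have norm up to 2, so \<open>e\<close> is given norm 1/2;
      the product is then at most 1, as \<open>form_powr_le\<close> demands. This is the origin of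
      the halving in the statement.\<close>
    define e where "e = (\<lambda>x. complex_of_real (inverse (2 * N)) * d x)"
    have e: "e \<in> L2 \<mu>" unfolding e_def using d by (rule L2_scale)
    have e2: "L2norm \<mu> e = 1 / 2"
      using N unfolding e_def L2norm_scale N_def[symmetric] by (simp add: norm_mult norm_inverse)
    have "form \<sigma> h d = L2_inner \<mu> d d"
    proof -
      have "form \<sigma> h d = form \<sigma> f d - form \<sigma> g d"
        unfolding h_def using form_lincomb[OF C f(1) g(1) d, of 1 "- 1"] by simp
      also have "\<dots> = L2_inner \<mu> d d"
        unfolding W_form[OF C f(1) d, symmetric] W_form[OF C g(1) d, symmetric]
        using L2_inner_diff_left[OF Wf Wg d] by (simp only: d_def)
      finally show ?thesis .
    qed
    then have "L2_inner \<mu> (W \<sigma> h) d = complex_of_real (N\<^sup>2)"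
      using W_form[OF C h d] by (simp add: L2_inner_self N_def)
    moreover have "form \<sigma> h e = complex_of_real (inverse (2 * N)) * L2_inner \<mu> (W \<sigma> h) d"
      unfolding W_form[OF C h e, symmetric] unfolding e_def L2_inner_scale_right by simp
    moreover have "inverse (2 * N) * N\<^sup>2 = N / 2" using N by (simp add: power2_eq_square)
    ultimately have "form \<sigma> h e = complex_of_real (N / 2)"
      by (simp only: of_real_mult[symmetric])
    then have c: "cmod (form \<sigma> h e) = N / 2"
      using N by (simp only: norm_of_real)
    have "L2norm \<mu> h * L2norm \<mu> e \<le> 1" unfolding e2 using h2 by simp
    from form_powr_le[OF p \<sigma> h e this]
    have "(N / 2) powr p \<le> (LINT \<xi>|\<mu>. cmod (\<sigma> \<xi>) powr p * (cmod (F h \<xi>) * cmod (G e \<xi>)))"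
      by (simp only: c)
    also have "\<dots> \<le> (LINT \<xi>|\<mu>. c\<^sub>K * (cmod (\<sigma> \<xi>) powr p * cmod (F f \<xi> - F g \<xi>)))"
    proof (rule integral_mono[OF Lp_weight_integrable[OF \<sigma> h e]])
      have "F f \<in> borel_measurable \<mu>" "F g \<in> borel_measurable \<mu>"
        using F_L2(1) f(1) g(1) L2_measurable by auto
      then have m: "(\<lambda>\<xi>. cmod (\<sigma> \<xi>) powr p * cmod (F f \<xi> - F g \<xi>)) \<in> borel_measurable \<mu>"
        using \<sigma>(2) by (intro borel_measurable_times borel_measurable_norm borel_measurable_diff) auto
      have "integrable \<mu> (\<lambda>\<xi>. cmod (\<sigma> \<xi>) powr p * cmod (F f \<xi> - F g \<xi>))"
      proof (rule Bochner_Integration.integrable_bound[of _ "\<lambda>\<xi>. c\<^sub>K * L2norm \<mu> h * cmod (\<sigma> \<xi>) powr p", OF _ m])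
        show "AE \<xi> in \<mu>. norm (cmod (\<sigma> \<xi>) powr p * cmod (F f \<xi> - F g \<xi>)) \<le> norm (c\<^sub>K * L2norm \<mu> h * cmod (\<sigma> \<xi>) powr p)"
        proof (rule AE_I2)
          fix \<xi> assume "\<xi> \<in> space \<mu>"
          then have \<xi>: "\<xi> \<in> \<Omega>" by (simp add: space_mu)
          have "cmod (\<sigma> \<xi>) powr p * cmod (F f \<xi> - F g \<xi>) \<le> cmod (\<sigma> \<xi>) powr p * (c\<^sub>K * L2norm \<mu> h)"
            using F_bound[OF h \<xi>] unfolding Fh[OF \<xi>] by (intro mult_left_mono) auto
          then show "norm (cmod (\<sigma> \<xi>) powr p * cmod (F f \<xi> - F g \<xi>)) \<le> norm (c\<^sub>K * L2norm \<mu> h * cmod (\<sigma> \<xi>) powr p)"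
            using cK_nonneg by (simp add: abs_mult mult.commute)
        qed
      qed (use \<sigma>(2) in simp)
      then show "integrable \<mu> (\<lambda>\<xi>. c\<^sub>K * (cmod (\<sigma> \<xi>) powr p * cmod (F f \<xi> - F g \<xi>)))" by simp
      fix \<xi> assume "\<xi> \<in> space \<mu>"
      then have \<xi>: "\<xi> \<in> \<Omega>" by (simp add: space_mu)
      have "cmod (G e \<xi>) \<le> c\<^sub>K * (1 / 2)" using G_bound[OF e \<xi>] unfolding e2 .
      also have "\<dots> \<le> c\<^sub>K" using cK_nonneg by simp
      finally have "cmod (\<sigma> \<xi>) powr p * cmod (F h \<xi>) * cmod (G e \<xi>) \<le> cmod (\<sigma> \<xi>) powr p * cmod (F h \<xi>) * c\<^sub>K"
        by (intro mult_left_mono) auto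
      then show "cmod (\<sigma> \<xi>) powr p * (cmod (F h \<xi>) * cmod (G e \<xi>)) \<le> c\<^sub>K * (cmod (\<sigma> \<xi>) powr p * cmod (F f \<xi> - F g \<xi>))"
        by (simp add: Fh[OF \<xi>] mult_ac)
    qed
    finally show ?thesis by (simp add: N_def d_def)
  qed
qed

text \<open>Along a subsequence the transforms \<open>F (u k)\<close> converge pointwise. Being
  bounded by \<open>c\<^sub>K\<close>, they converge in L1 with weight |\<sigma>|^p, and the
  estimate for differences makes the images Cauchy in L2.\<close>

lemma W_compact_op:
  assumes p: "1 \<le> p" and \<sigma>: "\<sigma> \<in> borel_measurable \<mu>" "integrable \<mu> (\<lambda>\<xi>. cmod (\<sigma> \<xi>) powr p)"
  shows "L2_compact_op \<mu> (W \<sigma>)"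
proof -
  obtain C where C: "bounded_symbol \<sigma> C" using bounded_symbol_Lp[OF p \<sigma>] by blast
  have "\<exists>r. \<exists>w\<in>L2 \<mu>. strict_mono r \<and> (\<lambda>k. L2norm \<mu> (\<lambda>x. W \<sigma> (u (r k)) x - w x)) \<longlonglongrightarrow> 0"
    if u: "\<And>k. u k \<in> L2 \<mu>" "\<And>k. L2norm \<mu> (u k) \<le> 1" for u :: "nat \<Rightarrow> 'a \<Rightarrow> complex"
  proof -
    obtain r :: "nat \<Rightarrow> nat" and \<tau> where r: "strict_mono r" and \<tau>: "\<And>\<xi>. \<xi> \<in> \<Omega> \<Longrightarrow> (\<lambda>k. F (u (r k)) \<xi>) \<longlonglongrightarrow> \<tau> \<xi>"
      by (rule F_pointwise_convergent_subseq[of u, OF u]) (rule that)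
    have Fm: "F (u k) \<in> borel_measurable \<mu>" for k using F_L2(1)[OF u(1)] by (rule L2_measurable)
    have \<tau>m: "\<tau> \<in> borel_measurable \<mu>"
      by (rule borel_measurable_LIMSEQ_metric[of "\<lambda>k. F (u (r k))", OF Fm]) (simp add: \<tau> space_mu)
    have Fb: "cmod (F (u k) \<xi>) \<le> c\<^sub>K" if "\<xi> \<in> \<Omega>" for k \<xi>
      using F_bound[OF u(1) that, of k] mult_left_mono[OF u(2)[of k] cK_nonneg] by simp
    have \<tau>b: "cmod (\<tau> \<xi>) \<le> c\<^sub>K" if "\<xi> \<in> \<Omega>" for \<xi>
      by (rule tendsto_upperbound[OF tendsto_norm[OF \<tau>[OF that]]]) (use Fb that in auto)
    \<comment> \<open>Distances to the pointwise limit depend on one index, so dominated convergence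
      applies; differences of two members follow by the triangle inequality.\<close>
    let ?d = "\<lambda>k \<xi>. cmod (\<sigma> \<xi>) powr p * cmod (F (u (r k)) \<xi> - \<tau> \<xi>)"
    have dm: "?d k \<in> borel_measurable \<mu>" for k
      using borel_measurable_integrable[OF \<sigma>(2)] Fm[of "r k"] \<tau>m by measurable
    have w: "integrable \<mu> (\<lambda>\<xi>. cmod (\<sigma> \<xi>) powr p * (2 * c\<^sub>K))" using \<sigma>(2) by simp
    have db: "AE \<xi> in \<mu>. norm (?d k \<xi>) \<le> cmod (\<sigma> \<xi>) powr p * (2 * c\<^sub>K)" for k
    proof (rule AE_I2)
      fix \<xi> assume "\<xi> \<in> space \<mu>"
      then have \<xi>: "\<xi> \<in> \<Omega>" by (simp add: space_mu)
      have "cmod (F (u (r k)) \<xi> - \<tau> \<xi>) \<le> 2 * c\<^sub>K"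
        using norm_triangle_ineq4[of "F (u (r k)) \<xi>" "\<tau> \<xi>"] Fb[OF \<xi>, of "r k"] \<tau>b[OF \<xi>] by linarith
      then show "norm (?d k \<xi>) \<le> cmod (\<sigma> \<xi>) powr p * (2 * c\<^sub>K)"
        by (simp add: abs_mult mult_left_mono)
    qed
    have dlim: "AE \<xi> in \<mu>. (\<lambda>k. ?d k \<xi>) \<longlonglongrightarrow> 0"
    proof (rule AE_I2)
      fix \<xi> assume "\<xi> \<in> space \<mu>"
      then show "(\<lambda>k. ?d k \<xi>) \<longlonglongrightarrow> 0"
        using \<tau>[of \<xi>] by (intro tendsto_mult_right_zero tendsto_norm_zero LIM_zero) (simp add: space_mu)
    qed
    have "(\<lambda>k. LINT \<xi>|\<mu>. ?d k \<xi>) \<longlonglongrightarrow> (LINT \<xi>|\<mu>. 0)"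
      by (rule integral_dominated_convergence[OF _ dm w dlim db]) simp
    then have J0: "(\<lambda>k. c\<^sub>K * (LINT \<xi>|\<mu>. ?d k \<xi>)) \<longlonglongrightarrow> 0"
      by (intro tendsto_mult_right_zero) simp
    have di: "integrable \<mu> (?d k)" for k
      by (rule integrable_dominated_convergence2[OF _ dm w dlim db]) simp
    have bound: "(L2norm \<mu> (\<lambda>x. W \<sigma> (u (r k)) x - W \<sigma> (u (r l)) x) / 2) powr p
        \<le> c\<^sub>K * (LINT \<xi>|\<mu>. ?d k \<xi>) + c\<^sub>K * (LINT \<xi>|\<mu>. ?d l \<xi>)" for k l
    proof -
      have "(LINT \<xi>|\<mu>. cmod (\<sigma> \<xi>) powr p * cmod (F (u (r k)) \<xi> - F (u (r l)) \<xi>))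
          \<le> (LINT \<xi>|\<mu>. ?d k \<xi> + ?d l \<xi>)"
      proof (rule integral_mono')
        show "integrable \<mu> (\<lambda>\<xi>. ?d k \<xi> + ?d l \<xi>)" using di by simp
        fix \<xi>
        have "cmod (F (u (r k)) \<xi> - F (u (r l)) \<xi>) \<le> cmod (F (u (r k)) \<xi> - \<tau> \<xi>) + cmod (F (u (r l)) \<xi> - \<tau> \<xi>)"
          by (rule norm_diff_triangle_le[of _ "\<tau> \<xi>"]) (simp_all add: norm_minus_commute)
        then have "cmod (\<sigma> \<xi>) powr p * cmod (F (u (r k)) \<xi> - F (u (r l)) \<xi>)
            \<le> cmod (\<sigma> \<xi>) powr p * (cmod (F (u (r k)) \<xi> - \<tau> \<xi>) + cmod (F (u (r l)) \<xi> - \<tau> \<xi>))"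
          by (intro mult_left_mono) auto
        then show "cmod (\<sigma> \<xi>) powr p * cmod (F (u (r k)) \<xi> - F (u (r l)) \<xi>) \<le> ?d k \<xi> + ?d l \<xi>"
          by (simp only: distrib_left)
      qed simp
      then have "c\<^sub>K * (LINT \<xi>|\<mu>. cmod (\<sigma> \<xi>) powr p * cmod (F (u (r k)) \<xi> - F (u (r l)) \<xi>))
          \<le> c\<^sub>K * ((LINT \<xi>|\<mu>. ?d k \<xi>) + (LINT \<xi>|\<mu>. ?d l \<xi>))"
        using di cK_nonneg by (intro mult_left_mono) auto
      then show ?thesis
        using W_diff_norm_powr_le[OF p \<sigma> u(1) u(2) u(1) u(2), of "r k" "r l"] by (simp add: distrib_left)
    qed
    have cauchy: "\<exists>N. \<forall>k\<ge>N. \<forall>l\<ge>N. L2norm \<mu> (\<lambda>x. W \<sigma> (u (r k)) x - W \<sigma> (u (r l)) x) < \<epsilon>" if "0 < \<epsilon>" for \<epsilon>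
    proof -
      have "0 < (\<epsilon> / 2) powr p / 2" using that by simp
      then have "\<forall>\<^sub>F k in sequentially. c\<^sub>K * (LINT \<xi>|\<mu>. ?d k \<xi>) < (\<epsilon> / 2) powr p / 2"
        using order_tendstoD(2)[OF J0] by blast
      then obtain N where N: "\<And>k. N \<le> k \<Longrightarrow> c\<^sub>K * (LINT \<xi>|\<mu>. ?d k \<xi>) < (\<epsilon> / 2) powr p / 2"
        unfolding eventually_sequentially by blast
      have "L2norm \<mu> (\<lambda>x. W \<sigma> (u (r k)) x - W \<sigma> (u (r l)) x) < \<epsilon>" if "N \<le> k" "N \<le> l" for k l
      proof (rule ccontr)
        assume "\<not> ?thesis"
        then have "(\<epsilon> / 2) powr p \<le> (L2norm \<mu> (\<lambda>x. W \<sigma> (u (r k)) x - W \<sigma> (u (r l)) x) / 2) powr p"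
          using \<open>0 < \<epsilon>\<close> p by (intro powr_mono2) auto
        then show False using bound[of k l] N[OF that(1)] N[OF that(2)] by linarith
      qed
      then show ?thesis by blast
    qed
    obtain w where "w \<in> L2 \<mu>" "(\<lambda>k. L2norm \<mu> (\<lambda>x. W \<sigma> (u (r k)) x - w x)) \<longlonglongrightarrow> 0"
      using L2_complete[of "\<lambda>k. W \<sigma> (u (r k))", OF W_L2[OF C u(1)] cauchy] by blast
    then show ?thesis using r by blast
  qed
  then show ?thesis
    unfolding L2_compact_op_def using W_bounded_op[OF C] by blast
qed

section \<open>Schatten bound and uncertainty principle\<close>

lemma W_schatten_norm_le:
  assumes p: "1 \<le> p" and \<sigma>: "\<sigma> \<in> Lp_space p \<mu>"
  shows "is_wavelet_multiplier \<mu> K \<psi> \<sigma> \<phi> (W \<sigma>)" "W \<sigma> \<in> schatten_class p \<mu>"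
    "schatten_norm p \<mu> (W \<sigma>) \<le> (if p = \<infinity> then 1 else c\<^sub>K powr (2 / enn2real p)) * Lp_norm p \<mu> \<sigma>"
proof -
  have "is_wavelet_multiplier \<mu> K \<psi> \<sigma> \<phi> (W \<sigma>) \<and> W \<sigma> \<in> schatten_class p \<mu> \<and>
    schatten_norm p \<mu> (W \<sigma>) \<le> (if p = \<infinity> then 1 else c\<^sub>K powr (2 / enn2real p)) * Lp_norm p \<mu> \<sigma>"
  proof (cases "p = \<infinity>")
    case True
    have m: "\<sigma> \<in> borel_measurable \<mu>" using \<sigma> by (simp add: Lp_space_def)
    \<comment> \<open>Plancherel for both windows and m n \<le> 1 bound the form by the supremum of
      the symbol, so no kernel constant enters.\<close>
    have b: "bounded_symbol \<sigma> (Lp_norm \<infinity> \<mu> \<sigma>)"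
      using \<sigma> True by (intro bounded_symbol_bounded[OF m] Linf_norm_AE Linf_norm_nonneg) simp
    show ?thesis
      using W_is_wavelet_multiplier[OF b] W_bounded_op[OF b] W_opnorm[OF b] True
      by (simp add: schatten_class_def schatten_norm_def)
  next
    case False
    define q where "q = enn2real p"
    have q: "1 \<le> q"
      using enn2real_mono[OF p] False by (simp add: q_def less_top)
    have \<sigma>': "\<sigma> \<in> borel_measurable \<mu>" "integrable \<mu> (\<lambda>\<xi>. cmod (\<sigma> \<xi>) powr q)"
      using \<sigma> False by (auto simp: Lp_space_def q_def)
    obtain C where C: "bounded_symbol \<sigma> C" using bounded_symbol_Lp[OF q \<sigma>'] by blast
    define I where "I = (LINT \<xi>|\<mu>. cmod (\<sigma> \<xi>) powr q)"
    have I: "0 \<le> I" by (simp add: I_def)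
    have sum: "singular_power_sum q \<mu> (W \<sigma>) \<le> ennreal (c\<^sub>K\<^sup>2 * I)"
      unfolding I_def by (rule singular_power_sum_le[OF q \<sigma>'])
    have "enn2real (singular_power_sum q \<mu> (W \<sigma>)) \<le> c\<^sub>K\<^sup>2 * I"
      using enn2real_mono[OF sum] I by simp
    then have "enn2real (singular_power_sum q \<mu> (W \<sigma>)) powr (1 / q) \<le> (c\<^sub>K\<^sup>2 * I) powr (1 / q)"
      using q by (intro powr_mono2) auto
    also have "\<dots> = (c\<^sub>K\<^sup>2) powr (1 / q) * I powr (1 / q)"
      using I by (simp add: powr_mult)
    also have "(c\<^sub>K\<^sup>2) powr (1 / q) = c\<^sub>K powr (2 / q)"
    proof (cases "c\<^sub>K = 0")
      case False
      then have "c\<^sub>K\<^sup>2 = c\<^sub>K powr 2" using cK_nonneg by simp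
      then show ?thesis by (simp add: powr_powr)
    qed simp
    finally have "schatten_norm p \<mu> (W \<sigma>) \<le> c\<^sub>K powr (2 / q) * Lp_norm p \<mu> \<sigma>"
      using False by (simp add: schatten_norm_def Lp_norm_def q_def I_def)
    moreover have "W \<sigma> \<in> schatten_class p \<mu>"
      using False W_compact_op[OF q \<sigma>'] le_less_trans[OF sum ennreal_less_top]
      by (simp add: schatten_class_def q_def)
    ultimately show ?thesis using False W_is_wavelet_multiplier[OF C] by (simp add: q_def)
  qed
  then show "is_wavelet_multiplier \<mu> K \<psi> \<sigma> \<phi> (W \<sigma>)" "W \<sigma> \<in> schatten_class p \<mu>"
    "schatten_norm p \<mu> (W \<sigma>) \<le> (if p = \<infinity> then 1 else c\<^sub>K powr (2 / enn2real p)) * Lp_norm p \<mu> \<sigma>"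
    by blast+
qed

text \<open>Two bounds for the same operator, from the supremum and from the L1 norm of the symbol.
  The first carries an error through the operator, the second brings in the measure.\<close>

lemma bounded_symbol_indicator:
  assumes "S \<in> sets \<mu>" "emeasure \<mu> S < \<infinity>"
  shows "bounded_symbol (indicator S) 1" "bounded_symbol (indicator S) (c\<^sub>K\<^sup>2 * measure \<mu> S)"
proof -
  show "bounded_symbol (indicator S) 1"
    by (rule bounded_symbol_bounded) (use assms in \<open>auto simp: indicator_def\<close>)
  have "integrable \<mu> (indicator S :: 'a \<Rightarrow> real)"
    using assms sets.Int[OF assms(1) sets.top] by (simp add: integrable_indicator_iff)
  then have "integrable \<mu> (\<lambda>x. complex_of_real (indicator S x))" by simp
  moreover have "(\<lambda>x. complex_of_real (indicator S x)) = indicator S" by (auto simp: indicator_def)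
  ultimately have "integrable \<mu> (indicator S :: 'a \<Rightarrow> complex)" by (simp only:)
  from bounded_symbol_L1[OF this]
  have "bounded_symbol (indicator S) (c\<^sub>K\<^sup>2 * (LINT \<xi>|\<mu>. cmod (indicator S \<xi>)))" .
  moreover have "(LINT \<xi>|\<mu>. cmod (indicator S \<xi>)) = (LINT \<xi>|\<mu>. indicator S \<xi>)"
    by (rule Bochner_Integration.integral_cong) (auto simp: indicator_def)
  moreover have "(LINT \<xi>|\<mu>. indicator S \<xi>) = measure \<mu> S"
    using sets.sets_into_space[OF assms(1)] by (simp add: Int_absorb2)
  ultimately show "bounded_symbol (indicator S) (c\<^sub>K\<^sup>2 * measure \<mu> S)" by (simp only:)
qed

text \<open>Write f - A B f = (f - A f) + A (f - B f). As A has norm at most 1, the right side is at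
  most \<open>\<epsilon>\<^sub>1 + \<epsilon>\<^sub>2\<close> times the norm of f. The remainder has
  to come from A B f, whose two L1 bounds contribute \<open>c\<^sub>K\<^sup>2\<close> each, hence
  the fourth power.\<close>

lemma localized_measure_ge:
  assumes S: "S \<in> sets \<mu>" "emeasure \<mu> S < \<infinity>" and \<Sigma>: "\<Sigma> \<in> sets \<mu>" "emeasure \<mu> \<Sigma> < \<infinity>"
    and f: "f \<in> L2 \<mu>" "\<not> (AE x in \<mu>. f x = 0)"
    and loc: "localized \<mu> \<epsilon>\<^sub>1 (W (indicator S)) f" "localized \<mu> \<epsilon>\<^sub>2 (W (indicator \<Sigma>)) f"
  shows "c\<^sub>K powi (-4) * (1 - \<epsilon>\<^sub>1 - \<epsilon>\<^sub>2) \<le> measure \<mu> S * measure \<mu> \<Sigma>"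
proof -
  let ?A = "W (indicator S)" and ?B = "W (indicator \<Sigma>)"
  let ?N = "L2norm \<mu> f"
  have N: "0 < ?N" using L2norm_eq_0_iff[OF f(1)] f(2) L2norm_nonneg[of \<mu> f] by linarith
  note s = bounded_symbol_indicator[OF S] and t = bounded_symbol_indicator[OF \<Sigma>]
  have Bf: "?B f \<in> L2 \<mu>" using W_L2[OF t(1) f(1)] .
  have Af: "?A f \<in> L2 \<mu>" using W_L2[OF s(1) f(1)] .
  have ABf: "?A (?B f) \<in> L2 \<mu>" using W_L2[OF s(1) Bf] .
  have d: "(\<lambda>x. 1 * ?B f x + (- 1) * f x) \<in> L2 \<mu>" using Bf f(1) by (intro L2_add L2_scale)
  \<comment> \<open>Linearity of the multiplier holds only almost everywhere, so it is used through
    equality of norms.\<close>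
  have "AE x in \<mu>. ?A (\<lambda>x. 1 * ?B f x + (- 1) * f x) x = 1 * ?A (?B f) x + (- 1) * ?A f x"
    using W_bounded_op[OF s(1)] Bf f(1) unfolding L2_bounded_op_def by blast
  then have "L2norm \<mu> (\<lambda>x. ?A (?B f) x - ?A f x) = L2norm \<mu> (?A (\<lambda>x. 1 * ?B f x + (- 1) * f x))"
    using L2_measurable[OF W_L2[OF s(1) d]] L2_measurable[OF L2_diff[OF ABf Af]]
    by (intro L2norm_cong_AE) auto
  also have "\<dots> \<le> L2norm \<mu> (\<lambda>x. ?B f x - f x)"
    using W_norm[OF s(1) d] by simp
  also have "\<dots> \<le> \<epsilon>\<^sub>2 * ?N" using loc(2) by (simp add: localized_def)
  finally have 1: "L2norm \<mu> (\<lambda>x. ?A (?B f) x - ?A f x) \<le> \<epsilon>\<^sub>2 * ?N" .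
  have 2: "L2norm \<mu> (\<lambda>x. ?A f x - f x) \<le> \<epsilon>\<^sub>1 * ?N" using loc(1) by (simp add: localized_def)
  have "?N \<le> L2norm \<mu> (\<lambda>x. f x - ?A (?B f) x) + L2norm \<mu> (?A (?B f))"
    using L2norm_triangle[OF L2_diff[OF f(1) ABf] ABf] by simp
  also have "L2norm \<mu> (\<lambda>x. f x - ?A (?B f) x) \<le> \<epsilon>\<^sub>2 * ?N + \<epsilon>\<^sub>1 * ?N"
    unfolding L2norm_minus_commute[of \<mu> f]
    using L2norm_triangle_diff[OF ABf Af f(1)] 1 2 by linarith
  also have "L2norm \<mu> (?A (?B f)) \<le> c\<^sub>K\<^sup>2 * measure \<mu> S * (c\<^sub>K\<^sup>2 * measure \<mu> \<Sigma> * ?N)"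
    by (rule order_trans[OF W_norm[OF s(2) Bf]], rule mult_left_mono[OF W_norm[OF t(2) f(1)]]) simp
  finally have "(1 - \<epsilon>\<^sub>1 - \<epsilon>\<^sub>2) * ?N \<le> (c\<^sub>K ^ 4 * (measure \<mu> S * measure \<mu> \<Sigma>)) * ?N"
    by (simp add: algebra_simps power4_eq_xxxx power2_eq_square)
  then have le: "1 - \<epsilon>\<^sub>1 - \<epsilon>\<^sub>2 \<le> c\<^sub>K ^ 4 * (measure \<mu> S * measure \<mu> \<Sigma>)"
    using N by (simp add: mult_le_cancel_right)
  show ?thesis
  \<comment> \<open>At \<open>c\<^sub>K = 0\<close> the negative power is 0 by the convention for
    division, and the claim only says that a product of measures is nonnegative.\<close>
  proof (cases "c\<^sub>K = 0")
    case False
    then have "0 < c\<^sub>K ^ 4" using cK_nonneg by simp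
    then show ?thesis using le by (simp add: power_int_minus field_simps)
  qed simp
qed

end

theorem theoremC:
  fixes \<Omega> :: "'a::euclidean_space set"
    and \<mu> :: "'a measure"
    and a :: real
    and Q :: "'a \<Rightarrow> real"
    and K :: "'a \<Rightarrow> 'a \<Rightarrow> complex"
    and c\<^sub>K :: real
    and \<phi> \<psi> \<sigma> :: "'a \<Rightarrow> complex"
    and p :: ennreal
    and S \<Sigma> :: "'a set"
    and \<epsilon>\<^sub>1 \<epsilon>\<^sub>2 :: real
  assumes "homogeneous_transform \<Omega> \<mu> a Q K c\<^sub>K"
    and "\<phi> \<in> Lp_space 2 \<mu> \<inter> Lp_space \<infinity> \<mu>" and "\<psi> \<in> Lp_space 2 \<mu> \<inter> Lp_space \<infinity> \<mu>"
    and "Lp_norm 2 \<mu> \<phi> = 1" and "Lp_norm 2 \<mu> \<psi> = 1"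
    and "Lp_norm \<infinity> \<mu> \<phi> * Lp_norm \<infinity> \<mu> \<psi> = 1"
    and "1 \<le> p" and "\<sigma> \<in> Lp_space p \<mu>"
    and "S \<in> sets \<mu>" and "0 < emeasure \<mu> S" and "emeasure \<mu> S < \<infinity>"
    and "\<Sigma> \<in> sets \<mu>" and "0 < emeasure \<mu> \<Sigma>" and "emeasure \<mu> \<Sigma> < \<infinity>"
    and "\<epsilon>\<^sub>1 \<in> {0<..<1}" and "\<epsilon>\<^sub>2 \<in> {0<..<1}" and "\<epsilon>\<^sub>1 + \<epsilon>\<^sub>2 < 1"
  shows "(is_wavelet_multiplier \<mu> K \<psi> \<sigma> \<phi> (wavelet_multiplier \<mu> K \<psi> \<sigma> \<phi>) \<and>
          wavelet_multiplier \<mu> K \<psi> \<sigma> \<phi> \<in> schatten_class p \<mu> \<and>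
          schatten_norm p \<mu> (wavelet_multiplier \<mu> K \<psi> \<sigma> \<phi>)
            \<le> (if p = \<infinity> then 1 else c\<^sub>K powr (2 / enn2real p)) * Lp_norm p \<mu> \<sigma>) \<and>
         (\<forall>f \<in> Lp_space 2 \<mu>.
            \<not> (AE x in \<mu>. f x = 0) \<longrightarrow>
            localized \<mu> \<epsilon>\<^sub>1 (wavelet_multiplier \<mu> K \<psi> (indicator S) \<phi>) f \<longrightarrow>
            localized \<mu> \<epsilon>\<^sub>2 (wavelet_multiplier \<mu> K \<psi> (indicator \<Sigma>) \<phi>) f \<longrightarrow>
            measure \<mu> S * measure \<mu> \<Sigma> \<ge> c\<^sub>K powi (-4) * (1 - \<epsilon>\<^sub>1 - \<epsilon>\<^sub>2))"
proof -
  interpret homogeneous_transform \<Omega> \<mu> a Q K c\<^sub>K by fact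
  \<comment> \<open>The essential supremum norms serve as bounds of the windows, and their product 1
    supplies m n \<le> 1.\<close>
  interpret wavelet_windows \<Omega> \<mu> a Q K c\<^sub>K \<phi> \<psi> "Lp_norm \<infinity> \<mu> \<phi>" "Lp_norm \<infinity> \<mu> \<psi>"
  proof unfold_locales
    show "window \<phi> (Lp_norm \<infinity> \<mu> \<phi>)" "window \<psi> (Lp_norm \<infinity> \<mu> \<psi>)"
      using assms(2-5) Linf_norm_AE[of \<phi> \<mu>] Linf_norm_AE[of \<psi> \<mu>] Linf_norm_nonneg[of \<mu>]
      by (auto simp: window_def)
  qed (use assms(6) in simp)
  show ?thesis
    using W_schatten_norm_le[OF assms(7,8)] localized_measure_ge[OF assms(9,11,12,14)] by blast
qed

end
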